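(* Unless $\mathbf{P}=\mathbf{NP}$, for every $\varepsilon\in(0,1)$ the optimization problem $(\mathbf{DiNDP})$ is not approximable within $|V|^{(1-\varepsilon)}$; that is, there is no polynomial-time algorithm that computes, for every instance, a subset $E'\subseteq E$ with $w(E')\le\beta$ and $R((V,E'))\le|V|^{(1-\varepsilon)}R^*$, where $R^*$ is the minimum of $R((V,E''))$ over all $E''\subseteq E$ with $w(E'')\le\beta$.
   Context: Let $G=(V,E)$ be a finite directed graph with weight and distance functions $w,d:E\to\mathbb{Z}_{\ge 0}$. The distance $\mathrm{dist}(u,v)$ is the length with respect to $d$ of a shortest directed path from $u$ to $v$, with $\mathrm{dist}(u,v)=\infty$ if no directed path exists. For $E'\subseteq E$, let $w(E')=\sum_{e\in E'}w(e)$ and let the total routing costs be $R((V,E'))=\sum_{u,v\in V}\mathrm{dist}|_{(V,E')}(u,v)$, with distances computed in $(V,E')$. Optimization problem $(\mathbf{DiNDP})$. Instance: a directed graph $G=(V,E,w,d)$ with $w,d:E\to\mathbb{Z}_{\ge 0}$ and $\beta\in\mathbb{Z}_{\ge 0}$. Task: find $E'\subseteq E$ with $w(E')\le\beta$ such that $R((V,E'))$ is minimal. *)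

theory Defs
  imports
    Complex_Main
    "HOL-Library.Extended_Real"
    "HOL-Computational_Algebra.Polynomial"
    "Graph_Theory.Pair_Digraph"
    "Graph_Theory.Shortest_Path"
begin

section \<open>Deterministic multi-tape Turing machines\<close>

text \<open>
  Tapes are infinite in both directions. Tape symbols are natural numbers, where 0 is the blank,
  1 and 2 are the bits, and the remaining symbols below \<open>num_symbols\<close> are at the machine's
  disposal. The working states are \<open>0, \<dots>, num_states - 1\<close>, the initial state is 0, and
  \<open>num_states\<close> itself is the halting state. The table \<open>delta\<close> maps a working state and the list of
  scanned symbols (one for each tape) to the next state and, for each tape, the symbol to be
  written and the head movement.
\<close>

datatype head_move = Move_Left | Stay | Move_Right

record turing_machine =
  num_tapes :: nat
  num_symbols :: nat
  num_states :: nat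
  delta :: "nat \<Rightarrow> nat list \<Rightarrow> nat \<times> (nat \<times> head_move) list"

definition wf_tm :: "turing_machine \<Rightarrow> bool" where
  "wf_tm M \<longleftrightarrow>
     num_tapes M \<ge> 1 \<and> num_symbols M \<ge> 3 \<and>
     (\<forall>q < num_states M. \<forall>ss. length ss = num_tapes M \<and> set ss \<subseteq> {..<num_symbols M} \<longrightarrow>
        fst (delta M q ss) \<le> num_states M \<and>
        length (snd (delta M q ss)) = num_tapes M \<and>
        (\<forall>(s, m) \<in> set (snd (delta M q ss)). s < num_symbols M))"

type_synonym tape = "(int \<Rightarrow> nat) \<times> int"  \<comment> \<open>cell contents and head position\<close>
type_synonym config = "nat \<times> tape list"

definition scanned :: "tape \<Rightarrow> nat" where
  "scanned T = fst T (snd T)"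

fun offset :: "head_move \<Rightarrow> int" where
  "offset Move_Left = -1"
| "offset Stay = 0"
| "offset Move_Right = 1"

fun act :: "nat \<times> head_move \<Rightarrow> tape \<Rightarrow> tape" where
  "act (s, m) (c, p) = (c(p := s), p + offset m)"

fun tm_step :: "turing_machine \<Rightarrow> config \<Rightarrow> config" where
  "tm_step M (q, Ts) =
     (if q < num_states M
      then let (q', acts) = delta M q (map scanned Ts) in (q', map2 act acts Ts)
      else (q, Ts))"

definition bit_symbol :: "bool \<Rightarrow> nat" where
  "bit_symbol b = (if b then 2 else 1)"

definition blank_tape :: tape where
  "blank_tape = (\<lambda>_. 0, 0)"

definition input_tape :: "bool list \<Rightarrow> tape" where
  "input_tape x =
     (\<lambda>i. if 0 \<le> i \<and> i < int (length x) then bit_symbol (x ! nat i) else 0, 0)"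

definition initial_config :: "turing_machine \<Rightarrow> bool list \<Rightarrow> config" where
  "initial_config M x = (0, input_tape x # replicate (num_tapes M - 1) blank_tape)"

text \<open>
  The output is read from the first tape, from cell 0 up to the first blank. The position of the
  head and the contents of the cells further right or left of cell 0 are irrelevant.
\<close>

definition tape_holds :: "tape \<Rightarrow> bool list \<Rightarrow> bool" where
  "tape_holds T y \<longleftrightarrow>
     (\<forall>i < length y. fst T (int i) = bit_symbol (y ! i)) \<and> fst T (int (length y)) = 0"

definition halts_with_output :: "turing_machine \<Rightarrow> config \<Rightarrow> bool list \<Rightarrow> bool" where
  "halts_with_output M c y \<longleftrightarrow> fst c = num_states M \<and> tape_holds (hd (snd c)) y"


section \<open>Polynomial time\<close>

definition poly_time_computable :: "(bool list \<Rightarrow> bool list) \<Rightarrow> bool" where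
  "poly_time_computable f \<longleftrightarrow>
     (\<exists>M (p :: nat poly). wf_tm M \<and>
        (\<forall>x. \<exists>t \<le> poly p (length x).
           halts_with_output M ((tm_step M ^^ t) (initial_config M x)) (f x)))"

text \<open>A prefix-free encoding of bit strings: every bit is preceded by a 1, and a 0 ends the string.\<close>

definition delimited :: "bool list \<Rightarrow> bool list" where
  "delimited x = concat (map (\<lambda>b. [True, b]) x) @ [False]"

definition encode_pair :: "bool list \<Rightarrow> bool list \<Rightarrow> bool list" where
  "encode_pair x y = delimited x @ y"

definition class_P :: "bool list set set" where
  "class_P = {L. poly_time_computable (\<lambda>x. [x \<in> L])}"

definition class_NP :: "bool list set set" where
  "class_NP =
     {L. \<exists>V \<in> class_P. \<exists>p :: nat poly. \<forall>x.
           x \<in> L \<longleftrightarrow> (\<exists>y. length y \<le> poly p (length x) \<and> encode_pair x y \<in> V)}"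


section \<open>The network design problem\<close>

text \<open>
  The graph is a set of vertices with a binary relation of arcs, the distance is \<open>\<mu>\<close> from
  the graph library, which is infinite if there is no path, and the sum ranges over all ordered
  pairs of vertices.
\<close>

definition routing_cost :: "'a pair_pre_digraph \<Rightarrow> ('a \<times> 'a \<Rightarrow> nat) \<Rightarrow> ereal" where
  "routing_cost G d =
     (\<Sum>u \<in> pverts G. \<Sum>v \<in> pverts G. wf_digraph.\<mu> (with_proj G) (\<lambda>e. real (d e)) u v)"

record 'a dindp_instance =
  inst_graph :: "'a pair_pre_digraph"
  inst_weight :: "'a \<times> 'a \<Rightarrow> nat"
  inst_dist :: "'a \<times> 'a \<Rightarrow> nat"
  inst_budget :: nat

definition feasible :: "'a dindp_instance \<Rightarrow> ('a \<times> 'a) set \<Rightarrow> bool" where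
  "feasible I E' \<longleftrightarrow>
     E' \<subseteq> parcs (inst_graph I) \<and> (\<Sum>e \<in> E'. inst_weight I e) \<le> inst_budget I"

definition solution_cost :: "'a dindp_instance \<Rightarrow> ('a \<times> 'a) set \<Rightarrow> ereal" where
  "solution_cost I E' =
     routing_cost \<lparr>pverts = pverts (inst_graph I), parcs = E'\<rparr> (inst_dist I)"

definition optimal_cost :: "'a dindp_instance \<Rightarrow> ereal" where
  "optimal_cost I = Min {solution_cost I E' | E'. feasible I E'}"

text \<open>
  As inputs to algorithms, graphs have the vertices \<open>0, \<dots>, n - 1\<close> and are given by their
  adjacency matrix, in row-major order, where every entry that is an arc carries the binary
  representations of its weight and its distance. Sets of arcs are output as plain 0-1 adjacency
  matrices.
\<close>

definition dindp_input :: "nat dindp_instance \<Rightarrow> bool" where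
  "dindp_input I \<longleftrightarrow>
     pair_fin_digraph (inst_graph I) \<and> (\<exists>n. pverts (inst_graph I) = {..<n})"

fun binary :: "nat \<Rightarrow> bool list" where  \<comment> \<open>least significant bit first\<close>
  "binary n = (if n = 0 then [] else odd n # binary (n div 2))"

declare binary.simps [simp del]

definition encode_nat :: "nat \<Rightarrow> bool list" where
  "encode_nat n = delimited (binary n)"

definition encode_instance :: "nat dindp_instance \<Rightarrow> bool list" where
  "encode_instance I =
     (let n = card (pverts (inst_graph I)) in
        replicate n True @ [False] @
        concat (map (\<lambda>e. if e \<in> parcs (inst_graph I)
                         then True # encode_nat (inst_weight I e) @ encode_nat (inst_dist I e)
                         else [False])
                 (List.product [0..<n] [0..<n])) @
        encode_nat (inst_budget I))"

definition encode_arcs :: "nat \<Rightarrow> (nat \<times> nat) set \<Rightarrow> bool list" where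
  "encode_arcs n E' = map (\<lambda>e. e \<in> E') (List.product [0..<n] [0..<n])"

definition dindp_approx_algorithm :: "(nat \<Rightarrow> real) \<Rightarrow> (bool list \<Rightarrow> bool list) \<Rightarrow> bool" where
  "dindp_approx_algorithm r f \<longleftrightarrow>
     (\<forall>I. dindp_input I \<longrightarrow>
        (\<exists>E'. f (encode_instance I) = encode_arcs (card (pverts (inst_graph I))) E' \<and>
              feasible I E' \<and>
              solution_cost I E' \<le> ereal (r (card (pverts (inst_graph I)))) * optimal_cost I))"

end

theory Submission
  imports Defs
begin

text \<open>
  Let \<open>L\<close> be in NP with a polynomial-time verifier \<open>M\<close>. As in the Cook-Levin theorem, the
  computations of \<open>M\<close> on an input \<open>x\<close> and a guessed string are described by clauses over
  polynomially many variables. The clauses become a network design instance: buying the arc from a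
  root to a literal makes the literal true and costs weight \<open>2 ^ v\<close> for variable \<open>v\<close>, so that the
  budget \<open>2 ^ m - 1\<close> pays for exactly one literal of each of the \<open>m\<close> variables. True literals reach
  their clauses at distance 0, and everything else is reached through a relay at distance 1. Every
  clause has \<open>N\<close> copies, so that one violated clause forces about \<open>N ^ 2\<close> pairs of vertices to pay
  for the relay, whereas a satisfying assignment leaves only the literals at distance 1. If \<open>N\<close> is a
  large power of the size of the formula, an approximation within \<open>n powr (1 - \<epsilon>)\<close> has to buy
  a satisfying assignment. So a guessed string can be read off the computed set of arcs, and running
  \<open>M\<close> on it decides \<open>L\<close>.
\<close>

section \<open>Programs for multi-tape machines\<close>

text \<open>Polynomial time refers to a concrete Turing machine, so the reduction itself has to be
  run by one, and this shapes the instance. Weights \<open>2 ^ v\<close> and the budget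
  \<open>2 ^ m - 1\<close> have binary forms that loops over tapes can write without arithmetic:
  zeros and a final one, or ones only. Indexing the tapes relative to the heads confines each clause
  to one column, its neighbours and the center, so the number of clause kinds depends on the
  verifier alone and a test of a few scanned symbols decides which literals a clause contains.
  Tautologies containing both literals of a variable force the purchase of at least one of them;
  only then does the budget exclude buying both. The number of copies is \<open>N = Z ^ k\<close>
  with \<open>k * \<epsilon> \<ge> 1\<close>: the ratio falls short of the number of vertices by a
  factor of at least \<open>N powr \<epsilon> \<ge> Z\<close>, up to constants and clause counts,
  and the polynomial \<open>Z\<close> dominates those. If \<open>x\<close> is not in
  \<open>L\<close>, nothing is asked of the computed arcs: the string read off is verified in any
  case, so a false acceptance cannot occur.\<close>

datatype com =
    Prim turing_machine
  | Seq com com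
  | If "nat list" "nat list \<Rightarrow> bool" com com
  | While "nat list" "nat list \<Rightarrow> bool" com

definition test :: "nat list \<Rightarrow> (nat list \<Rightarrow> bool) \<Rightarrow> nat list \<Rightarrow> bool" where
  "test js P ss \<longleftrightarrow> P (map ((!) ss) js)"

abbreviation stay :: "nat list \<Rightarrow> (nat \<times> head_move) list" where
  "stay ss \<equiv> map (\<lambda>s. (s, Stay)) ss"

fun nst :: "com \<Rightarrow> nat" where
  "nst (Prim M) = num_states M"
| "nst (Seq a b) = nst a + nst b"
| "nst (If js P a b) = 1 + nst a + nst b"
| "nst (While js P a) = 1 + nst a"

text \<open>Components occupy consecutive intervals of states, and \<open>nst c\<close> is the exit.
  In \<open>Seq\<close> the exit of \<open>a\<close> is the entry of \<open>b\<close>. In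
  \<open>If\<close> and \<open>While\<close> state 0 performs the test without touching the tapes.
  There, shifting states by one would send the exit of \<open>a\<close> to the entry of
  \<open>b\<close>, or out of the loop; so this one value is redirected to the common exit, or back
  to the test.\<close>

fun code :: "com \<Rightarrow> nat \<Rightarrow> nat list \<Rightarrow> nat \<times> (nat \<times> head_move) list" where
  "code (Prim M) q ss = delta M q ss"
| "code (Seq a b) q ss =
     (if q < nst a then code a q ss
      else apfst (\<lambda>r. nst a + r) (code b (q - nst a) ss))"
| "code (If js P a b) q ss =
     (if q = 0 then (if test js P ss then 1 else 1 + nst a, stay ss)
      else if q \<le> nst a
        then apfst (\<lambda>r. if r = nst a then 1 + nst a + nst b else 1 + r) (code a (q - 1) ss)
      else apfst (\<lambda>r. 1 + nst a + r) (code b (q - 1 - nst a) ss))"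
| "code (While js P a) q ss =
     (if q = 0 then (if test js P ss then 1 else 1 + nst a, stay ss)
      else apfst (\<lambda>r. if r = nst a then 0 else 1 + r) (code a (q - 1) ss))"

text \<open>
  \<open>cost B c\<close> bounds the running time when \<open>B\<close> bounds both the number of iterations of every loop
  and the running time of every embedded machine. It is a polynomial in \<open>B\<close>.
\<close>

fun cost :: "nat \<Rightarrow> com \<Rightarrow> nat" where
  "cost B (Prim M) = B"
| "cost B (Seq a b) = cost B a + cost B b"
| "cost B (If js P a b) = 1 + cost B a + cost B b"
| "cost B (While js P a) = B * (1 + cost B a) + 1"

definition machine :: "nat \<Rightarrow> nat \<Rightarrow> com \<Rightarrow> turing_machine" where
  "machine K S c = \<lparr>num_tapes = K, num_symbols = S, num_states = nst c, delta = code c\<rparr>"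

section \<open>Well-formedness of compiled programs\<close>

definition wf_delta ::
    "nat \<Rightarrow> nat \<Rightarrow> nat \<Rightarrow> (nat \<Rightarrow> nat list \<Rightarrow> nat \<times> (nat \<times> head_move) list) \<Rightarrow> bool" where
  "wf_delta K S n \<delta> \<longleftrightarrow>
     (\<forall>q < n. \<forall>ss. length ss = K \<and> set ss \<subseteq> {..<S} \<longrightarrow>
        fst (\<delta> q ss) \<le> n \<and> length (snd (\<delta> q ss)) = K \<and>
        (\<forall>(s, m) \<in> set (snd (\<delta> q ss)). s < S))"

text \<open>The entry state of a branch must differ from its exit state, hence the positivity conditions.\<close>

fun wf_com :: "nat \<Rightarrow> nat \<Rightarrow> com \<Rightarrow> bool" where
  "wf_com K S (Prim M) \<longleftrightarrow> wf_delta K S (num_states M) (delta M)"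
| "wf_com K S (Seq a b) \<longleftrightarrow> wf_com K S a \<and> wf_com K S b"
| "wf_com K S (If js P a b) \<longleftrightarrow> 0 < nst a \<and> wf_com K S a \<and> wf_com K S b"
| "wf_com K S (While js P a) \<longleftrightarrow> 0 < nst a \<and> wf_com K S a"

lemma wf_deltaD:
  assumes "wf_delta K S n \<delta>" "q < n" "length ss = K" "set ss \<subseteq> {..<S}"
  shows "fst (\<delta> q ss) \<le> n" "length (snd (\<delta> q ss)) = K"
    "\<forall>(s, m) \<in> set (snd (\<delta> q ss)). s < S"
  using assms by (auto simp: wf_delta_def)

lemma wf_code: "wf_com K S c \<Longrightarrow> wf_delta K S (nst c) (code c)"
proof (induction c)
  case (Prim M)
  then show ?case by (simp add: wf_delta_def)
next
  case (Seq a b)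
  then have a: "wf_delta K S (nst a) (code a)" and b: "wf_delta K S (nst b) (code b)" by auto
  show ?case unfolding wf_delta_def
  proof (intro allI impI, elim conjE)
    fix q ss assume q: "q < nst (Seq a b)" and ss: "length ss = K" "set ss \<subseteq> {..<S}"
    show "fst (code (Seq a b) q ss) \<le> nst (Seq a b) \<and> length (snd (code (Seq a b) q ss)) = K \<and>
       (\<forall>(s, m)\<in>set (snd (code (Seq a b) q ss)). s < S)"
    proof (cases "q < nst a")
      case True
      show ?thesis using wf_deltaD[OF a True ss] True by auto
    next
      case False
      then have "q - nst a < nst b" using q by auto
      from wf_deltaD[OF b this ss] False show ?thesis by auto
    qed
  qed
next
  case (If js P a b)
  then have a: "wf_delta K S (nst a) (code a)" and b: "wf_delta K S (nst b) (code b)" by auto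
  show ?case unfolding wf_delta_def
  proof (intro allI impI, elim conjE)
    fix q ss assume q: "q < nst (If js P a b)" and ss: "length ss = K" "set ss \<subseteq> {..<S}"
    consider "q = 0" | "0 < q" "q \<le> nst a" | "q > nst a" by linarith
    then show "fst (code (If js P a b) q ss) \<le> nst (If js P a b) \<and>
       length (snd (code (If js P a b) q ss)) = K \<and>
       (\<forall>(s, m)\<in>set (snd (code (If js P a b) q ss)). s < S)"
    proof cases
      case 1
      then show ?thesis using ss by auto
    next
      case 2
      then have "q - 1 < nst a" by auto
      from wf_deltaD[OF a this ss] 2 show ?thesis by auto
    next
      case 3
      then have "q - 1 - nst a < nst b" using q by auto
      from wf_deltaD[OF b this ss] 3 show ?thesis by auto
    qed
  qed
next
  case (While js P a)
  then have a: "wf_delta K S (nst a) (code a)" by auto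
  show ?case unfolding wf_delta_def
  proof (intro allI impI, elim conjE)
    fix q ss assume q: "q < nst (While js P a)" and ss: "length ss = K" "set ss \<subseteq> {..<S}"
    show "fst (code (While js P a) q ss) \<le> nst (While js P a) \<and>
       length (snd (code (While js P a) q ss)) = K \<and>
       (\<forall>(s, m)\<in>set (snd (code (While js P a) q ss)). s < S)"
    proof (cases "q = 0")
      case True
      then show ?thesis using ss by auto
    next
      case False
      then have "q - 1 < nst a" using q by auto
      from wf_deltaD[OF a this ss] False show ?thesis by auto
    qed
  qed
qed

lemma wf_machine: "wf_com K S c \<Longrightarrow> 1 \<le> K \<Longrightarrow> 3 \<le> S \<Longrightarrow> wf_tm (machine K S c)"
  using wf_code[of K S c] by (simp add: wf_tm_def machine_def wf_delta_def)

text \<open>A single step depends neither on the declared number of tapes nor on the alphabet, so 0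
  stands for both.\<close>

definition mstep :: "com \<Rightarrow> config \<Rightarrow> config" where
  "mstep c = tm_step (machine 0 0 c)"

lemma mstep_simp:
  "mstep c (q, Ts) =
     (if q < nst c
      then (fst (code c q (map scanned Ts)), map2 act (snd (code c q (map scanned Ts))) Ts)
      else (q, Ts))"
  by (auto simp: mstep_def machine_def split: prod.splits)

lemma tm_step_machine: "tm_step (machine K S c) = mstep c"
  by (rule ext) (auto simp: mstep_def machine_def split: prod.splits)

lemma map2_act_stay: "map2 act (stay (map scanned Ts)) Ts = Ts"
  by (induction Ts) (auto simp: scanned_def)

text \<open>\<open>f\<close> renames the states of a component inside the whole program. Agreement
  can be demanded only before the component halts, since afterwards it idles while the whole program
  goes on. The count therefore stops at the first arrival in \<open>nst a\<close>, which is why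
  \<open>t\<close> may shrink to \<open>t'\<close>.\<close>

lemma mstep_simulation:
  assumes sim: "\<And>q Ts. q < nst a \<Longrightarrow> mstep c (f q, Ts) = apfst f (mstep a (q, Ts))"
  shows "(mstep a ^^ t) (q, Ts) = (nst a, Ts') \<Longrightarrow>
    \<exists>t' \<le> t. (mstep c ^^ t') (f q, Ts) = (f (nst a), Ts')"
proof (induction t arbitrary: q Ts)
  case 0
  then show ?case by auto
next
  case (Suc t)
  show ?case
  proof (cases "q < nst a")
    case True
    obtain q1 Ts1 where s: "mstep a (q, Ts) = (q1, Ts1)" by (cases "mstep a (q, Ts)")
    then have "(mstep a ^^ t) (q1, Ts1) = (nst a, Ts')"
      using Suc.prems by (simp add: funpow_Suc_right del: funpow.simps)
    from Suc.IH[OF this] obtain t' where t': "t' \<le> t" "(mstep c ^^ t') (f q1, Ts1) = (f (nst a), Ts')"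
      by auto
    have "(mstep c ^^ Suc t') (f q, Ts) = (f (nst a), Ts')"
      using t' sim[OF True, of Ts] s by (simp add: funpow_Suc_right del: funpow.simps)
    then show ?thesis using t'(1) by (metis Suc_le_mono)
  next
    case False
    then have "mstep a (q, Ts) = (q, Ts)" by (simp add: mstep_simp)
    then have "(mstep a ^^ u) (q, Ts) = (q, Ts)" for u by (induction u) auto
    from this[of "Suc t"] have "q = nst a" "Ts = Ts'" using Suc.prems by (auto simp del: funpow.simps)
    then show ?thesis by (intro exI[of _ 0]) auto
  qed
qed

definition runs :: "com \<Rightarrow> tape list \<Rightarrow> nat \<Rightarrow> tape list \<Rightarrow> bool" where
  "runs c Ts b Ts' \<longleftrightarrow> (\<exists>t \<le> b. (mstep c ^^ t) (0, Ts) = (nst c, Ts'))"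

lemma runs_Seq:
  assumes "runs a Ts t Ts1" "runs b Ts1 u Ts2"
  shows "runs (Seq a b) Ts (t + u) Ts2"
proof -
  obtain t' where t': "t' \<le> t" "(mstep a ^^ t') (0, Ts) = (nst a, Ts1)"
    using assms(1) by (auto simp: runs_def)
  have "\<exists>s \<le> t'. (mstep (Seq a b) ^^ s) (id 0, Ts) = (id (nst a), Ts1)"
    by (rule mstep_simulation[OF _ t'(2)]) (auto simp: mstep_simp)
  then obtain s where s: "s \<le> t'" "(mstep (Seq a b) ^^ s) (0, Ts) = (nst a, Ts1)" by auto
  obtain u' where u': "u' \<le> u" "(mstep b ^^ u') (0, Ts1) = (nst b, Ts2)"
    using assms(2) by (auto simp: runs_def)
  have "\<exists>r \<le> u'. (mstep (Seq a b) ^^ r) (nst a + 0, Ts1) = (nst a + nst b, Ts2)"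
    by (rule mstep_simulation[OF _ u'(2)]) (auto simp: mstep_simp)
  then obtain r where r: "r \<le> u'" "(mstep (Seq a b) ^^ r) (nst a, Ts1) = (nst a + nst b, Ts2)" by auto
  have "(mstep (Seq a b) ^^ (r + s)) (0, Ts) = (nst (Seq a b), Ts2)"
    using s r by (simp add: funpow_add)
  moreover have "r + s \<le> t + u" using s r t' u' by auto
  ultimately show ?thesis unfolding runs_def by blast
qed

lemma runs_If:
  assumes "if test js P (map scanned Ts) then runs a Ts t Ts' \<and> 0 < nst a else runs b Ts t Ts'"
  shows "runs (If js P a b) Ts (1 + t) Ts'"
proof (cases "test js P (map scanned Ts)")
  case True
  then obtain t' where t': "t' \<le> t" "(mstep a ^^ t') (0, Ts) = (nst a, Ts')" and pos: "0 < nst a"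
    using assms by (auto simp: runs_def)
  let ?f = "\<lambda>r. if r = nst a then 1 + nst a + nst b else 1 + r"
  have "\<exists>s \<le> t'. (mstep (If js P a b) ^^ s) (?f 0, Ts) = (?f (nst a), Ts')"
    by (rule mstep_simulation[OF _ t'(2)]) (auto simp: mstep_simp)
  then obtain s where s: "s \<le> t'" "(mstep (If js P a b) ^^ s) (1, Ts) = (nst (If js P a b), Ts')"
    using pos by auto
  have "mstep (If js P a b) (0, Ts) = (1, Ts)"
    using True by (simp add: mstep_simp map2_act_stay del: map_map)
  then have "(mstep (If js P a b) ^^ Suc s) (0, Ts) = (nst (If js P a b), Ts')"
    using s by (simp add: funpow_Suc_right del: funpow.simps)
  then show ?thesis unfolding runs_def using s t' by (intro exI[of _ "Suc s"]) auto
next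
  case False
  then obtain t' where t': "t' \<le> t" "(mstep b ^^ t') (0, Ts) = (nst b, Ts')"
    using assms by (auto simp: runs_def)
  have "\<exists>s \<le> t'. (mstep (If js P a b) ^^ s) (1 + nst a + 0, Ts) = (1 + nst a + nst b, Ts')"
    by (rule mstep_simulation[OF _ t'(2)]) (auto simp: mstep_simp)
  then obtain s where s: "s \<le> t'" "(mstep (If js P a b) ^^ s) (1 + nst a, Ts) = (nst (If js P a b), Ts')"
    by auto
  have "mstep (If js P a b) (0, Ts) = (1 + nst a, Ts)"
    using False by (simp add: mstep_simp map2_act_stay del: map_map)
  then have "(mstep (If js P a b) ^^ Suc s) (0, Ts) = (nst (If js P a b), Ts')"
    using s by (simp add: funpow_Suc_right del: funpow.simps)
  then show ?thesis unfolding runs_def using s t' by (intro exI[of _ "Suc s"]) auto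
qed

lemma runs_While:
  assumes pos: "0 < nst a"
    and "\<And>i. i < n \<Longrightarrow> test js P (map scanned (Ts i)) \<and> runs a (Ts i) t (Ts (Suc i))"
    and "\<not> test js P (map scanned (Ts n))"
  shows "runs (While js P a) (Ts 0) (n * (1 + t) + 1) (Ts n)"
  using assms(2,3)
proof (induction n arbitrary: Ts)
  case 0
  then have "mstep (While js P a) (0, Ts 0) = (nst (While js P a), Ts 0)"
    by (simp add: mstep_simp map2_act_stay del: map_map)
  then show ?case unfolding runs_def by (intro exI[of _ 1]) simp
next
  case (Suc n)
  obtain t' where t': "t' \<le> t" "(mstep a ^^ t') (0, Ts 0) = (nst a, Ts 1)"
    and T: "test js P (map scanned (Ts 0))"
    using Suc.prems(1)[of 0] by (auto simp: runs_def)
  let ?f = "\<lambda>r. if r = nst a then 0 else 1 + r"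
  have "\<exists>s \<le> t'. (mstep (While js P a) ^^ s) (?f 0, Ts 0) = (?f (nst a), Ts 1)"
    by (rule mstep_simulation[OF _ t'(2)]) (auto simp: mstep_simp)
  then obtain s where s: "s \<le> t'" "(mstep (While js P a) ^^ s) (1, Ts 0) = (0, Ts 1)"
    using pos by auto
  have "mstep (While js P a) (0, Ts 0) = (1, Ts 0)"
    using T by (simp add: mstep_simp map2_act_stay del: map_map)
  then have 1: "(mstep (While js P a) ^^ Suc s) (0, Ts 0) = (0, Ts 1)"
    using s by (simp add: funpow_Suc_right del: funpow.simps)
  have "runs (While js P a) (Ts (Suc 0)) (n * (1 + t) + 1) (Ts (Suc n))"
    by (rule Suc.IH[of "\<lambda>i. Ts (Suc i)"]) (use Suc.prems in auto)
  then obtain r where r: "r \<le> n * (1 + t) + 1"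
      "(mstep (While js P a) ^^ r) (0, Ts 1) = (nst (While js P a), Ts (Suc n))"
    by (auto simp: runs_def)
  have "(mstep (While js P a) ^^ (r + Suc s)) (0, Ts 0) = (nst (While js P a), Ts (Suc n))"
    using 1 r by (simp only: funpow_add o_apply)
  moreover have "r + Suc s \<le> Suc n * (1 + t) + 1" using r s t' by auto
  ultimately show ?case unfolding runs_def by blast
qed

lemma cost_mono: "A \<le> B \<Longrightarrow> cost A c \<le> cost B c"
  by (induction c) (auto intro!: add_mono mult_mono)

lemma cost_poly: "\<exists>p :: nat poly. \<forall>B. cost B c = poly p B"
proof (induction c)
  case (Prim M)
  show ?case by (rule exI[of _ "[:0, 1:]"]) simp
next
  case (Seq a b)
  then obtain p q where "\<forall>B. cost B a = poly p B" "\<forall>B. cost B b = poly q B" by auto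
  then show ?case by (intro exI[of _ "p + q"]) simp
next
  case (If js P a b)
  then obtain p q where "\<forall>B. cost B a = poly p B" "\<forall>B. cost B b = poly q B" by auto
  then show ?case by (intro exI[of _ "1 + p + q"]) simp
next
  case (While js P a)
  then obtain p where "\<forall>B. cost B a = poly p B" by auto
  then show ?case by (intro exI[of _ "[:0, 1:] * (1 + p) + 1"]) simp
qed

text \<open>Tapes are given as a function of their number, which suits updates of single tapes; the
  machine has the first \<open>K\<close> of them. One bound \<open>B\<close> serves all loops and
  embedded machines, so composition needs no time arithmetic.\<close>

definition exec :: "nat \<Rightarrow> nat \<Rightarrow> com \<Rightarrow> (nat \<Rightarrow> tape) \<Rightarrow> (nat \<Rightarrow> tape) \<Rightarrow> bool" where
  "exec K B c s s' \<longleftrightarrow> runs c (map s [0..<K]) (cost B c) (map s' [0..<K])"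

lemma runs_mono: "runs c Ts t Ts' \<Longrightarrow> t \<le> u \<Longrightarrow> runs c Ts u Ts'"
  unfolding runs_def by (meson le_trans)

lemma exec_mono: "exec K A c s s' \<Longrightarrow> A \<le> B \<Longrightarrow> exec K B c s s'"
  unfolding exec_def by (metis runs_mono cost_mono)

lemma exec_Seq [intro]: "exec K B a s s1 \<Longrightarrow> exec K B b s1 s2 \<Longrightarrow> exec K B (Seq a b) s s2"
  unfolding exec_def by (auto intro: runs_Seq)

lemma test_scanned:
  "set js \<subseteq> {..<K} \<Longrightarrow>
     test js P (map scanned (map s [0..<K])) = P (map (\<lambda>j. scanned (s j)) js)"
proof -
  assume "set js \<subseteq> {..<K}"
  then have "map ((!) (map scanned (map s [0..<K]))) js = map (\<lambda>j. scanned (s j)) js"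
    by (intro map_cong) (auto simp: subset_iff)
  then show ?thesis unfolding test_def by (simp only:)
qed

lemma exec_If:
  assumes "set js \<subseteq> {..<K}" "0 < nst a"
    and "P (map (\<lambda>j. scanned (s j)) js) \<Longrightarrow> exec K B a s s'"
    and "\<not> P (map (\<lambda>j. scanned (s j)) js) \<Longrightarrow> exec K B b s s'"
  shows "exec K B (If js P a b) s s'"
proof -
  have "runs (If js P a b) (map s [0..<K]) (1 + (cost B a + cost B b)) (map s' [0..<K])"
    by (rule runs_If)
       (use assms in \<open>auto simp: test_scanned exec_def simp del: map_map intro: runs_mono\<close>)
  then show ?thesis by (simp add: exec_def)
qed

lemma exec_While:
  assumes "set js \<subseteq> {..<K}" "0 < nst a" "n \<le> B"
    and "\<And>i. i < n \<Longrightarrow> P (map (\<lambda>j. scanned (st i j)) js)"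
    and "\<And>i. i < n \<Longrightarrow> exec K B a (st i) (st (Suc i))"
    and "\<not> P (map (\<lambda>j. scanned (st n j)) js)"
  shows "exec K B (While js P a) (st 0) (st n)"
proof -
  have "runs (While js P a) (map (st 0) [0..<K]) (n * (1 + cost B a) + 1) (map (st n) [0..<K])"
    by (rule runs_While[where Ts = "\<lambda>i. map (st i) [0..<K]"])
       (use assms in \<open>auto simp: test_scanned exec_def simp del: map_map\<close>)
  moreover have "n * (1 + cost B a) \<le> B * (1 + cost B a)" using assms(3) by (rule mult_le_mono1)
  ultimately show ?thesis unfolding exec_def by (auto elim!: runs_mono)
qed

definition basic :: "(nat \<Rightarrow> nat \<Rightarrow> nat \<times> head_move) \<Rightarrow> com" where
  "basic g = Prim \<lparr>num_tapes = 0, num_symbols = 0, num_states = 1,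
     delta = (\<lambda>q ss. (1, map (\<lambda>i. g i (ss ! i)) [0..<length ss]))\<rparr>"

lemma nst_basic [simp]: "nst (basic g) = 1"
  by (simp add: basic_def)

lemma wf_basic: "(\<And>i x. x < S \<Longrightarrow> fst (g i x) < S) \<Longrightarrow> wf_com K S (basic g)"
proof -
  assume g: "\<And>i x. x < S \<Longrightarrow> fst (g i x) < S"
  have "s < S" if "(s, m) = g i (ss ! i)" "i < length ss" "set ss \<subseteq> {..<S}" for s m i ss
    using g[of "ss ! i" i] that by (metis fst_conv lessThan_iff nth_mem subsetD)
  note * = this
  show ?thesis by (auto simp: basic_def wf_delta_def intro: *[OF sym])
qed

lemma exec_basic:
  assumes "1 \<le> B" "\<And>i. i < K \<Longrightarrow> s' i = act (g i (scanned (s i))) (s i)"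
  shows "exec K B (basic g) s s'"
proof -
  have "mstep (basic g) (0, map s [0..<K]) = (1, map s' [0..<K])"
    using assms(2) by (auto simp: mstep_simp basic_def intro!: nth_equalityI)
  then show ?thesis unfolding exec_def runs_def using assms(1)
    by (intro exI[of _ 1]) (auto simp: basic_def)
qed

text \<open>For the fixed program \<open>c\<close>, \<open>cost B c\<close> is a polynomial in
  \<open>B\<close>; composing it with the polynomial for \<open>B\<close> bounds the running
  time.\<close>

lemma exec_poly_time:
  assumes wf: "wf_com K S c" "1 \<le> K" "3 \<le> S"
    and run: "\<And>x. \<exists>s'. exec K (poly p (length x)) c
      (\<lambda>i. if i = 0 then input_tape x else blank_tape) s' \<and> tape_holds (s' 0) (f x)"
  shows "poly_time_computable f"
proof -
  obtain q where q: "\<And>B. cost B c = poly q B" using cost_poly by metis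
  have "\<exists>t \<le> poly (pcompose q p) (length x).
      halts_with_output (machine K S c) ((tm_step (machine K S c) ^^ t) (initial_config (machine K S c) x)) (f x)"
    for x
  proof -
    obtain s' where s': "exec K (poly p (length x)) c
        (\<lambda>i. if i = 0 then input_tape x else blank_tape) s'" "tape_holds (s' 0) (f x)"
      using run by blast
    let ?i = "map (\<lambda>i. if i = 0 then input_tape x else blank_tape) [0..<K]"
    have i: "initial_config (machine K S c) x = (0, ?i)"
      using wf(2) unfolding initial_config_def machine_def
      by (auto intro!: nth_equalityI simp: nth_Cons split: nat.splits)
    obtain t where t: "t \<le> cost (poly p (length x)) c" "(mstep c ^^ t) (0, ?i) = (nst c, map s' [0..<K])"
      using s'(1) by (auto simp: exec_def runs_def)
    have "hd (map s' [0..<K]) = s' 0" using wf(2) by (simp add: hd_map)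
    then have "halts_with_output (machine K S c) (nst c, map s' [0..<K]) (f x)"
      using s'(2) by (simp add: halts_with_output_def machine_def)
    then show ?thesis using t i by (intro exI[of _ t]) (simp add: tm_step_machine poly_pcompose q)
  qed
  then show ?thesis unfolding poly_time_computable_def using wf_machine[OF wf] by blast
qed

section \<open>Loops over words\<close>

definition cells :: "nat list \<Rightarrow> int \<Rightarrow> nat" where
  "cells v i = (if 0 \<le> i \<and> i < int (length v) then v ! nat i else 0)"

definition rt :: "nat list \<Rightarrow> tape" where "rt v = (cells v, 0)"
definition wt :: "nat list \<Rightarrow> tape" where "wt v = (cells v, int (length v))"

lemma wt_Nil: "wt [] = blank_tape"
  by (auto simp: wt_def blank_tape_def cells_def)

lemma rt_input: "rt (map bit_symbol x) = input_tape x"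
  by (auto simp: rt_def input_tape_def cells_def fun_eq_iff)

lemma act_eq: "act (a, m) T = ((fst T)(snd T := a), snd T + offset m)"
  by (cases T) simp

lemma act_scanned [simp]: "act (scanned T, m) T = (fst T, snd T + offset m)"
  by (cases T) (simp add: scanned_def)

lemma cells_snoc: "(cells v)(int (length v) := a) = cells (v @ [a])"
  by (auto simp: cells_def nth_append fun_eq_iff)

definition move :: "(nat \<Rightarrow> head_move) \<Rightarrow> com" where
  "move D = basic (\<lambda>i x. (x, D i))"

definition put :: "nat \<Rightarrow> nat \<Rightarrow> head_move \<Rightarrow> com" where
  "put k a m = basic (\<lambda>i x. if i = k then (a, m) else (x, Stay))"

fun opp :: "head_move \<Rightarrow> head_move" where
  "opp Move_Left = Move_Right" | "opp Stay = Stay" | "opp Move_Right = Move_Left"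

lemma offset_opp [simp]: "offset (opp m) = - offset m"
  by (cases m) auto

definition only :: "nat \<Rightarrow> nat \<Rightarrow> head_move" where
  "only k j = (if j = k then Move_Right else Stay)"

definition shift :: "(nat \<Rightarrow> head_move) \<Rightarrow> int \<Rightarrow> (nat \<Rightarrow> tape) \<Rightarrow> nat \<Rightarrow> tape" where
  "shift D z s j = (fst (s j), snd (s j) + z * offset (D j))"

lemma shift_0 [simp]: "shift D 0 s = s"
  by (auto simp: shift_def)

lemma shift_upd [simp]: "D out = Stay \<Longrightarrow> shift D z (s(out := T)) = (shift D z s)(out := T)"
  by (auto simp: shift_def fun_eq_iff)

lemma scanned_shift: "scanned (shift D z s j) = fst (s j) (snd (s j) + z * offset (D j))"
  by (simp add: scanned_def shift_def)

lemma exec_move: "1 \<le> B \<Longrightarrow> exec K B (move D) s (shift D 1 s)"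
  unfolding move_def by (rule exec_basic) (auto simp: shift_def)
    
lemma exec_move_shift: "1 \<le> B \<Longrightarrow> z' = z + 1 \<Longrightarrow> exec K B (move D) (shift D z s) (shift D z' s)"
  unfolding move_def
  by (rule exec_basic) (auto simp: shift_def act_eq scanned_def algebra_simps)

lemma exec_move_opp: "1 \<le> B \<Longrightarrow> z' = z - 1 \<Longrightarrow> exec K B (move (opp \<circ> D)) (shift D z s) (shift D z' s)"
  unfolding move_def
  by (rule exec_basic) (auto simp: shift_def act_eq scanned_def algebra_simps)

lemma exec_put:
  "1 \<le> B \<Longrightarrow> exec K B (put k a m) s (s(k := act (a, m) (s k)))"
  unfolding put_def by (rule exec_basic) auto

lemma nst_move [simp]: "nst (move D) = 1" and nst_put [simp]: "nst (put k a m) = 1"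
  by (auto simp: move_def put_def)

lemma wf_move [simp]: "wf_com K S (move D)"
  unfolding move_def by (rule wf_basic) auto

lemma wf_put [simp]: "a < S \<Longrightarrow> wf_com K S (put k a m)"
  unfolding put_def by (rule wf_basic) auto

abbreviation nonblank :: "nat list \<Rightarrow> bool" where
  "nonblank ss \<equiv> hd ss \<noteq> 0"

text \<open>
  The loop runs the head of tape \<open>k\<close> over its word. All other heads move along as prescribed by
  \<open>D\<close>, and in the end all heads are brought back.
\<close>

definition For :: "nat \<Rightarrow> (nat \<Rightarrow> head_move) \<Rightarrow> com \<Rightarrow> com" where
  "For k D c = Seq (While [k] nonblank (Seq c (move D)))
     (Seq (move (opp \<circ> D)) (Seq (While [k] nonblank (move (opp \<circ> D))) (move D)))"

lemma nst_For [simp]: "0 < nst (For k D c)"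
  by (simp add: For_def)

lemma wf_For [simp]: "wf_com K S (For k D c) \<longleftrightarrow> wf_com K S c"
  by (simp add: For_def)

definition is_word :: "nat \<Rightarrow> tape \<Rightarrow> bool" where
  "is_word n T \<longleftrightarrow> snd T = 0 \<and> (\<forall>i. fst T i \<noteq> 0 \<longleftrightarrow> 0 \<le> i \<and> i < int n)"

lemma is_word_rt: "0 \<notin> set v \<Longrightarrow> n = length v \<Longrightarrow> is_word n (rt v)"
  by (auto simp: is_word_def rt_def cells_def in_set_conv_nth)

text \<open>\<open>st i\<close> describes the tapes after \<open>i\<close> iterations as if all
  heads were at home, whereas the machine is really in \<open>shift D (int i) (st i)\<close>. The
  control head stops on the blank behind its word and, on the way back, on the blank in cell -1;
  hence the single moves before and after the second loop.\<close>

lemma exec_For: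
  assumes k: "k < K" "D k = Move_Right" and n: "n \<le> B" "1 \<le> B"
    and word: "\<And>i. i \<le> n \<Longrightarrow> is_word n (st i k)"
    and body: "\<And>i. i < n \<Longrightarrow> exec K B c (shift D (int i) (st i)) (shift D (int i) (st (Suc i)))"
  shows "exec K B (For k D c) (st 0) (st n)"
proof -
  have sc: "scanned (shift D z (st i) k) \<noteq> 0 \<longleftrightarrow> 0 \<le> z \<and> z < int n" if "i \<le> n" for i z
    using word[OF that] k by (auto simp: scanned_shift is_word_def)
  have 1: "exec K B (While [k] nonblank (Seq c (move D)))
      (shift D (int 0) (st 0)) (shift D (int n) (st n))"
  proof (rule exec_While[where st = "\<lambda>i. shift D (int i) (st i)"])
    show "exec K B (Seq c (move D)) (shift D (int i) (st i)) (shift D (int (Suc i)) (st (Suc i)))"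
      if "i < n" for i
      by (rule exec_Seq[OF body[OF that] exec_move_shift]) (use n in auto)
  qed (use k n sc in auto)
  have 2: "exec K B (move (opp \<circ> D)) (shift D (int n) (st n)) (shift D (int n - 1 - int 0) (st n))"
    using n by (intro exec_move_opp) auto
  have 3: "exec K B (While [k] nonblank (move (opp \<circ> D)))
      (shift D (int n - 1 - int 0) (st n)) (shift D (int n - 1 - int n) (st n))"
  proof (rule exec_While[where st = "\<lambda>i. shift D (int n - 1 - int i) (st n)"])
    show "exec K B (move (opp \<circ> D)) (shift D (int n - 1 - int i) (st n))
        (shift D (int n - 1 - int (Suc i)) (st n))" for i
      by (rule exec_move_opp) (use n in auto)
  qed (use k n sc[of n] in simp_all)
  have 4: "exec K B (move D) (shift D (int n - 1 - int n) (st n)) (shift D 0 (st n))"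
    using n by (intro exec_move_shift) auto
  show ?thesis
    using exec_Seq[OF 1 exec_Seq[OF 2 exec_Seq[OF 3 4]]] by (simp add: For_def)
qed

definition noop :: com where "noop = move (\<lambda>_. Stay)"

lemma exec_noop: "1 \<le> B \<Longrightarrow> exec K B noop s s"
  unfolding noop_def move_def by (rule exec_basic) auto

lemma nst_noop [simp]: "nst noop = 1" and wf_noop [simp]: "wf_com K S noop"
  by (auto simp: noop_def)

definition seqs :: "com list \<Rightarrow> com" where
  "seqs cs = foldr Seq cs noop"

lemma nst_foldr_Seq [simp]: "0 < nst (foldr Seq cs noop)"
  by (induction cs) auto

lemma nst_seqs [simp]: "0 < nst (seqs cs)"
  by (simp add: seqs_def)

lemma wf_seqs [simp]: "wf_com K S (seqs cs) \<longleftrightarrow> (\<forall>c \<in> set cs. wf_com K S c)"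
  unfolding seqs_def by (induction cs) auto

lemma exec_seqs:
  assumes "1 \<le> B" "\<And>i. i < length cs \<Longrightarrow> exec K B (cs ! i) (st i) (st (Suc i))"
  shows "exec K B (seqs cs) (st 0) (st (length cs))"
  using assms(2)
proof (induction cs arbitrary: st)
  case Nil
  then show ?case using assms(1) by (auto simp: seqs_def intro: exec_noop)
next
  case (Cons c cs)
  have "exec K B (seqs cs) (st (Suc 0)) (st (Suc (length cs)))"
    by (rule Cons.IH[of "\<lambda>i. st (Suc i)"]) (use Cons.prems in force)
  then show ?case using Cons.prems[of 0] by (auto simp: seqs_def)
qed

text \<open>Quantifying over the word \<open>v\<close> already written makes outputs of consecutive
  programs concatenate. All other tapes, including head positions, have to be restored.\<close>

definition emits :: "nat \<Rightarrow> nat \<Rightarrow> nat \<Rightarrow> com \<Rightarrow> (nat \<Rightarrow> tape) \<Rightarrow> nat list \<Rightarrow> bool" where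
  "emits K B out c s w \<longleftrightarrow> (\<forall>v. exec K B c (s(out := wt v)) (s(out := wt (v @ w))))"

lemma emits_noop: "1 \<le> B \<Longrightarrow> emits K B out noop s []"
  by (simp add: emits_def exec_noop)

lemma emits_Seq: "emits K B out a s v \<Longrightarrow> emits K B out b s w \<Longrightarrow> emits K B out (Seq a b) s (v @ w)"
  unfolding emits_def by (metis append.assoc exec_Seq)

lemma emits_seqs:
  assumes "1 \<le> B" "\<And>x. x \<in> set xs \<Longrightarrow> emits K B out (c x) s (w x)"
  shows "emits K B out (seqs (map c xs)) s (concat (map w xs))"
  using assms(2) unfolding seqs_def
  by (induction xs) (use assms(1) in \<open>auto simp: emits_noop intro!: emits_Seq\<close>)

lemma emits_If:
  assumes "set js \<subseteq> {..<K}" "out \<notin> set js" "0 < nst a"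
    and "P (map (\<lambda>j. scanned (s j)) js) \<Longrightarrow> emits K B out a s w"
    and "\<not> P (map (\<lambda>j. scanned (s j)) js) \<Longrightarrow> emits K B out b s w"
  shows "emits K B out (If js P a b) s w"
proof -
  have same: "map (\<lambda>j. scanned ((s(out := wt v)) j)) js = map (\<lambda>j. scanned (s j)) js" for v
    using assms(2) by (intro map_cong) auto
  show ?thesis unfolding emits_def
  proof (intro allI exec_If, unfold same)
    fix v
    show "exec K B a (s(out := wt v)) (s(out := wt (v @ w)))" if "P (map (\<lambda>j. scanned (s j)) js)"
      using assms(4)[OF that] by (simp add: emits_def)
    show "exec K B b (s(out := wt v)) (s(out := wt (v @ w)))" if "\<not> P (map (\<lambda>j. scanned (s j)) js)"
      using assms(5)[OF that] by (simp add: emits_def)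
  qed (use assms in auto)
qed

fun emit :: "nat \<Rightarrow> nat list \<Rightarrow> com" where
  "emit out [] = noop"
| "emit out (a # w) = Seq (put out a Move_Right) (emit out w)"

lemma nst_emit [simp]: "0 < nst (emit out w)"
  by (induction w) auto

lemma wf_emit [simp]: "set w \<subseteq> {..<S} \<Longrightarrow> wf_com K S (emit out w)"
  by (induction w) auto

lemma emits_emit: "1 \<le> B \<Longrightarrow> emits K B out (emit out w) s w"
proof (induction w)
  case Nil
  then show ?case by (simp add: emits_noop)
next
  case (Cons a w)
  have "emits K B out (put out a Move_Right) s [a]"
    unfolding emits_def
  proof
    fix v
    have "act (a, Move_Right) (wt v) = wt (v @ [a])" by (simp add: wt_def cells_snoc)
    then show "exec K B (put out a Move_Right) (s(out := wt v)) (s(out := wt (v @ [a])))"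
      using exec_put[OF Cons.prems, of K out a Move_Right "s(out := wt v)"] by simp
  qed
  from emits_Seq[OF this Cons.IH[OF Cons.prems]] show ?case by simp
qed

declare emit.simps [simp del]

lemma emits_For:
  assumes "k < K" "D k = Move_Right" "n \<le> B" "1 \<le> B" "D out = Stay" "is_word n (s k)"
    and "\<And>i. i < n \<Longrightarrow> emits K B out c (shift D (int i) s) (e i)"
  shows "emits K B out (For k D c) s (concat (map e [0..<n]))"
  unfolding emits_def
proof
  fix v
  define st where "st i = s(out := wt (v @ concat (map e [0..<i])))" for i
  have "k \<noteq> out" using assms(2,5) by auto
  have "exec K B (For k D c) (st 0) (st n)"
  proof (rule exec_For)
    fix i assume "i < n"
    then show "exec K B c (shift D (int i) (st i)) (shift D (int i) (st (Suc i)))"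
      using assms(5) assms(7)[of i, unfolded emits_def, rule_format, of "v @ concat (map e [0..<i])"]
      unfolding st_def by simp
  qed (use assms \<open>k \<noteq> out\<close> in \<open>auto simp: st_def\<close>)
  then show "exec K B (For k D c) (s(out := wt v)) (s(out := wt (v @ concat (map e [0..<n]))))"
    by (simp add: st_def)
qed

definition rewind :: "nat \<Rightarrow> com" where
  "rewind k = Seq (move (opp \<circ> only k)) (Seq (While [k] nonblank (move (opp \<circ> only k))) (move (only k)))"

lemma nst_rewind [simp]: "0 < nst (rewind k)" and wf_rewind [simp]: "wf_com K S (rewind k)"
  by (auto simp: rewind_def)

text \<open>The head may stand on the blank behind the word, so one step to the left precedes the
  search for the blank in cell -1.\<close>

lemma exec_rewind:
  assumes "k < K" "s k = (cells v, int p)" "p \<le> length v" "0 \<notin> set v" "p \<le> B" "1 \<le> B"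
  shows "exec K B (rewind k) s (s(k := rt v))"
proof -
  define s0 where "s0 = s(k := rt v)"
  have s: "s = shift (only k) (int p) s0"
    using assms(2) by (auto simp: s0_def shift_def only_def rt_def fun_eq_iff)
  have w: "is_word (length v) (s0 k)" using assms(4) by (auto simp: s0_def intro: is_word_rt)
  have sc: "scanned (shift (only k) z s0 k) \<noteq> 0 \<longleftrightarrow> 0 \<le> z \<and> z < int (length v)" for z
    using w by (auto simp: scanned_shift is_word_def only_def)
  have 2: "exec K B (move (opp \<circ> only k)) s (shift (only k) (int p - 1 - int 0) s0)"
    unfolding s by (rule exec_move_opp) (use assms(6) in auto)
  have 3: "exec K B (While [k] nonblank (move (opp \<circ> only k)))
      (shift (only k) (int p - 1 - int 0) s0) (shift (only k) (int p - 1 - int p) s0)"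
  proof (rule exec_While[where st = "\<lambda>i. shift (only k) (int p - 1 - int i) s0" and n = p])
    show "exec K B (move (opp \<circ> only k)) (shift (only k) (int p - 1 - int i) s0)
        (shift (only k) (int p - 1 - int (Suc i)) s0)" for i
      by (rule exec_move_opp) (use assms(6) in auto)
  qed (use assms(1,3,5) sc in simp_all)
  have 4: "exec K B (move (only k)) (shift (only k) (int p - 1 - int p) s0) (shift (only k) 0 s0)"
    using assms by (intro exec_move_shift) auto
  show ?thesis
    using exec_Seq[OF 2 exec_Seq[OF 3 4]] by (simp add: rewind_def s0_def)
qed

definition fill :: "nat \<Rightarrow> com \<Rightarrow> com" where
  "fill out c = Seq c (rewind out)"

lemma wf_fill [simp]: "wf_com K S (fill out c) \<longleftrightarrow> wf_com K S c"
  by (simp add: fill_def)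

lemma exec_fill:
  assumes "emits K B out c s w" "s out = blank_tape" "0 \<notin> set w" "length w \<le> B" "1 \<le> B" "out < K"
  shows "exec K B (fill out c) s (s(out := rt w))"
proof -
  have "s = s(out := wt [])" using assms(2) by (auto simp: wt_Nil)
  then have "exec K B c s (s(out := wt w))" using assms(1) unfolding emits_def by (metis append_Nil)
  moreover have "exec K B (rewind out) (s(out := wt w)) ((s(out := wt w))(out := rt w))"
    by (rule exec_rewind[where p = "length w"]) (use assms in \<open>auto simp: wt_def\<close>)
  ultimately show ?thesis unfolding fill_def by auto
qed

text \<open>Running times bound the lengths of words written, since a head moves one cell per step.\<close>

lemma head_position:
  assumes "runs c Ts t Ts'" "i < length Ts" "i < length Ts'"
  shows "snd (Ts' ! i) \<le> snd (Ts ! i) + int t"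
proof -
  have a: "snd (act b T) \<le> snd T + 1" for b T
    by (cases b; cases "snd b") (auto simp: act_eq)
  have one: "i < length (snd (mstep c (q, Us))) \<Longrightarrow>
      i < length Us \<and> snd (snd (mstep c (q, Us)) ! i) \<le> snd (Us ! i) + 1" for q Us
    by (auto simp: mstep_simp a)
  have pos: "i < length (snd ((mstep c ^^ u) (0, Ts))) \<Longrightarrow>
      snd (snd ((mstep c ^^ u) (0, Ts)) ! i) \<le> snd (Ts ! i) + int u" for u
  proof (induction u)
    case (Suc u)
    obtain q Us where "(mstep c ^^ u) (0, Ts) = (q, Us)" by (cases "(mstep c ^^ u) (0, Ts)")
    then show ?case using Suc one[of q Us] by auto
  qed auto
  obtain u where "u \<le> t" "(mstep c ^^ u) (0, Ts) = (nst c, Ts')"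
    using assms(1) by (auto simp: runs_def)
  then show ?thesis using pos[of u] assms(3) by simp
qed

lemma emits_length:
  assumes "emits K B out c s w" "out < K"
  shows "length w \<le> cost B c"
proof -
  have "exec K B c (s(out := wt [])) (s(out := wt w))" using assms(1) by (metis append_Nil emits_def)
  from head_position[OF this[unfolded exec_def], of out] assms(2) show ?thesis
    by (simp add: wt_def)
qed

section \<open>Polynomials of the input length in unary\<close>

lemma concat_replicate_sum:
  "concat (map (\<lambda>i. replicate (f i) a) [0..<m]) = replicate (\<Sum>i<m. f i) a"
  by (induction m) (auto simp: replicate_add)

text \<open>With \<open>n\<close> the length of the word on tape \<open>x\<close>, tape
  \<open>b + i\<close> receives \<open>n ^ i\<close> ones, each power by a nested loop over that
  word and the previous power. A monomial then costs just one loop over one of these tapes.\<close>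

definition pow_tapes :: "nat \<Rightarrow> nat \<Rightarrow> nat \<Rightarrow> com" where
  "pow_tapes x b d = Seq (fill b (emit b [1]))
     (seqs (map (\<lambda>i. fill (b + Suc i) (For x (only x) (For (b + i) (only (b + i)) (emit (b + Suc i) [1]))))
        [0..<d]))"

lemma wf_pow_tapes [simp]: "2 \<le> S \<Longrightarrow> wf_com K S (pow_tapes x b d)"
  by (simp add: pow_tapes_def)

definition with_pows :: "nat \<Rightarrow> nat \<Rightarrow> nat \<Rightarrow> (nat \<Rightarrow> tape) \<Rightarrow> nat \<Rightarrow> tape" where
  "with_pows b d n s j = (if b \<le> j \<and> j \<le> b + d then rt (replicate (n ^ (j - b)) 1) else s j)"

lemma exec_pow_tapes:
  assumes "x < b" "b + d < K" "is_word n (s x)" "n \<le> B" "n ^ d \<le> B" "1 \<le> B"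
    and blank: "\<And>j. b \<le> j \<Longrightarrow> j \<le> b + d \<Longrightarrow> s j = blank_tape"
  shows "exec K B (pow_tapes x b d) s (with_pows b d n s)"
proof -
  \<comment> \<open>The case \<open>n = 0\<close> rests on \<open>1 \<le> B\<close>, because
    \<open>0 ^ 0 = 1\<close>.\<close>
  have pow: "n ^ i \<le> B" if "i \<le> d" for i
    using that assms(4-6) power_increasing[of i d n]
    by (cases "n = 0") (auto simp: power_0_left intro: le_trans)
  have "exec K B (fill b (emit b [1])) s (s(b := rt [1]))"
    by (rule exec_fill[OF emits_emit]) (use assms in auto)
  moreover have "s(b := rt [1]) = with_pows b 0 n s"
    by (auto simp: with_pows_def fun_eq_iff)
  moreover have "exec K B (fill (b + Suc i) (For x (only x) (For (b + i) (only (b + i)) (emit (b + Suc i) [1]))))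
      (with_pows b i n s) (with_pows b (Suc i) n s)" if "i < d" for i
  proof -
    let ?s = "with_pows b i n s"
    have "emits K B (b + Suc i) (For x (only x) (For (b + i) (only (b + i)) (emit (b + Suc i) [1]))) ?s
       (concat (map (\<lambda>_. concat (map (\<lambda>_. [1]) [0..<n ^ i])) [0..<n]))"
    proof (intro emits_For emits_emit)
      show "is_word n (?s x)" using assms by (auto simp: with_pows_def)
      show "is_word (n ^ i) (shift (only x) (int j) ?s (b + i))" for j
      proof -
        have "shift (only x) (int j) ?s (b + i) = rt (replicate (n ^ i) 1)"
          using assms(1) by (auto simp: with_pows_def shift_def only_def rt_def)
        then show ?thesis by (auto intro: is_word_rt)
      qed
    qed (use assms that pow[of i] in \<open>auto simp: only_def\<close>)
    moreover have "concat (map (\<lambda>_. concat (map (\<lambda>_. [1::nat]) [0..<n ^ i])) [0..<n]) = replicate (n ^ Suc i) 1"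
      using concat_replicate_sum[of "\<lambda>_. n ^ i" "1::nat" n] by (simp add: map_replicate_const)
    ultimately have "exec K B (fill (b + Suc i) (For x (only x) (For (b + i) (only (b + i)) (emit (b + Suc i) [1]))))
       ?s (?s(b + Suc i := rt (replicate (n ^ Suc i) 1)))"
      using that assms(2) pow[of "Suc i"] blank assms(6)
      by (intro exec_fill) (auto simp: with_pows_def)
    moreover have "?s(b + Suc i := rt (replicate (n ^ Suc i) 1)) = with_pows b (Suc i) n s"
      by (auto simp: with_pows_def fun_eq_iff)
    ultimately show ?thesis by simp
  qed
  then have "exec K B (seqs (map (\<lambda>i. fill (b + Suc i) (For x (only x) (For (b + i) (only (b + i)) (emit (b + Suc i) [1]))))
        [0..<d])) (with_pows b 0 n s) (with_pows b d n s)"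
    using exec_seqs[where st = "\<lambda>i. with_pows b i n s" and cs = "map (\<lambda>i. fill (b + Suc i) (For x (only x) (For (b + i) (only (b + i)) (emit (b + Suc i) [1])))) [0..<d]"] assms(6)
    by simp
  ultimately show ?thesis unfolding pow_tapes_def by auto
qed

definition emit_poly :: "nat poly \<Rightarrow> nat \<Rightarrow> nat \<Rightarrow> nat \<Rightarrow> com" where
  "emit_poly p b out a =
     seqs (map (\<lambda>i. For (b + i) (only (b + i)) (emit out (replicate (coeff p i) a))) [0..<Suc (degree p)])"

lemma wf_emit_poly [simp]: "a < S \<Longrightarrow> wf_com K S (emit_poly p b out a)"
  by (auto simp: emit_poly_def intro!: wf_emit)

lemma emits_emit_poly:
  assumes "degree p \<le> d" "out < b \<or> b + d < out" "b + d < K" "n \<le> B" "n ^ d \<le> B" "1 \<le> B"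
    and "\<And>i. i \<le> d \<Longrightarrow> s (b + i) = rt (replicate (n ^ i) 1)"
  shows "emits K B out (emit_poly p b out a) s (replicate (poly p n) a)"
proof -
  have pow: "n ^ i \<le> B" if "i \<le> d" for i
    using that assms(4-6) power_increasing[of i d n]
    by (cases "n = 0") (auto simp: power_0_left intro: le_trans)
  have "emits K B out (emit_poly p b out a) s
     (concat (map (\<lambda>i. concat (map (\<lambda>_. replicate (coeff p i) a) [0..<n ^ i])) [0..<Suc (degree p)]))"
    unfolding emit_poly_def
  proof (rule emits_seqs, goal_cases)
    case (2 i)
    then have "i \<le> d" using assms(1) by auto
    then show ?case
      using assms pow[of i] by (intro emits_For emits_emit) (auto simp: only_def intro: is_word_rt)
  qed (use assms in auto)
  moreover have "concat (map (\<lambda>i. concat (map (\<lambda>_. replicate (coeff p i) a) [0..<n ^ i])) [0..<Suc (degree p)])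
     = replicate (poly p n) a"
    unfolding concat_replicate_sum by (simp add: poly_altdef lessThan_Suc_atMost mult.commute)
  ultimately show ?thesis by simp
qed

section \<open>Subroutines\<close>

text \<open>
  To run an arbitrary machine as a subroutine, its first head has to be brought back to cell 0
  afterwards. A shadow tape carries a mark in cell 0 and its head moves along with the first head.
  The parity of a state of the combined machine records the side of cell 0 on which the head is.
\<close>

definition call_delta ::
    "turing_machine \<Rightarrow> nat \<Rightarrow> nat \<Rightarrow> nat \<Rightarrow> nat list \<Rightarrow> nat \<times> (nat \<times> head_move) list" where
  "call_delta M j sh q ss =
     (let k = num_tapes M; us = map (\<lambda>i. ss ! (j + i)) [0..<k]; r = delta M (q div 2) us;
          m = snd (snd r ! 0) in
      if q div 2 < num_states M then
        if set us \<subseteq> {..<num_symbols M} then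
          (2 * fst r + (if ss ! sh = 0 then q mod 2 else if m = Move_Left then 1 else 0),
           map (\<lambda>i. if j \<le> i \<and> i < j + k then snd r ! (i - j)
                    else (ss ! i, if i = sh then m else Stay)) [0..<length ss])
        else (2 * num_states M + 2, stay ss)
      else if ss ! sh \<noteq> 0 then (2 * num_states M + 2, stay ss)
      else (q, map (\<lambda>i. (ss ! i, if i = j \<or> i = sh then if q mod 2 = 0 then Move_Left else Move_Right else Stay))
                 [0..<length ss]))"

definition call_prim :: "turing_machine \<Rightarrow> nat \<Rightarrow> nat \<Rightarrow> com" where
  "call_prim M j sh = Prim \<lparr>num_tapes = 0, num_symbols = 0, num_states = 2 * num_states M + 2,
     delta = call_delta M j sh\<rparr>"

definition call :: "turing_machine \<Rightarrow> nat \<Rightarrow> nat \<Rightarrow> com" where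
  "call M j sh = Seq (put sh 1 Stay) (call_prim M j sh)"

lemma wf_tmD:
  assumes "wf_tm M" "q < num_states M" "length ss = num_tapes M" "set ss \<subseteq> {..<num_symbols M}"
  shows "fst (delta M q ss) \<le> num_states M" "length (snd (delta M q ss)) = num_tapes M"
    "i < num_tapes M \<Longrightarrow> fst (snd (delta M q ss) ! i) < num_symbols M"
  using assms unfolding wf_tm_def by (auto, metis (no_types, lifting) case_prodE fst_conv nth_mem)

text \<open>The surrounding program may use symbols foreign to \<open>M\<close>, about which
  \<open>wf_tm M\<close> says nothing; on these \<open>call_delta\<close> goes straight to its exit
  \<open>2 * num_states M + 2\<close>. States \<open>2 * q\<close> and \<open>2 * q + 1\<close>
  stand for \<open>q\<close>; those with \<open>q = num_states M\<close> walk back to the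
  mark.\<close>

lemma wf_call:
  assumes M: "wf_tm M" and S: "num_symbols M \<le> S" "2 \<le> S" and K: "j + num_tapes M \<le> K"
  shows "wf_com K S (call M j sh)"
proof -
  have "fst (call_delta M j sh q ss) \<le> 2 * num_states M + 2 \<and>
      length (snd (call_delta M j sh q ss)) = K \<and>
      (\<forall>(s, m)\<in>set (snd (call_delta M j sh q ss)). s < S)"
    if q: "q < 2 * num_states M + 2" and ss: "length ss = K" "set ss \<subseteq> {..<S}" for q ss
  proof -
    let ?us = "map (\<lambda>i. ss ! (j + i)) [0..<num_tapes M]"
    have nth: "ss ! i < S" if "i < K" for i using ss that by (auto simp: subset_iff)
    show ?thesis
    proof (cases "q div 2 < num_states M \<and> set ?us \<subseteq> {..<num_symbols M}")
      case True
      then have *: "fst (delta M (q div 2) ?us) \<le> num_states M"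
          "\<And>i. i < num_tapes M \<Longrightarrow> fst (snd (delta M (q div 2) ?us) ! i) < S"
        using wf_tmD[OF M, of "q div 2" ?us] S(1) by (simp, metis True length_map length_upt minus_nat.diff_0 order_less_le_trans)
      have "a < S" if "(a, b) = snd (delta M (q div 2) ?us) ! (i - j)" "i < j + num_tapes M" "j \<le> i" for a b i
        using *(2)[of "i - j"] that by (metis fst_conv le_add_diff_inverse nat_add_left_cancel_less)
      then show ?thesis using True *(1) ss nth
        by (auto simp: call_delta_def Let_def split: if_splits)
    next
      case False
      then show ?thesis using ss nth q by (auto simp: call_delta_def Let_def subset_iff)
    qed
  qed
  then have "wf_delta K S (2 * num_states M + 2) (call_delta M j sh)"
    unfolding wf_delta_def by blast
  then show ?thesis using S by (simp add: call_def call_prim_def)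
qed

definition valid_config :: "turing_machine \<Rightarrow> config \<Rightarrow> bool" where
  "valid_config M c \<longleftrightarrow> fst c \<le> num_states M \<and> length (snd c) = num_tapes M \<and>
     (\<forall>T \<in> set (snd c). \<forall>i. fst T i < num_symbols M)"

lemma valid_scanned:
  "valid_config M (q, Ts) \<Longrightarrow> set (map scanned Ts) \<subseteq> {..<num_symbols M}"
  by (auto simp: valid_config_def scanned_def)

lemma tm_step_eq:
  assumes "q < num_states M"
  shows "tm_step M (q, Ts) =
    (fst (delta M q (map scanned Ts)), map2 act (snd (delta M q (map scanned Ts))) Ts)"
  using assms by (auto split: prod.splits)

lemma valid_step:
  assumes M: "wf_tm M" and v: "valid_config M c"
  shows "valid_config M (tm_step M c)"
proof -
  obtain q Ts where c: "c = (q, Ts)" by (cases c)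
  show ?thesis
  proof (cases "q < num_states M")
    case True
    note d = wf_tmD[OF M True _ valid_scanned[OF v[unfolded c]]]
    have len: "length (map scanned Ts) = num_tapes M" using v c by (simp add: valid_config_def)
    have "fst (act b T) i < num_symbols M"
      if "fst b < num_symbols M" "\<forall>i. fst T i < num_symbols M" for b T i
      using that by (cases b) (auto simp: act_eq)
    then have "fst (map2 act (snd (delta M q (map scanned Ts))) Ts ! n) i < num_symbols M"
      if "n < num_tapes M" for n i
      using d[OF len] v len that unfolding c valid_config_def by (simp del: act.simps)
    then show ?thesis using d[OF len] v len unfolding c tm_step_eq[OF True] valid_config_def
      by (simp add: all_set_conv_all_nth)
  next
    case False
    then show ?thesis using v c by simp
  qed
qed

lemma valid_initial:
  assumes "wf_tm M"
  shows "valid_config M (initial_config M x)"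
  using assms unfolding valid_config_def initial_config_def wf_tm_def
  by (auto simp: input_tape_def blank_tape_def bit_symbol_def)

lemma valid_funpow: "wf_tm M \<Longrightarrow> valid_config M c \<Longrightarrow> valid_config M ((tm_step M ^^ t) c)"
  by (induction t) (auto simp: valid_step)

definition tapes_in :: "turing_machine \<Rightarrow> nat \<Rightarrow> nat \<Rightarrow> (nat \<Rightarrow> tape) \<Rightarrow> tape list \<Rightarrow> nat \<Rightarrow> tape" where
  "tapes_in M j sh s Us i =
     (if j \<le> i \<and> i < j + num_tapes M then Us ! (i - j)
      else if i = sh then (cells [1], snd (Us ! 0)) else s i)"

text \<open>Parity 0 allows positions at or right of cell 0, parity 1 those at or left of it. On
  cell 0 both are allowed: there the mark is scanned, and the next move sets the parity
  anew.\<close>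

definition side :: "nat \<Rightarrow> int \<Rightarrow> bool" where
  "side r p \<longleftrightarrow> r < 2 \<and> (0 < p \<longrightarrow> r = 0) \<and> (p < 0 \<longrightarrow> r = 1)"

lemma nst_call_prim [simp]: "nst (call_prim M j sh) = 2 * num_states M + 2"
  by (simp add: call_prim_def)

context
  fixes M :: turing_machine and j sh K :: nat and s :: "nat \<Rightarrow> tape"
  assumes M: "wf_tm M" and K: "j + num_tapes M \<le> K" "sh < K" "sh < j \<or> j + num_tapes M \<le> sh"
begin

lemma scanned_tapes_in:
  assumes "length Us = num_tapes M"
  shows "map (\<lambda>i. map scanned (map (tapes_in M j sh s Us) [0..<K]) ! (j + i)) [0..<num_tapes M] =
      map scanned Us"
    "map scanned (map (tapes_in M j sh s Us) [0..<K]) ! sh = (if snd (Us ! 0) = 0 then 1 else 0)"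
  using assms K by (auto intro!: nth_equalityI simp: tapes_in_def scanned_def cells_def)

lemma call_step:
  assumes q: "q < num_states M" and v: "valid_config M (q, Us)" and r: "side r (snd (Us ! 0))"
    and st: "tm_step M (q, Us) = (q', Us')"
  shows "\<exists>r'. side r' (snd (Us' ! 0)) \<and>
    mstep (call_prim M j sh) (2 * q + r, map (tapes_in M j sh s Us) [0..<K]) =
      (2 * q' + r', map (tapes_in M j sh s Us') [0..<K])"
proof -
  let ?ss = "map scanned (map (tapes_in M j sh s Us) [0..<K])"
  let ?d = "delta M q (map scanned Us)"
  have len: "length Us = num_tapes M" using v by (simp add: valid_config_def)
  then have d: "length (snd ?d) = num_tapes M"
    using wf_tmD(2)[OF M q _ valid_scanned[OF v]] by simp
  have k: "0 < num_tapes M" using M by (simp add: wf_tm_def)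
  have q': "q' = fst ?d" and Us': "Us' = map2 act (snd ?d) Us"
    using st unfolding tm_step_eq[OF q] by auto
  have r2: "r < 2" using r by (simp add: side_def)
  then have dm: "(2 * q + r) div 2 = q" "(2 * q + r) mod 2 = r" by auto
  let ?m = "snd (snd ?d ! 0)"
  let ?r = "if snd (Us ! 0) \<noteq> 0 then r else if ?m = Move_Left then 1 else 0"
  have U0: "snd (Us' ! 0) = snd (Us ! 0) + offset ?m"
    unfolding Us' using d len k by (cases "snd ?d ! 0") (simp add: act_eq)
  have side: "side ?r (snd (Us' ! 0))"
    using r unfolding U0 by (cases ?m) (auto simp: side_def)
  have cd: "call_delta M j sh (2 * q + r) ?ss = (2 * q' + ?r,
      map (\<lambda>i. if j \<le> i \<and> i < j + num_tapes M then snd ?d ! (i - j)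
               else (?ss ! i, if i = sh then ?m else Stay)) [0..<K])"
    unfolding call_delta_def scanned_tapes_in[OF len] dm q' Let_def
    using q valid_scanned[OF v] by simp
  have "map2 act (snd (call_delta M j sh (2 * q + r) ?ss)) (map (tapes_in M j sh s Us) [0..<K]) =
      map (tapes_in M j sh s Us') [0..<K]"
  proof (rule nth_equalityI, goal_cases)
    case 1
    then show ?case unfolding cd by simp
  next
    case (2 i)
    then have i: "i < K" unfolding cd by simp
    show ?case
    proof (cases "j \<le> i \<and> i < j + num_tapes M")
      case True
      then have "i - j < num_tapes M" by auto
      then show ?thesis using i True d len unfolding cd Us' by (simp add: tapes_in_def)
    next
      case False
      then show ?thesis using i U0 unfolding cd by (auto simp: tapes_in_def scanned_def act_eq)
    qed
  qed
  moreover have "2 * q + r < 2 * num_states M + 2" using q r2 by auto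
  ultimately have "mstep (call_prim M j sh) (2 * q + r, map (tapes_in M j sh s Us) [0..<K]) =
      (2 * q' + ?r, map (tapes_in M j sh s Us') [0..<K])"
    unfolding mstep_simp nst_call_prim by (simp add: call_prim_def cd del: map_map)
  then show ?thesis using side by blast
qed

lemma call_steps:
  assumes "valid_config M (q, Us)" "side r (snd (Us ! 0))" "(tm_step M ^^ t) (q, Us) = (q', Us')"
  shows "\<exists>r' t'. t' \<le> t \<and> side r' (snd (Us' ! 0)) \<and> \<bar>snd (Us' ! 0)\<bar> \<le> \<bar>snd (Us ! 0)\<bar> + int t \<and>
    (mstep (call_prim M j sh) ^^ t') (2 * q + r, map (tapes_in M j sh s Us) [0..<K]) =
      (2 * q' + r', map (tapes_in M j sh s Us') [0..<K])"
  using assms(3)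
proof (induction t arbitrary: q' Us')
  case 0
  then show ?case using assms by (intro exI[of _ r] exI[of _ 0]) auto
next
  case (Suc t)
  obtain q1 Us1 where 1: "(tm_step M ^^ t) (q, Us) = (q1, Us1)" by (cases "(tm_step M ^^ t) (q, Us)")
  have v: "valid_config M (q1, Us1)" using valid_funpow[OF M assms(1), of t] 1 by simp
  have st: "tm_step M (q1, Us1) = (q', Us')" using Suc.prems 1 by (simp del: tm_step.simps)
  obtain r1 t1 where r1: "t1 \<le> t" "side r1 (snd (Us1 ! 0))" "\<bar>snd (Us1 ! 0)\<bar> \<le> \<bar>snd (Us ! 0)\<bar> + int t"
    "(mstep (call_prim M j sh) ^^ t1) (2 * q + r, map (tapes_in M j sh s Us) [0..<K]) =
      (2 * q1 + r1, map (tapes_in M j sh s Us1) [0..<K])"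
    using Suc.IH[OF 1] by blast
  show ?case
  proof (cases "q1 < num_states M")
    case True
    from call_step[OF True v r1(2) st] obtain r' where r': "side r' (snd (Us' ! 0))"
      "mstep (call_prim M j sh) (2 * q1 + r1, map (tapes_in M j sh s Us1) [0..<K]) =
        (2 * q' + r', map (tapes_in M j sh s Us') [0..<K])" by blast
    have Us': "Us' = map2 act (snd (delta M q1 (map scanned Us1))) Us1"
      using st unfolding tm_step_eq[OF True] by auto
    have len: "length Us1 = num_tapes M" using v by (simp add: valid_config_def)
    then have d: "length (snd (delta M q1 (map scanned Us1))) = num_tapes M"
      using wf_tmD(2)[OF M True _ valid_scanned[OF v]] by simp
    have k: "0 < num_tapes M" using M by (simp add: wf_tm_def)
    have "\<bar>snd (Us' ! 0)\<bar> \<le> \<bar>snd (Us1 ! 0)\<bar> + 1"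
      unfolding Us' using d len k
      by (cases "snd (delta M q1 (map scanned Us1)) ! 0";
          cases "snd (snd (delta M q1 (map scanned Us1)) ! 0)") (auto simp: act_eq)
    then show ?thesis using r1 r' by (intro exI[of _ r'] exI[of _ "Suc t1"]) auto
  next
    case False
    then have "q' = q1" "Us' = Us1" using st by auto
    then show ?thesis using r1 by (intro exI[of _ r1] exI[of _ t1]) auto
  qed
qed

text \<open>Every step reduces the distance to the mark by one; the last of the \<open>Suc n\<close>
  steps scans the mark and exits.\<close>

lemma call_home:
  assumes len: "length Us = num_tapes M"
  shows "side r p \<Longrightarrow> nat \<bar>p\<bar> = n \<Longrightarrow>
    (mstep (call_prim M j sh) ^^ Suc n)
      (2 * num_states M + r, map (tapes_in M j sh s (Us[0 := (c, p)])) [0..<K]) =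
    (2 * num_states M + 2, map (tapes_in M j sh s (Us[0 := (c, 0)])) [0..<K])"
proof (induction n arbitrary: p)
  case (0 p)
  let ?Us = "Us[0 := (c, 0)]"
  have p: "p = 0" using 0 by simp
  have k: "0 < num_tapes M" using M by (simp add: wf_tm_def)
  have r2: "r < 2" using 0 by (simp add: side_def)
  have "call_delta M j sh (2 * num_states M + r) (map scanned (map (tapes_in M j sh s ?Us) [0..<K])) =
     (2 * num_states M + 2, stay (map scanned (map (tapes_in M j sh s ?Us) [0..<K])))"
    unfolding call_delta_def Let_def using scanned_tapes_in[of ?Us] len k r2 by simp
  moreover have "mstep (call_prim M j sh) (2 * num_states M + r, map (tapes_in M j sh s ?Us) [0..<K]) =
    (2 * num_states M + 2, map (tapes_in M j sh s ?Us) [0..<K])"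
    if "call_delta M j sh (2 * num_states M + r) (map scanned (map (tapes_in M j sh s ?Us) [0..<K])) =
     (2 * num_states M + 2, stay (map scanned (map (tapes_in M j sh s ?Us) [0..<K])))"
    using r2 map2_act_stay[of "map (tapes_in M j sh s ?Us) [0..<K]"] that
    unfolding mstep_simp nst_call_prim by (simp add: call_prim_def del: map_map)
  ultimately show ?case by (simp add: p)
next
  case (Suc n p)
  let ?Us = "\<lambda>p. Us[0 := (c, p)]"
  let ?p = "if r = 0 then p - 1 else p + 1"
  let ?ss = "map scanned (map (tapes_in M j sh s (?Us p)) [0..<K])"
  have k: "0 < num_tapes M" using M by (simp add: wf_tm_def)
  have r2: "r < 2" and side: "side r ?p" and n: "nat \<bar>?p\<bar> = n" and p: "p \<noteq> 0"
    using Suc.prems by (auto simp: side_def)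
  then have "(2 * num_states M + r) mod 2 = r" "(2 * num_states M + r) div 2 = num_states M" by auto
  then have cd: "call_delta M j sh (2 * num_states M + r) ?ss = (2 * num_states M + r,
      map (\<lambda>i. (?ss ! i, if i = j \<or> i = sh then if r = 0 then Move_Left else Move_Right else Stay)) [0..<K])"
    unfolding call_delta_def Let_def using scanned_tapes_in[of "?Us p"] len k p by simp
  have "map2 act (snd (call_delta M j sh (2 * num_states M + r) ?ss)) (map (tapes_in M j sh s (?Us p)) [0..<K]) =
      map (tapes_in M j sh s (?Us ?p)) [0..<K]"
    unfolding cd using k len K(3) by (intro nth_equalityI) (auto simp: tapes_in_def nth_list_update)
  then have "mstep (call_prim M j sh) (2 * num_states M + r, map (tapes_in M j sh s (?Us p)) [0..<K]) =
    (2 * num_states M + r, map (tapes_in M j sh s (?Us ?p)) [0..<K])"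
    using r2 unfolding mstep_simp nst_call_prim by (simp add: call_prim_def cd del: map_map)
  then have "(mstep (call_prim M j sh) ^^ Suc (Suc n)) (2 * num_states M + r, map (tapes_in M j sh s (?Us p)) [0..<K])
     = (mstep (call_prim M j sh) ^^ Suc n) (2 * num_states M + r, map (tapes_in M j sh s (?Us ?p)) [0..<K])"
    by (simp only: funpow_Suc_right o_apply)
  then show ?case using Suc.IH[OF side n] by simp
qed

text \<open>The bound counts \<open>t\<close> simulated steps, at most \<open>t\<close> steps home,
  as the head has moved at most \<open>t\<close> cells, and one step to exit. The shadow tape and
  the work tapes of \<open>M\<close> are left dirty, so a later call needs fresh ones.\<close>

lemma exec_call:
  assumes input: "s j = input_tape x" and blank: "\<And>i. j < i \<Longrightarrow> i < j + num_tapes M \<Longrightarrow> s i = blank_tape"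
    and shadow: "s sh = blank_tape"
    and halts: "halts_with_output M ((tm_step M ^^ t) (initial_config M x)) y"
    and B: "2 * t + 1 \<le> B"
  obtains s' where "exec K B (call M j sh) s s'" "snd (s' j) = 0" "tape_holds (s' j) y"
    "\<And>i. i < j \<or> j + num_tapes M \<le> i \<Longrightarrow> i \<noteq> sh \<Longrightarrow> s' i = s i"
proof -
  let ?init = "snd (initial_config M x)"
  have k: "0 < num_tapes M" using M by (simp add: wf_tm_def)
  have 0: "initial_config M x = (0, ?init)" by (simp add: initial_config_def)
  have start: "(s(sh := act (1, Stay) (s sh))) i = tapes_in M j sh s ?init i" for i
  proof (cases "j \<le> i \<and> i < j + num_tapes M")
    case True
    then show ?thesis using input blank[of i] K(3) by (cases "i = j")
        (auto simp: tapes_in_def initial_config_def nth_Cons shadow split: nat.splits)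
  next
    case False
    then show ?thesis using shadow
      by (auto simp: tapes_in_def initial_config_def input_tape_def blank_tape_def cells_def fun_eq_iff)
  qed
  obtain q' Us' where t: "(tm_step M ^^ t) (0, ?init) = (q', Us')" by (cases "(tm_step M ^^ t) (0, ?init)")
  have v: "valid_config M (q', Us')" using valid_funpow[OF M valid_initial[OF M], of t x] 0 t by simp
  have q': "q' = num_states M" and y: "tape_holds (hd Us') y"
    using halts t 0 by (auto simp: halts_with_output_def)
  have len: "length Us' = num_tapes M" using v by (simp add: valid_config_def)
  have s0: "snd (?init ! 0) = 0" by (simp add: initial_config_def input_tape_def)
  obtain r' t' where r': "t' \<le> t" "side r' (snd (Us' ! 0))" "\<bar>snd (Us' ! 0)\<bar> \<le> int t"
    "(mstep (call_prim M j sh) ^^ t') (0, map (tapes_in M j sh s ?init) [0..<K]) =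
      (2 * num_states M + r', map (tapes_in M j sh s Us') [0..<K])"
    using call_steps[OF _ _ t, of 0] valid_initial[OF M, of x] 0 s0 q' by (auto simp: side_def)
  let ?n = "nat \<bar>snd (Us' ! 0)\<bar>"
  let ?Vs = "Us'[0 := (fst (Us' ! 0), 0)]"
  have "(mstep (call_prim M j sh) ^^ Suc ?n) (2 * num_states M + r', map (tapes_in M j sh s Us') [0..<K]) =
      (2 * num_states M + 2, map (tapes_in M j sh s ?Vs) [0..<K])"
    using call_home[OF len r'(2) refl, of "fst (Us' ! 0)"] by simp
  then have "(mstep (call_prim M j sh) ^^ (Suc ?n + t')) (0, map (tapes_in M j sh s ?init) [0..<K]) =
      (nst (call_prim M j sh), map (tapes_in M j sh s ?Vs) [0..<K])"
    using r'(4) by (simp only: funpow_add o_apply nst_call_prim)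
  moreover have "Suc ?n + t' \<le> cost B (call_prim M j sh)" using r' B by (simp add: call_prim_def)
  ultimately have 2: "exec K B (call_prim M j sh) (tapes_in M j sh s ?init) (tapes_in M j sh s ?Vs)"
    unfolding exec_def runs_def by blast
  have "s(sh := act (1, Stay) (s sh)) = tapes_in M j sh s ?init" using start by (rule ext)
  then have 1: "exec K B (put sh 1 Stay) s (tapes_in M j sh s ?init)"
    using exec_put[of B K sh 1 Stay s] B by simp
  show ?thesis
  proof
    show "exec K B (call M j sh) s (tapes_in M j sh s ?Vs)" using 1 2 by (auto simp: call_def)
    show "snd (tapes_in M j sh s ?Vs j) = 0" using k len by (simp add: tapes_in_def)
    show "tape_holds (tapes_in M j sh s ?Vs j) y"
      using k len y by (cases Us') (auto simp: tapes_in_def tape_holds_def)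
    show "tapes_in M j sh s ?Vs i = s i" if "i < j \<or> j + num_tapes M \<le> i" "i \<noteq> sh" for i
      using that by (auto simp: tapes_in_def)
  qed
qed

end

section \<open>Computation tableaux\<close>

text \<open>
  Propositional variables describe a computation of \<open>M\<close> at time \<open>t\<close>, where the tapes are indexed
  relative to the positions of the heads, so that all scanned cells are in the column \<open>ctr\<close> and a
  step shifts whole tapes. \<open>VC j a\<close> says that tape \<open>j\<close> carries symbol \<open>a\<close> in column \<open>i\<close>, and \<open>VZ\<close>
  that cell 0 of the first tape is in column \<open>i\<close>. At time 0, \<open>VE\<close> and \<open>VB\<close> encode the guessed
  string: whether it extends to column \<open>i\<close>, and its bit there.
\<close>

datatype var_kind = VE | VB | VS nat | VTr nat "nat list" | VC nat nat | VZ
datatype time_spec = T0 | Tcur | Tnext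
datatype col_spec = Ctr | Rel head_move

type_synonym pattern = "bool \<times> var_kind \<times> time_spec \<times> col_spec"

text \<open>\<open>KPair\<close> is a tautology, \<open>KIn 3\<close> closes the extent of the guess
  under predecessors, and \<open>KRej\<close> forbids halting with symbol 1 (the bit
  \<open>False\<close>) in cell 0. All other kinds derive facts of the run: from the input and the
  guess at time 0, and from the current to the next configuration. So a satisfying assignment makes
  all facts of the actual run true; it does no harm if it makes further variables true.\<close>

datatype clause_kind =
    KPair var_kind | KState0 | KBlank nat | KZ0 | KIn nat
  | KTr nat "nat list" | KNext nat "nat list" | KShift nat "nat list" nat nat | KZ nat "nat list" | KRej

abbreviation "trivial_patterns \<equiv> [(True, VE, Tcur, Rel Stay), (False, VE, Tcur, Rel Stay)]"

text \<open>
  Column codes: 1 is a blank, 2 and 3 are the bits of the delimited input, 4 is a cell of the guessed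
  string, and 5 marks the two boundary columns.
\<close>

fun patterns :: "turing_machine \<Rightarrow> clause_kind \<Rightarrow> nat \<Rightarrow> bool \<Rightarrow> pattern list" where
  "patterns M (KPair v) s c = [(True, v, Tcur, Rel Stay), (False, v, Tcur, Rel Stay)]"
| "patterns M KState0 s c = [(True, VS 0, T0, Ctr)]"
| "patterns M (KBlank j) s c = [(True, VC j 0, T0, Rel Stay)]"
| "patterns M KZ0 s c = [(True, VZ, T0, Ctr)]"
| "patterns M (KIn n) s c =
     (if n = 0 \<and> s < 4 then [(True, VC 0 (s - 1), T0, Rel Stay)]
      else if n = 0 then [(False, VE, T0, Rel Stay), (False, VB, T0, Rel Stay), (True, VC 0 2, T0, Rel Stay)]
      else if s \<noteq> 4 then trivial_patterns
      else if n = 1 then [(False, VE, T0, Rel Stay), (True, VB, T0, Rel Stay), (True, VC 0 1, T0, Rel Stay)]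
      else if n = 2 then [(True, VE, T0, Rel Stay), (True, VC 0 0, T0, Rel Stay)]
      else [(True, VE, T0, Rel Stay), (False, VE, T0, Rel Move_Right)])"
| "patterns M (KTr q ss) s c =
     (False, VS q, Tcur, Ctr) # (True, VTr q ss, Tcur, Ctr) #
     map (\<lambda>j. (False, VC j (ss ! j), Tcur, Ctr)) [0..<num_tapes M]"
| "patterns M (KNext q ss) s c =
     [(False, VTr q ss, Tcur, Ctr), (True, VS (fst (delta M q ss)), Tnext, Ctr)]"
| "patterns M (KShift q ss j a) s c =
     (let (b, m) = snd (delta M q ss) ! j in
      if c then [(False, VTr q ss, Tcur, Ctr), (True, VC j b, Tnext, Rel (opp m))]
      else [(False, VTr q ss, Tcur, Ctr), (False, VC j a, Tcur, Rel Stay), (True, VC j a, Tnext, Rel (opp m))])"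
| "patterns M (KZ q ss) s c =
     [(False, VTr q ss, Tcur, Ctr), (False, VZ, Tcur, Rel Stay),
      (True, VZ, Tnext, Rel (opp (snd (snd (delta M q ss) ! 0))))]"
| "patterns M KRej s c =
     [(False, VS (num_states M), Tcur, Ctr), (False, VZ, Tcur, Rel Stay), (False, VC 0 1, Tcur, Rel Stay)]"

fun is_pair :: "clause_kind \<Rightarrow> bool" where
  "is_pair (KPair v) = True"
| "is_pair \<kappa> = False"

text \<open>In the boundary columns and at time \<open>T\<close>, a clause could refer to columns or
  times outside the grid, so a tautology replaces it there. \<open>KPair\<close> is kept, since
  every variable of the grid needs its own pair clause.\<close>

definition clause_patterns :: "turing_machine \<Rightarrow> clause_kind \<Rightarrow> nat \<Rightarrow> bool \<Rightarrow> bool \<Rightarrow> pattern list" where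
  "clause_patterns M \<kappa> s c l =
     (if (s = 5 \<or> l) \<and> \<not> is_pair \<kappa> then trivial_patterns else patterns M \<kappa> s c)"

fun tval :: "time_spec \<Rightarrow> nat \<Rightarrow> nat" where
  "tval T0 t = 0" | "tval Tcur t = t" | "tval Tnext t = Suc t"

fun ival :: "nat \<Rightarrow> col_spec \<Rightarrow> nat \<Rightarrow> nat" where
  "ival ctr Ctr i = ctr" | "ival ctr (Rel m) i = nat (int i + offset m)"

fun holds :: "nat \<Rightarrow> (var_kind \<Rightarrow> nat \<Rightarrow> nat \<Rightarrow> bool) \<Rightarrow> nat \<Rightarrow> nat \<Rightarrow> pattern \<Rightarrow> bool" where
  "holds ctr \<alpha> t i (b, v, ts, is) \<longleftrightarrow> \<alpha> v (tval ts t) (ival ctr is i) = b"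

definition symbol_lists :: "turing_machine \<Rightarrow> nat list set" where
  "symbol_lists M = {ss. set ss \<subseteq> {..<num_symbols M} \<and> length ss = num_tapes M}"

definition var_kinds :: "turing_machine \<Rightarrow> var_kind set" where
  "var_kinds M = VS ` {..num_states M} \<union> case_prod VTr ` ({..<num_states M} \<times> symbol_lists M) \<union>
     case_prod VC ` ({..<num_tapes M} \<times> {..<num_symbols M}) \<union> {VZ}"

text \<open>\<open>VE\<close> and \<open>VB\<close> come first so that the variables of the guess
  have known positions in the output of the approximation algorithm. The order of the rest is
  arbitrary but fixed together with \<open>M\<close>, so a choice by \<open>SOME\<close> can be
  built into the program.\<close>

definition var_list :: "turing_machine \<Rightarrow> var_kind list" where
  "var_list M = VE # VB # (SOME vs. set vs = var_kinds M \<and> distinct vs)"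

definition clause_kinds :: "turing_machine \<Rightarrow> clause_kind set" where
  "clause_kinds M = KPair ` set (var_list M) \<union> {KState0, KZ0, KRej} \<union> KIn ` {..<4} \<union>
     KBlank ` {1..<num_tapes M} \<union>
     case_prod KTr ` ({..<num_states M} \<times> symbol_lists M) \<union>
     case_prod KNext ` ({..<num_states M} \<times> symbol_lists M) \<union>
     case_prod KZ ` ({..<num_states M} \<times> symbol_lists M) \<union>
     (\<lambda>(q, ss, j, a). KShift q ss j a) `
       ({..<num_states M} \<times> symbol_lists M \<times> {..<num_tapes M} \<times> {..<num_symbols M})"

definition clause_list :: "turing_machine \<Rightarrow> clause_kind list" where
  "clause_list M = (SOME ks. set ks = clause_kinds M)"

lemma finite_symbol_lists: "finite (symbol_lists M)"
  unfolding symbol_lists_def by (rule finite_lists_length_eq) auto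

lemma var_list: "set (var_list M) = {VE, VB} \<union> var_kinds M" "distinct (var_list M)"
proof -
  have "finite (var_kinds M)" by (auto simp: var_kinds_def finite_symbol_lists)
  from someI_ex[OF finite_distinct_list[OF this]]
  show "set (var_list M) = {VE, VB} \<union> var_kinds M" "distinct (var_list M)"
    by (auto simp: var_list_def) (auto simp: var_kinds_def)
qed

lemma clause_list: "set (clause_list M) = clause_kinds M"
proof -
  have "finite (clause_kinds M)" by (auto simp: clause_kinds_def finite_symbol_lists)
  from someI_ex[OF finite_list[OF this]] show ?thesis by (simp add: clause_list_def)
qed

text \<open>The margins \<open>2 * T\<close> add up two losses: cell 0 can drift by up to
  \<open>T\<close> columns from the center, and the columns whose contents are certain shrink by one
  per side and step.\<close>

definition columns :: "nat \<Rightarrow> nat \<Rightarrow> bool list \<Rightarrow> nat list" where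
  "columns T g x = 5 # replicate (2 * T) 1 @ map (\<lambda>b. if b then 3 else 2) (delimited x) @
     replicate g 4 @ replicate (2 * T) 1 @ [5]"

lemma length_delimited: "length (delimited x) = 2 * length x + 1"
  by (induction x) (auto simp: delimited_def)

text \<open>Turns the closure under predecessors from \<open>KIn 3\<close> into an initial segment,
  so that the guessed string occupies consecutive cells of the input.\<close>

lemma filter_prefix:
  assumes "\<And>e. Suc e < g \<Longrightarrow> P (Suc e) \<Longrightarrow> P e"
  shows "\<exists>n \<le> g. filter P [0..<g] = [0..<n] \<and> (\<forall>e<g. P e \<longleftrightarrow> e < n)"
  using assms
proof (induction g)
  case (Suc g)
  then obtain n where n: "n \<le> g" "filter P [0..<g] = [0..<n]" "\<And>e. e < g \<Longrightarrow> P e \<longleftrightarrow> e < n"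
    by (metis Suc_lessD less_SucI)
  show ?case
  proof (cases "P g")
    case True
    then have "n = g" using Suc.prems[of "g - 1"] n by (cases g) (auto simp: le_Suc_eq)
    then show ?thesis using n True by (intro exI[of _ "Suc g"]) (auto simp: less_Suc_eq)
  next
    case False
    then show ?thesis using n by (intro exI[of _ n]) (auto simp: less_Suc_eq)
  qed
qed auto

section \<open>Soundness and completeness of the tableau\<close>

locale tableau =
  fixes M :: turing_machine and T g :: nat and x :: "bool list"
  assumes wf: "wf_tm M"
begin

definition "ctr = 2 * T + 1"
definition "width = 4 * T + 3 + 2 * length x + g"
definition "guess_start = ctr + 2 * length x + 1"

lemma length_columns: "length (columns T g x) = width"
  by (simp add: columns_def width_def length_delimited)

lemma columns_nth:
  "columns T g x ! 0 = 5" "columns T g x ! (width - 1) = 5"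
  "1 \<le> i \<Longrightarrow> i < ctr \<Longrightarrow> columns T g x ! i = 1"
  "l < 2 * length x + 1 \<Longrightarrow> columns T g x ! (ctr + l) = (if delimited x ! l then 3 else 2)"
  "e < g \<Longrightarrow> columns T g x ! (guess_start + e) = 4"
  "guess_start + g \<le> i \<Longrightarrow> i < width - 1 \<Longrightarrow> columns T g x ! i = 1"
proof -
  show "columns T g x ! 0 = 5" by (simp add: columns_def)
  show "columns T g x ! (width - 1) = 5"
    by (simp add: columns_def width_def nth_Cons' nth_append length_delimited)
  show "1 \<le> i \<Longrightarrow> i < ctr \<Longrightarrow> columns T g x ! i = 1"
    by (auto simp: columns_def ctr_def nth_Cons' nth_append)
  show "l < 2 * length x + 1 \<Longrightarrow> columns T g x ! (ctr + l) = (if delimited x ! l then 3 else 2)"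
    by (auto simp: columns_def ctr_def nth_append length_delimited)
  show "e < g \<Longrightarrow> columns T g x ! (guess_start + e) = 4"
    by (auto simp: columns_def ctr_def guess_start_def nth_append length_delimited)
  show "guess_start + g \<le> i \<Longrightarrow> i < width - 1 \<Longrightarrow> columns T g x ! i = 1"
    by (auto simp: columns_def ctr_def guess_start_def width_def nth_Cons' nth_append length_delimited)
qed

lemma column_cases:
  assumes "1 \<le> i" "i < width - 1"
  obtains "i < ctr" "columns T g x ! i = 1"
  | l where "i = ctr + l" "l < 2 * length x + 1" "columns T g x ! i = (if delimited x ! l then 3 else 2)"
  | e where "i = guess_start + e" "e < g" "columns T g x ! i = 4"
  | "guess_start + g \<le> i" "columns T g x ! i = 1"
proof -
  consider "i < ctr" | "i = ctr + (i - ctr)" "i - ctr < 2 * length x + 1"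
    | "i = guess_start + (i - guess_start)" "i - guess_start < g" | "guess_start + g \<le> i"
    using guess_start_def by linarith
  then show ?thesis using that columns_nth assms by cases metis+
qed

abbreviation "pats \<kappa> t i \<equiv> clause_patterns M \<kappa> (columns T g x ! i) (i = ctr) (t = T)"

definition satisfies :: "(var_kind \<Rightarrow> nat \<Rightarrow> nat \<Rightarrow> bool) \<Rightarrow> bool" where
  "satisfies \<alpha> \<longleftrightarrow> (\<forall>\<kappa> \<in> clause_kinds M. \<forall>t \<le> T. \<forall>i < width. \<exists>p \<in> set (pats \<kappa> t i). holds ctr \<alpha> t i p)"

definition guessed :: "(var_kind \<Rightarrow> nat \<Rightarrow> nat \<Rightarrow> bool) \<Rightarrow> bool list" where
  "guessed \<alpha> = map (\<lambda>e. \<alpha> VB 0 (guess_start + e)) (filter (\<lambda>e. \<alpha> VE 0 (guess_start + e)) [0..<g])"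

lemma interior: "1 \<le> i \<Longrightarrow> i < width - 1 \<Longrightarrow> columns T g x ! i \<noteq> 5"
  by (rule column_cases[of i]) (auto split: if_splits)

lemma satisfiesD:
  assumes "satisfies \<alpha>" "\<kappa> \<in> clause_kinds M" "t < T" "1 \<le> i" "i < width - 1"
  shows "\<exists>p \<in> set (patterns M \<kappa> (columns T g x ! i) (i = ctr)). holds ctr \<alpha> t i p"
proof -
  have "\<exists>p \<in> set (pats \<kappa> t i). holds ctr \<alpha> t i p"
  proof -
    have "t \<le> T" "i < width" using assms by auto
    then show ?thesis using assms(1,2) unfolding satisfies_def by blast
  qed
  then show ?thesis using interior[OF assms(4,5)] assms(3) by (simp add: clause_patterns_def)
qed

abbreviation "cell Ts j p \<equiv> fst (Ts ! j) (snd (Ts ! j) + p)"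

lemma initial_facts:
  assumes sat: "satisfies \<alpha>" and T: "0 < T" and i: "1 \<le> i" "i < width - 1" and j: "j < num_tapes M"
  shows "\<alpha> (VC j (cell (snd (initial_config M (encode_pair x (guessed \<alpha>)))) j (int i - int ctr))) 0 i"
proof -
  note D = satisfiesD[OF sat _ T i]
  show ?thesis
  proof (cases "j = 0")
    case False
    then have "KBlank j \<in> clause_kinds M" using j by (auto simp: clause_kinds_def)
    from D[OF this] show ?thesis using False j
      by (auto simp: initial_config_def blank_tape_def nth_Cons')
  next
    case True
    let ?E = "\<lambda>e. \<alpha> VE 0 (guess_start + e)" and ?z = "encode_pair x (guessed \<alpha>)"
    have kin: "KIn n \<in> clause_kinds M" if "n < 4" for n using that by (auto simp: clause_kinds_def)
    have "?E e" if e: "Suc e < g" "?E (Suc e)" for e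
    proof -
      have "1 \<le> guess_start + e" "guess_start + e < width - 1"
        using e by (auto simp: guess_start_def width_def ctr_def)
      from satisfiesD[OF sat kin[of 3] T this] e show ?thesis
        by (auto simp: columns_nth nat_add_distrib)
    qed
    then obtain n where n: "n \<le> g" "filter ?E [0..<g] = [0..<n]" "\<And>e. e < g \<Longrightarrow> ?E e \<longleftrightarrow> e < n"
      using filter_prefix[of g ?E] by blast
    have y: "guessed \<alpha> = map (\<lambda>e. \<alpha> VB 0 (guess_start + e)) [0..<n]"
      unfolding guessed_def n(2) ..
    have z: "length ?z = 2 * length x + 1 + n"
      by (simp add: encode_pair_def length_delimited y)
    have in0: "cell (snd (initial_config M ?z)) 0 p =
        (if 0 \<le> p \<and> p < int (length ?z) then bit_symbol (?z ! nat p) else 0)" for p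
      by (simp add: initial_config_def input_tape_def)
    from i show ?thesis
    proof (cases rule: column_cases)
      case 1
      then show ?thesis using D[OF kin[of 0]] True unfolding True in0 by auto
    next
      case (2 l)
      then have "?z ! l = delimited x ! l" by (simp add: encode_pair_def nth_append length_delimited)
      then show ?thesis using D[OF kin[of 0]] 2 unfolding True in0 z
        by (auto simp: bit_symbol_def nat_int_add split: if_splits)
    next
      case (3 e)
      have p: "int i - int ctr = int (2 * length x + 1 + e)" using 3 by (simp add: guess_start_def)
      show ?thesis
      proof (cases "e < n")
        case True
        then have "?z ! (2 * length x + 1 + e) = \<alpha> VB 0 i"
          using 3 by (simp add: encode_pair_def nth_append length_delimited y)
        moreover have "\<alpha> VE 0 i" using True n(3) 3 by simp
        ultimately show ?thesis using D[OF kin[of 0]] D[OF kin[of 1]] 3 True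
          unfolding \<open>j = 0\<close> in0 z p nat_int by (auto simp: bit_symbol_def nat_int_add)
      next
        case False
        then have "\<not> \<alpha> VE 0 i" using n(3) 3 by simp
        then show ?thesis using D[OF kin[of 2]] 3 False unfolding \<open>j = 0\<close> in0 z p
          by (auto simp: nat_int_add)
      qed
    next
      case 4
      then have "int (length ?z) \<le> int i - int ctr" unfolding z using n(1) by (simp add: guess_start_def)
      then show ?thesis using D[OF kin[of 0]] 4 unfolding True in0 by auto
    qed
  qed
qed

text \<open>By induction on time: \<open>KTr\<close> forces the transition variable of the actual
  step, and from it follow the facts of the next configuration. A column at time
  \<open>Suc t\<close> depends on itself or a neighbour at time \<open>t\<close>, so the certain
  columns shrink from both sides; the column of cell 0 remains among them, being within
  \<open>t\<close> of \<open>ctr\<close>.\<close>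

lemma run_facts:
  assumes sat: "satisfies \<alpha>" and T: "0 < T"
    and c: "\<And>t. c t = (tm_step M ^^ t) (initial_config M (encode_pair x (guessed \<alpha>)))"
    and run: "\<forall>u<t. fst (c u) < num_states M" and t: "t < T"
  shows "\<alpha> (VS (fst (c t))) t ctr"
    and "\<And>i j. 1 + t \<le> i \<Longrightarrow> i + t + 1 < width \<Longrightarrow> j < num_tapes M \<Longrightarrow>
      \<alpha> (VC j (cell (snd (c t)) j (int i - int ctr))) t i"
    and "\<And>i. int i = int ctr - snd (snd (c t) ! 0) \<Longrightarrow> \<alpha> VZ t i"
    and "\<bar>snd (snd (c t) ! 0)\<bar> \<le> int t"
proof -
  have "\<alpha> (VS (fst (c t))) t ctr \<and>
    (\<forall>i j. 1 + t \<le> i \<and> i + t + 1 < width \<and> j < num_tapes M \<longrightarrow>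
       \<alpha> (VC j (cell (snd (c t)) j (int i - int ctr))) t i) \<and>
    (\<forall>i. int i = int ctr - snd (snd (c t) ! 0) \<longrightarrow> \<alpha> VZ t i) \<and> \<bar>snd (snd (c t) ! 0)\<bar> \<le> int t"
    using run t
  proof (induction t)
    case 0
    have i: "1 \<le> ctr" "ctr < width - 1" by (auto simp: ctr_def width_def)
    have "KState0 \<in> clause_kinds M" "KZ0 \<in> clause_kinds M" by (auto simp: clause_kinds_def)
    with satisfiesD[OF sat _ T i] have "\<alpha> (VS 0) 0 ctr" "\<alpha> VZ 0 ctr" by fastforce+
    then show ?case using initial_facts[OF sat T] unfolding c
      by (auto simp: initial_config_def input_tape_def)
  next
    case (Suc t)
    obtain q Ts where q: "c t = (q, Ts)" by (cases "c t")
    have IH: "\<alpha> (VS q) t ctr"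
      "\<And>i j. 1 + t \<le> i \<Longrightarrow> i + t + 1 < width \<Longrightarrow> j < num_tapes M \<Longrightarrow> \<alpha> (VC j (cell Ts j (int i - int ctr))) t i"
      "\<And>i. int i = int ctr - snd (Ts ! 0) \<Longrightarrow> \<alpha> VZ t i" "\<bar>snd (Ts ! 0)\<bar> \<le> int t"
      using Suc q by auto
    have t: "t < T" "Suc t < T" using Suc.prems by auto
    have qQ: "q < num_states M" using Suc.prems(1) q by auto
    have v: "valid_config M (q, Ts)"
      using valid_funpow[OF wf valid_initial[OF wf]] c[of t] q by metis
    have len: "length Ts = num_tapes M" using v by (simp add: valid_config_def)
    define ss where "ss = map scanned Ts"
    have ss: "ss \<in> symbol_lists M" "length ss = num_tapes M"
      using valid_scanned[OF v] len by (auto simp: symbol_lists_def ss_def)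
    have dl: "length (snd (delta M q ss)) = num_tapes M"
      using wf_tmD(2)[OF wf qQ] ss by (auto simp: symbol_lists_def)
    have cS: "c (Suc t) = (fst (delta M q ss), map2 act (snd (delta M q ss)) Ts)"
      using c[of "Suc t"] c[of t] q tm_step_eq[OF qQ, of Ts] by (simp add: ss_def del: tm_step.simps)
    have act: "(map2 act (snd (delta M q ss)) Ts) ! j = act (snd (delta M q ss) ! j) (Ts ! j)"
      if "j < num_tapes M" for j using that dl len by simp
    note D = satisfiesD[OF sat _ t(1)]
    have ctr: "1 \<le> ctr" "ctr < width - 1" "1 + t \<le> ctr" "ctr + t + 1 < width"
      using t by (auto simp: ctr_def width_def)
    have k: "0 < num_tapes M" using wf by (simp add: wf_tm_def)
    have scanned: "\<alpha> (VC j (ss ! j)) t ctr" if "j < num_tapes M" for j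
      using IH(2)[of ctr j] that ctr len by (simp add: ss_def scanned_def)
    have "KTr q ss \<in> clause_kinds M" "KNext q ss \<in> clause_kinds M" "KZ q ss \<in> clause_kinds M"
      using ss qQ by (auto simp: clause_kinds_def)
    note D3 = D[OF this(1) ctr(1,2)] D[OF this(2) ctr(1,2)] D[OF this(3)]
    have tr: "\<alpha> (VTr q ss) t ctr" using D3(1) IH(1) scanned by auto
    have 1: "\<alpha> (VS (fst (delta M q ss))) (Suc t) ctr" using D3(2) tr by auto
    have 2: "\<alpha> (VC j (cell (snd (c (Suc t))) j (int i - int ctr))) (Suc t) i"
      if i: "1 + Suc t \<le> i" "i + Suc t + 1 < width" and j: "j < num_tapes M" for i j
    proof -
      obtain b m where bm: "snd (delta M q ss) ! j = (b, m)" by fastforce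
      \<comment> \<open>The column whose contents the head movement carries to column
        \<open>i\<close>; it lies in the window that is certain at time \<open>t\<close>.\<close>
      define l where "l = nat (int i + offset m)"
      have l: "int l = int i + offset m" "1 + t \<le> l" "l + t + 1 < width" "1 \<le> l" "l < width - 1"
        "nat (int l + offset (opp m)) = i"
        using i unfolding l_def by (cases m; simp)+
      have ks: "KShift q ss j (cell Ts j (int l - int ctr)) \<in> clause_kinds M"
      proof -
        have "cell Ts j (int l - int ctr) < num_symbols M" using v j by (auto simp: valid_config_def)
        then show ?thesis using ss qQ j by (auto simp: clause_kinds_def image_iff)
      qed
      have cell: "cell (snd (c (Suc t))) j (int i - int ctr) =
          (if l = ctr then b else cell Ts j (int l - int ctr))"
        using l(1) unfolding cS snd_conv act[OF j] bm by (auto simp: act_eq algebra_simps)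
      show ?thesis
        using D[OF ks l(4,5)] tr IH(2)[OF l(2,3) j] l(6) unfolding cell
        by (auto simp: bm split: if_splits)
    qed
    have m0: "snd (snd (c (Suc t)) ! 0) = snd (Ts ! 0) + offset (snd (snd (delta M q ss) ! 0))"
      unfolding cS snd_conv act[OF k] by (cases "snd (delta M q ss) ! 0") (simp add: act_eq)
    have 3: "\<alpha> VZ (Suc t) i" if i: "int i = int ctr - snd (snd (c (Suc t)) ! 0)" for i
    proof -
      define l where "l = nat (int ctr - snd (Ts ! 0))"
      have l: "int l = int ctr - snd (Ts ! 0)" "1 \<le> l" "l < width - 1"
        using IH(4) ctr unfolding l_def by (auto simp: ctr_def width_def)
      have "nat (int l + offset (opp (snd (snd (delta M q ss) ! 0)))) = i"
        using l(1) i m0 by simp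
      then show ?thesis using D3(3)[OF l(2,3)] tr IH(3)[OF l(1)] by auto
    qed
    have 4: "\<bar>snd (snd (c (Suc t)) ! 0)\<bar> \<le> int (Suc t)"
      unfolding m0 using IH(4) by (cases "snd (snd (delta M q ss) ! 0)") auto
    show ?case using 1 2 3 4 unfolding cS by auto
  qed
  then show "\<alpha> (VS (fst (c t))) t ctr"
    and "\<And>i j. 1 + t \<le> i \<Longrightarrow> i + t + 1 < width \<Longrightarrow> j < num_tapes M \<Longrightarrow>
      \<alpha> (VC j (cell (snd (c t)) j (int i - int ctr))) t i"
    and "\<And>i. int i = int ctr - snd (snd (c t) ! 0) \<Longrightarrow> \<alpha> VZ t i"
    and "\<bar>snd (snd (c t) ! 0)\<bar> \<le> int t"
    by auto
qed

text \<open>A rejecting run would force all variables that \<open>KRej\<close> negates, in the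
  column of cell 0 at the first halting time \<open>u\<close>. It has to be the first one because
  \<open>run_facts\<close> asks for working states at all earlier times.\<close>

lemma tableau_sound:
  assumes sat: "satisfies \<alpha>" and t: "t < T"
    and halts: "halts_with_output M ((tm_step M ^^ t) (initial_config M (encode_pair x (guessed \<alpha>)))) [b]"
  shows b
proof (rule ccontr)
  assume b: "\<not> b"
  define c where "c t = (tm_step M ^^ t) (initial_config M (encode_pair x (guessed \<alpha>)))" for t
  have T: "0 < T" using t by simp
  define u where "u = (LEAST u. fst (c u) = num_states M)"
  have ct: "fst (c t) = num_states M" using halts by (simp add: halts_with_output_def c_def)
  have u: "fst (c u) = num_states M" "u \<le> t"
    unfolding u_def using ct by (auto intro: LeastI Least_le)
  have before: "\<forall>v<u. fst (c v) < num_states M"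
  proof (intro allI impI)
    fix v assume that: "v < u"
    have "fst (c v) \<noteq> num_states M" using that unfolding u_def by (rule not_less_Least)
    moreover have "valid_config M (c v)" unfolding c_def by (rule valid_funpow[OF wf valid_initial[OF wf]])
    ultimately show "fst (c v) < num_states M" by (simp add: valid_config_def)
  qed
  have "c (u + n) = c u" for n
    using u(1) by (induction n) (auto simp: c_def prod_eq_iff split: prod.splits, (metis fst_conv less_irrefl snd_conv surj_pair tm_step.simps)+)
  then have "c u = c t" using u(2) by (metis le_add_diff_inverse)
  then have out: "tape_holds (hd (snd (c u))) [b]" using halts by (simp add: halts_with_output_def c_def)
  have uT: "u < T" using u t by simp
  note F = run_facts[OF sat T c_def before uT]
  have k: "0 < num_tapes M" using wf by (simp add: wf_tm_def)
  have "length (snd (c u)) = num_tapes M"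
    using valid_funpow[OF wf valid_initial[OF wf]] unfolding c_def by (simp add: valid_config_def)
  then have hd: "hd (snd (c u)) = snd (c u) ! 0" using k by (cases "snd (c u)") auto
  define i where "i = nat (int ctr - snd (snd (c u) ! 0))"
  have i: "int i = int ctr - snd (snd (c u) ! 0)" "1 \<le> i" "i < width - 1" "1 + u \<le> i" "i + u + 1 < width"
    using F(4) uT unfolding i_def by (auto simp: ctr_def width_def)
  have "cell (snd (c u)) 0 (int i - int ctr) = 1"
    using out b unfolding hd i(1) by (simp add: tape_holds_def bit_symbol_def)
  then have "\<alpha> (VC 0 1) u i" using F(2)[OF i(4,5) k] by simp
  moreover have "\<alpha> VZ u i" "\<alpha> (VS (num_states M)) u ctr" using F(1,3) i(1) u(1) by auto
  moreover have "KRej \<in> clause_kinds M" by (auto simp: clause_kinds_def)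
  ultimately show False using satisfiesD[OF sat _ uT i(2,3), of KRej] by auto
qed

fun run_assignment :: "bool list \<Rightarrow> var_kind \<Rightarrow> nat \<Rightarrow> nat \<Rightarrow> bool" where
  "run_assignment y VE t i \<longleftrightarrow> i < guess_start + length y"
| "run_assignment y VB t i \<longleftrightarrow> y ! (i - guess_start)"
| "run_assignment y (VS q) t i \<longleftrightarrow> fst ((tm_step M ^^ t) (initial_config M (encode_pair x y))) = q"
| "run_assignment y (VTr q ss) t i \<longleftrightarrow>
     fst ((tm_step M ^^ t) (initial_config M (encode_pair x y))) = q \<and>
     map scanned (snd ((tm_step M ^^ t) (initial_config M (encode_pair x y)))) = ss"
| "run_assignment y (VC j a) t i \<longleftrightarrow>
     cell (snd ((tm_step M ^^ t) (initial_config M (encode_pair x y)))) j (int i - int ctr) = a"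
| "run_assignment y VZ t i \<longleftrightarrow>
     int i = int ctr - snd (snd ((tm_step M ^^ t) (initial_config M (encode_pair x y))) ! 0)"

text \<open>The facts of any run satisfy the propagating clauses; acceptance matters for
  \<open>KRej\<close> alone. The halting time \<open>t0\<close> may exceed \<open>T\<close>, since a
  run still going at time \<open>T\<close> violates no clause.\<close>

lemma tableau_complete:
  assumes y: "length y \<le> g"
    and acc: "halts_with_output M ((tm_step M ^^ t0) (initial_config M (encode_pair x y))) [True]"
  shows "satisfies (run_assignment y)"
  unfolding satisfies_def
proof (intro ballI allI impI)
  fix \<kappa> t i assume \<kappa>: "\<kappa> \<in> clause_kinds M" and t: "t \<le> T" and i: "i < width"
  let ?\<alpha> = "run_assignment y" and ?z = "encode_pair x y"
  define c where "c t = (tm_step M ^^ t) (initial_config M ?z)" for t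
  show "\<exists>p\<in>set (pats \<kappa> t i). holds ctr ?\<alpha> t i p"
  proof (cases "columns T g x ! i = 5 \<or> t = T")
    case True
    then show ?thesis by (cases \<kappa>) (auto simp: clause_patterns_def)
  next
    case False
    then have i: "1 \<le> i" "i < width - 1"
      using i columns_nth(1,2) by (metis One_nat_def less_one not_le, metis Suc_lessI diff_Suc_1 One_nat_def Suc_pred' gr_zeroI less_diff_conv add.commute plus_1_eq_Suc not_less0)
    have k: "0 < num_tapes M" using wf by (simp add: wf_tm_def)
    obtain q Ts where q: "(tm_step M ^^ t) (initial_config M ?z) = (q, Ts)" by (cases "c t") (auto simp: c_def)
    have v: "valid_config M (q, Ts)"
      using valid_funpow[OF wf valid_initial[OF wf], of t ?z] q by simp
    have len: "length Ts = num_tapes M" using v by (simp add: valid_config_def)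
    have in0: "cell (snd (initial_config M ?z)) 0 p =
        (if 0 \<le> p \<and> p < int (length ?z) then bit_symbol (?z ! nat p) else 0)" for p
      by (simp add: initial_config_def input_tape_def)
    have z: "length ?z = 2 * length x + 1 + length y"
      by (simp add: encode_pair_def length_delimited)
    have step: "(tm_step M ^^ Suc t) (initial_config M ?z) =
        (fst (delta M q (map scanned Ts)), map2 act (snd (delta M q (map scanned Ts))) Ts)"
      if "q < num_states M" using q tm_step_eq[OF that, of Ts] by (simp del: tm_step.simps)
    have dl: "length (snd (delta M q (map scanned Ts))) = num_tapes M" if "q < num_states M"
      using wf_tmD(2)[OF wf that _ valid_scanned[OF v]] len by simp
    have "\<exists>p\<in>set (patterns M \<kappa> (columns T g x ! i) (i = ctr)). holds ctr ?\<alpha> t i p"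
    proof (cases \<kappa>)
      case (KPair v)
      then show ?thesis by auto
    next
      case KState0
      then show ?thesis by (simp add: initial_config_def)
    next
      case (KBlank j)
      then have "j < num_tapes M" "j \<noteq> 0" using \<kappa> by (auto simp: clause_kinds_def var_list)
      then show ?thesis using KBlank by (simp add: initial_config_def blank_tape_def nth_Cons')
    next
      case KZ0
      then show ?thesis by (simp add: initial_config_def input_tape_def)
    next
      case (KIn n)
      then have n: "n < 4" using \<kappa> by (auto simp: clause_kinds_def)
      from i show ?thesis
      proof (cases rule: column_cases)
        case 1
        then show ?thesis using KIn n in0 by auto
      next
        case (2 l)
        then have "?z ! l = delimited x ! l" by (simp add: encode_pair_def nth_append length_delimited)
        then show ?thesis using KIn n 2 in0[of "int l"] z by (auto simp: bit_symbol_def)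
      next
        case (3 e)
        have p: "int i - int ctr = int (2 * length x + 1 + e)" using 3 by (simp add: guess_start_def)
        have ze: "?z ! (2 * length x + 1 + e) = y ! e"
          by (simp add: encode_pair_def nth_append length_delimited)
        have cell: "cell (snd (initial_config M ?z)) 0 (int i - int ctr) =
            (if e < length y then bit_symbol (y ! e) else 0)"
          unfolding in0 p z nat_int using ze by auto
        consider "n = 0" | "n = 1" | "n = 2" | "n = 3" using n by linarith
        then show ?thesis
          using 3 KIn cell by cases (auto simp: bit_symbol_def nat_add_distrib)
      next
        case 4
        then have "int (length ?z) \<le> int i - int ctr" unfolding z using y by (simp add: guess_start_def)
        then show ?thesis using KIn n 4 in0[of "int i - int ctr"] by auto
      qed
    next
      case (KTr r ss)
      then have "length ss = num_tapes M" using \<kappa> by (auto simp: clause_kinds_def symbol_lists_def)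
      show ?thesis
      proof (cases "map scanned Ts = ss")
        case True
        then show ?thesis using KTr q by auto
      next
        case False
        then obtain j where "j < num_tapes M" "scanned (Ts ! j) \<noteq> ss ! j"
          using len \<open>length ss = num_tapes M\<close> by (metis length_map nth_equalityI nth_map)
        then show ?thesis using KTr q by (auto simp: scanned_def)
      qed
    next
      case (KNext r ss)
      then have "r < num_states M" using \<kappa> by (auto simp: clause_kinds_def)
      then show ?thesis using KNext q step by (auto simp del: funpow.simps)
    next
      case (KShift r ss j a)
      then have r: "r < num_states M" "j < num_tapes M" using \<kappa> by (auto simp: clause_kinds_def)
      show ?thesis
      proof (cases "r = q \<and> map scanned Ts = ss")
        case True
        obtain b m where bm: "snd (delta M q ss) ! j = (b, m)" by fastforce
        have "snd ((tm_step M ^^ Suc t) (initial_config M ?z)) ! j = act (b, m) (Ts ! j)"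
          using step dl True r len bm by auto
        moreover have "int (nat (int i - offset m)) = int i - offset m" using i(1) by (cases m) auto
        ultimately show ?thesis using KShift q True bm
          by (auto simp: act_eq algebra_simps simp del: funpow.simps)
      next
        case False
        obtain b m where "snd (delta M r ss) ! j = (b, m)" by fastforce
        then show ?thesis using KShift q False by auto
      qed
    next
      case (KZ r ss)
      then have r: "r < num_states M" using \<kappa> by (auto simp: clause_kinds_def)
      show ?thesis
      proof (cases "r = q \<and> map scanned Ts = ss")
        case True
        obtain b m where bm: "snd (delta M q ss) ! 0 = (b, m)" by fastforce
        have "snd ((tm_step M ^^ Suc t) (initial_config M ?z)) ! 0 = act (b, m) (Ts ! 0)"
          using step dl True r len bm k by auto
        moreover have "int (nat (int i - offset m)) = int i - offset m" using i(1) by (cases m) auto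
        ultimately show ?thesis using KZ q True bm
          by (auto simp: act_eq algebra_simps simp del: funpow.simps)
      next
        case False
        then show ?thesis using KZ q by auto
      qed
    next
      case KRej
      show ?thesis
      proof (cases "q = num_states M \<and> int i = int ctr - snd (Ts ! 0)")
        case True
        have stay: "(tm_step M ^^ n) (num_states M, Us) = (num_states M, Us)" for n Us
          by (induction n) auto
        \<comment> \<open>Configurations no longer change once halted, and both \<open>t\<close> and
          \<open>t0\<close> are halting times; performing the \<open>t + t0\<close> steps in either
          order identifies the two configurations.\<close>
        have "(q, Ts) = (tm_step M ^^ (t + t0)) (initial_config M ?z)"
          using q True stay[of t0 Ts] by (simp add: add.commute[of t] funpow_add)
        also have "\<dots> = (tm_step M ^^ t0) (initial_config M ?z)"
          using acc stay[of t] by (simp add: funpow_add halts_with_output_def) (metis prod.collapse)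
        finally have "tape_holds (hd Ts) [True]" using acc by (metis halts_with_output_def snd_conv)
        then have "cell Ts 0 (int i - int ctr) = 2"
          using True len k by (cases Ts) (auto simp: tape_holds_def bit_symbol_def)
        then show ?thesis using KRej q by auto
      next
        case False
        then show ?thesis using KRej q by auto
      qed
    qed
    then show ?thesis using False by (auto simp: clause_patterns_def)
  qed
qed

text \<open>The tautologies at the border keep every literal inside the grid. The last claim says
  that \<open>nat\<close> in \<open>ival\<close> does not truncate, which reconciles it with
  comparisons of columns as integers.\<close>

lemma patterns_range:
  assumes \<kappa>: "\<kappa> \<in> clause_kinds M" and t: "t \<le> T" and i: "i < width"
    and p: "(b, v, ts, is) \<in> set (pats \<kappa> t i)"
  shows "v \<in> set (var_list M)" "tval ts t \<le> T" "ival ctr is i < width"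
    "is = Rel m \<Longrightarrow> 0 \<le> int i + offset m"
proof -
  have ctr: "ctr < width" by (simp add: ctr_def width_def)
  have triv: "v \<in> set (var_list M) \<and> ts = Tcur \<and> is = Rel Stay"
    if "is_pair \<kappa> \<or> columns T g x ! i = 5 \<or> t = T"
    using that p \<kappa> by (cases \<kappa>) (auto simp: clause_patterns_def clause_kinds_def var_list)
  have v: "v \<in> set (var_list M)" if "\<not> (is_pair \<kappa> \<or> columns T g x ! i = 5 \<or> t = T)"
  proof -
    have b: "fst (snd (delta M q ss) ! j) < num_symbols M" "fst (delta M q ss) \<le> num_states M"
      if "q < num_states M" "ss \<in> symbol_lists M" "j < num_tapes M" for q ss j
      using wf_tmD[OF wf, of q ss] that by (auto simp: symbol_lists_def)
    have S: "3 \<le> num_symbols M" "0 < num_tapes M" using wf by (auto simp: wf_tm_def)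
    have sl: "ss ! j < num_symbols M" if "ss \<in> symbol_lists M" "j < num_tapes M" for ss j
      using that by (auto simp: symbol_lists_def subset_iff)
    have col: "columns T g x ! i < 5"
    proof -
      have "\<forall>s \<in> set (columns T g x). s \<le> 5" by (auto simp: columns_def)
      then have "columns T g x ! i \<le> 5" using i length_columns by (metis nth_mem)
      then show ?thesis using that by auto
    qed
    show ?thesis
    proof (cases \<kappa>)
      case (KNext q ss)
      then show ?thesis using that p \<kappa> b[of q ss 0] S
        by (auto simp: clause_patterns_def clause_kinds_def var_list var_kinds_def)
    next
      case (KShift q ss j a)
      obtain b' m' where "snd (delta M q ss) ! j = (b', m')" by fastforce
      then show ?thesis using KShift that p \<kappa> b[of q ss j] S
        by (auto simp: clause_patterns_def clause_kinds_def var_list var_kinds_def split: if_splits prod.splits)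
    qed (use that p \<kappa> S sl col in
      \<open>auto simp: clause_patterns_def clause_kinds_def var_list var_kinds_def split: if_splits\<close>)
  qed
  show "v \<in> set (var_list M)" using v triv by blast
  show "tval ts t \<le> T" using triv t by (cases "t = T"; cases ts) auto
  have edge: "i \<noteq> 0 \<and> i \<noteq> width - 1" if "columns T g x ! i \<noteq> 5"
    using that columns_nth(1,2) by metis
  show "ival ctr is i < width"
  proof (cases "is_pair \<kappa> \<or> columns T g x ! i = 5 \<or> t = T")
    case True
    then show ?thesis using triv i by simp
  next
    case False
    then have "i \<noteq> width - 1" using edge by blast
    then show ?thesis
    proof (cases "is")
      case (Rel r)
      then show ?thesis using \<open>i \<noteq> width - 1\<close> i by (cases r) auto
    qed (use ctr in simp)
  qed
  show "0 \<le> int i + offset m" if "is = Rel m"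
  proof (cases "is_pair \<kappa> \<or> columns T g x ! i = 5 \<or> t = T")
    case True
    then show ?thesis using triv that by simp
  next
    case False
    then have "i \<noteq> 0" using edge by blast
    then show ?thesis by (cases m) auto
  qed
qed

end

section \<open>The gap of the network design instance\<close>

lemma mu_eq:
  assumes "E' \<subseteq> V \<times> V"
  shows "wf_digraph.\<mu> (with_proj \<lparr>pverts = V, parcs = E'\<rparr>) f u v =
    (INF p \<in> {p. u \<in> V \<and> set p \<subseteq> E' \<and> pcas u p v}. ereal (sum_list (map f p)))"
proof -
  interpret wf_digraph "with_proj \<lparr>pverts = V, parcs = E'\<rparr>"
    using assms by unfold_locales auto
  show ?thesis by (simp add: \<mu>_def awalk_def awalk_cost_def cas_with_proj_eq)
qed

text \<open>A cut argument, to be used with \<open>e\<close> the arc from the root to the relay, the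
  only arc of positive length.\<close>

lemma walk_leaves:
  assumes "\<And>a b. (a, b) \<in> E' \<Longrightarrow> a \<in> X \<Longrightarrow> (a, b) = e \<or> b \<in> X"
  shows "set p \<subseteq> E' \<Longrightarrow> pcas u p v \<Longrightarrow> u \<in> X \<Longrightarrow> v \<notin> X \<Longrightarrow> e \<in> set p"
proof (induction p arbitrary: u)
  case (Cons x p)
  then show ?case using assms[of "fst x" "snd x"] by (cases x) auto
qed auto

lemma sum_powers_of_two: "(\<Sum>v<m. 2 ^ v) = (2 ^ m - 1 :: nat)"
  by (induction m) auto

lemma sum_pairs: "(\<Sum>k<2 * m. f k) = (\<Sum>v<m. f (2 * v) + f (2 * v + 1))" for f :: "nat \<Rightarrow> nat"
  by (induction m) auto

lemma sum_slow:
  "(\<Sum>u<n :: nat. \<Sum>v<n. ereal (of_bool (v \<in> S))) = ereal (real n * real (card ({..<n} \<inter> S)))"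
proof -
  have "(\<Sum>v<n. of_bool (v \<in> S) :: real) = real (card ({..<n} \<inter> S))"
    by (simp add: sum_of_bool_eq)
  then show ?thesis by simp
qed

text \<open>
  A hitting set instance with \<open>m\<close> variables and \<open>M\<close> clauses, where \<open>hit c v b\<close> says that clause
  \<open>c\<close> contains variable \<open>v\<close> (if \<open>b\<close>) or its negation. The vertices are a root 0, a slow relay 1,
  the literals \<open>2 + 2 * v\<close> and \<open>3 + 2 * v\<close>, and \<open>N\<close> copies of every clause. Only the arcs from the
  root to the literals cost weight, namely \<open>2 ^ v\<close>, and the budget \<open>2 ^ m - 1\<close> suffices for exactly
  one literal of every variable. Only the arc from the root to the relay has a positive length.
\<close>

definition gap_arcs :: "nat \<Rightarrow> nat \<Rightarrow> nat \<Rightarrow> (nat \<Rightarrow> nat \<Rightarrow> bool \<Rightarrow> bool) \<Rightarrow> (nat \<times> nat) set" where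
  "gap_arcs m M N hit =
     (\<lambda>i. (i, 0)) ` {1..<2 + 2 * m + M * N} \<union> {(0, 1)} \<union> {0, 1} \<times> {2..<2 + 2 * m} \<union>
     {(2 + k, 2 + 2 * m + l) | k l. k < 2 * m \<and> l < M * N \<and> hit (l div N) (k div 2) (even k)}"

definition gap_instance :: "nat \<Rightarrow> nat \<Rightarrow> nat \<Rightarrow> (nat \<Rightarrow> nat \<Rightarrow> bool \<Rightarrow> bool) \<Rightarrow> nat dindp_instance" where
  "gap_instance m M N hit =
     \<lparr>inst_graph = \<lparr>pverts = {..<2 + 2 * m + M * N}, parcs = gap_arcs m M N hit\<rparr>,
      inst_weight = (\<lambda>(i, j). if i = 0 \<and> 2 \<le> j then 2 ^ ((j - 2) div 2) else 0),
      inst_dist = (\<lambda>(i, j). if i = 0 \<and> j = 1 then 1 else 0),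
      inst_budget = 2 ^ m - 1\<rparr>"

context
  fixes m M N :: nat and hit :: "nat \<Rightarrow> nat \<Rightarrow> bool \<Rightarrow> bool"
begin

abbreviation "gap_order \<equiv> 2 + 2 * m + M * N"
abbreviation "gap_edges \<equiv> gap_arcs m M N hit"
abbreviation "gap_inst \<equiv> gap_instance m M N hit"

lemma gap_arcs_subset: "gap_edges \<subseteq> {..<gap_order} \<times> {..<gap_order}"
  by (auto simp: gap_arcs_def)

lemma finite_gap_arcs: "finite gap_edges"
  using gap_arcs_subset by (rule finite_subset) auto

lemma gap_instance_input: "dindp_input gap_inst"
proof -
  have "pair_fin_digraph (inst_graph gap_inst)"
    using gap_arcs_subset finite_gap_arcs by unfold_locales (auto simp: gap_instance_def)
  then show ?thesis by (auto simp: dindp_input_def gap_instance_def)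
qed

lemma feasible_iff:
  "feasible gap_inst E' \<longleftrightarrow> E' \<subseteq> gap_edges \<and>
     (\<Sum>v<m. 2 ^ v * (of_bool ((0, 2 + 2 * v) \<in> E') + of_bool ((0, 3 + 2 * v) \<in> E'))) \<le> (2 ^ m - 1 :: nat)"
proof -
  have "(\<Sum>e\<in>E'. inst_weight gap_inst e) =
      (\<Sum>v<m. 2 ^ v * (of_bool ((0, 2 + 2 * v) \<in> E') + of_bool ((0, 3 + 2 * v) \<in> E')))"
    if E': "E' \<subseteq> gap_edges"
  proof -
    let ?B = "(\<lambda>k. (0, 2 + k)) ` {..<2 * m}"
    have fin: "finite E'" using E' finite_gap_arcs by (rule finite_subset)
    have "(\<Sum>e\<in>E'. inst_weight gap_inst e) = (\<Sum>e\<in>E' \<inter> ?B. inst_weight gap_inst e)"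
    proof (rule sum.mono_neutral_right)
      show "\<forall>e\<in>E' - E' \<inter> ?B. inst_weight gap_inst e = 0"
      proof
        fix e assume e: "e \<in> E' - E' \<inter> ?B"
        then have "e \<in> gap_edges" using E' by auto
        moreover have "e \<notin> {0} \<times> {2..<2 + 2 * m}"
        proof
          assume "e \<in> {0} \<times> {2..<2 + 2 * m}"
          then have "e = (0, 2 + (snd e - 2))" "snd e - 2 < 2 * m" by auto
          then have "e \<in> ?B" by blast
          then show False using e by auto
        qed
        ultimately show "inst_weight gap_inst e = 0" by (auto simp: gap_arcs_def gap_instance_def)
      qed
    qed (use fin in auto)
    also have "\<dots> = (\<Sum>e\<in>?B. of_bool (e \<in> E') * inst_weight gap_inst e)"
      by (rule sum.mono_neutral_cong_left) auto
    also have "\<dots> = (\<Sum>k<2 * m. of_bool ((0, 2 + k) \<in> E') * 2 ^ (k div 2))"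
      by (subst sum.reindex) (auto simp: inj_on_def gap_instance_def)
    also have "\<dots> = (\<Sum>v<m. 2 ^ v * (of_bool ((0, 2 + 2 * v) \<in> E') + of_bool ((0, 3 + 2 * v) \<in> E')))"
      unfolding sum_pairs by (intro sum.cong) (auto simp: numeral_3_eq_3)
    finally show ?thesis .
  qed
  then show ?thesis by (auto simp: feasible_def gap_instance_def)
qed

text \<open>One literal per variable already exhausts the budget, since the powers
  \<open>2 ^ v\<close> add up to \<open>2 ^ m - 1\<close>; a second literal of any variable makes
  the sum strictly larger.\<close>

lemma exactly_one:
  assumes feas: "feasible gap_inst E'" and some: "\<And>v. v < m \<Longrightarrow> (0, 2 + 2 * v) \<in> E' \<or> (0, 3 + 2 * v) \<in> E'"
    and v: "v < m" "(0, 2 + 2 * v) \<in> E'"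
  shows "(0, 3 + 2 * v) \<notin> E'"
proof
  assume both: "(0, 3 + 2 * v) \<in> E'"
  have "(\<Sum>v<m. 2 ^ v) < (\<Sum>v<m. 2 ^ v * (of_bool ((0, 2 + 2 * v) \<in> E') + of_bool ((0, 3 + 2 * v) \<in> E')) :: nat)"
    by (rule sum_strict_mono_ex1) (use some v both in force)+
  also have "\<dots> \<le> 2 ^ m - 1" using feas by (simp add: feasible_iff)
  finally show False by (simp add: sum_powers_of_two)
qed

lemma solution_cost_eq:
  "solution_cost gap_inst E' = (\<Sum>u<gap_order. \<Sum>v<gap_order. wf_digraph.\<mu> (with_proj \<lparr>pverts = {..<gap_order}, parcs = E'\<rparr>)
     (\<lambda>e. real (inst_dist gap_inst e)) u v)"
  by (simp add: solution_cost_def routing_cost_def gap_instance_def lessThan_def)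

text \<open>Keep all arcs except those from the root to the false literals. Every vertex returns to
  the root at length 0; from there the relay and the \<open>m\<close> false literals cost at most 1,
  and all else is reached at length 0, clause copies through a true literal. This accounts for the
  factor \<open>m + 1\<close>.\<close>

lemma cost_satisfiable:
  assumes sat: "\<And>c. c < M \<Longrightarrow> \<exists>v<m. hit c v (\<alpha> v)"
  shows "optimal_cost gap_inst \<le> ereal (real (gap_order * (m + 1)))"
proof -
  define un where "un v = (if \<alpha> v then 3 + 2 * v else 2 + 2 * v)" for v
  define E' where "E' = gap_edges - (\<lambda>v. (0, un v)) ` {..<m}"
  have sub: "E' \<subseteq> gap_edges" by (auto simp: E'_def)
  have in_E: "(0, 2 + 2 * v) \<in> E' \<longleftrightarrow> \<alpha> v" "(0, 3 + 2 * v) \<in> E' \<longleftrightarrow> \<not> \<alpha> v" if "v < m" for v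
    using that by (auto simp: E'_def gap_arcs_def un_def split: if_splits) presburger+
  have feas: "feasible gap_inst E'"
  proof -
    have "(\<Sum>v<m. 2 ^ v * (of_bool ((0, 2 + 2 * v) \<in> E') + of_bool ((0, 3 + 2 * v) \<in> E'))) =
        (\<Sum>v<m. 2 ^ v :: nat)"
      by (rule sum.cong) (use in_E in auto)
    then show ?thesis unfolding feasible_iff using sub by (simp add: sum_powers_of_two)
  qed
  define slow where "slow = insert 1 (un ` {..<m})"
  have walk: "wf_digraph.\<mu> (with_proj \<lparr>pverts = {..<gap_order}, parcs = E'\<rparr>) (\<lambda>e. real (inst_dist gap_inst e)) u v
      \<le> ereal (of_bool (v \<in> slow))" if uv: "u < gap_order" "v < gap_order" for u v
  proof -
    have via: "\<exists>p. set p \<subseteq> E' \<and> pcas 0 p v \<and> sum_list (map (\<lambda>e. real (inst_dist gap_inst e)) p) = of_bool (v \<in> slow)"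
    proof -
      consider "v = 0" | "v = 1" | k where "v = 2 + k" "k < 2 * m" "v \<in> slow"
        | k where "v = 2 + k" "k < 2 * m" "v \<notin> slow" | l where "v = 2 + 2 * m + l" "l < M * N"
      proof -
        have "v = 0 \<or> v = 1 \<or> v = 2 + (v - 2) \<and> v - 2 < 2 * m \<or>
           v = 2 + 2 * m + (v - 2 - 2 * m) \<and> v - 2 - 2 * m < M * N"
          using uv(2) by linarith
        then show ?thesis using that by blast
      qed
      then show ?thesis
      proof cases
        case 1
        then show ?thesis by (intro exI[of _ "[]"]) (auto simp: slow_def un_def)
      next
        case 2
        then have "(0, 1) \<in> E'" by (auto simp: E'_def gap_arcs_def un_def split: if_splits)
        then show ?thesis using 2 by (intro exI[of _ "[(0, 1)]"]) (auto simp: slow_def gap_instance_def)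
      next
        case (3 k)
        then have "(0, 1) \<in> E'" "(1, 2 + k) \<in> E'" by (auto simp: E'_def gap_arcs_def un_def split: if_splits)
        then show ?thesis using 3 by (intro exI[of _ "[(0, 1), (1, 2 + k)]"]) (auto simp: gap_instance_def)
      next
        case (4 k)
        then have "(0, 2 + k) \<in> E'" by (auto simp: E'_def gap_arcs_def slow_def)
        then show ?thesis using 4 by (intro exI[of _ "[(0, 2 + k)]"]) (auto simp: gap_instance_def)
      next
        case (5 l)
        then have "l div N < M" by (simp add: less_mult_imp_div_less)
        then obtain w where w: "w < m" "hit (l div N) w (\<alpha> w)" using sat by blast
        define k where "k = (if \<alpha> w then 2 * w else 2 * w + 1)"
        have k: "k < 2 * m" "k div 2 = w" "even k = \<alpha> w" using w by (auto simp: k_def)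
        have "(0, 2 + k) \<in> E'" using in_E[OF w(1)] by (auto simp: k_def eval_nat_numeral)
        moreover have "(2 + k, v) \<in> E'"
          using 5 k w by (auto simp: E'_def gap_arcs_def)
        moreover have "v \<notin> slow" using 5 by (auto simp: slow_def un_def split: if_splits)
        ultimately show ?thesis using 5 by (intro exI[of _ "[(0, 2 + k), (2 + k, v)]"]) (auto simp: gap_instance_def)
      qed
    qed
    then obtain p where p: "set p \<subseteq> E'" "pcas 0 p v"
      "sum_list (map (\<lambda>e. real (inst_dist gap_inst e)) p) = of_bool (v \<in> slow)" by blast
    have "\<exists>p. set p \<subseteq> E' \<and> pcas u p v \<and> sum_list (map (\<lambda>e. real (inst_dist gap_inst e)) p) = of_bool (v \<in> slow)"
    proof (cases "u = 0")
      case True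
      then show ?thesis using p by blast
    next
      case False
      then have "(u, 0) \<in> E'" using uv by (auto simp: E'_def gap_arcs_def)
      then show ?thesis using p False by (intro exI[of _ "(u, 0) # p"]) (auto simp: gap_instance_def)
    qed
    then obtain p where p: "set p \<subseteq> E'" "pcas u p v"
      "sum_list (map (\<lambda>e. real (inst_dist gap_inst e)) p) = of_bool (v \<in> slow)" by blast
    show ?thesis
      by (subst mu_eq) (use sub gap_arcs_subset p uv in \<open>auto intro!: INF_lower2[of p]\<close>)
  qed
  have "solution_cost gap_inst E' \<le> (\<Sum>u<gap_order. \<Sum>v<gap_order. ereal (of_bool (v \<in> slow)))"
    unfolding solution_cost_eq by (intro sum_mono walk) auto
  also have "\<dots> = ereal (real gap_order * real (card ({..<gap_order} \<inter> slow)))"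
    by (rule sum_slow)
  also have "card ({..<gap_order} \<inter> slow) \<le> card slow" by (rule card_mono) (auto simp: slow_def)
  then have "real gap_order * real (card ({..<gap_order} \<inter> slow)) \<le> real (gap_order * (m + 1))"
  proof -
    have "card slow \<le> Suc (card (un ` {..<m}))" unfolding slow_def by (rule card_insert_le_m1) auto
    also have "card (un ` {..<m}) \<le> m" by (metis card_image_le card_lessThan finite_lessThan)
    finally have "card ({..<gap_order} \<inter> slow) \<le> m + 1" using \<open>card ({..<gap_order} \<inter> slow) \<le> card slow\<close> by simp
    then show ?thesis by (metis mult_le_mono2 of_nat_le_iff of_nat_mult)
  qed
  finally have "solution_cost gap_inst E' \<le> ereal (real (gap_order * (m + 1)))" by simp
  moreover have "optimal_cost gap_inst \<le> solution_cost gap_inst E'"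
  proof -
    have "{solution_cost gap_inst E' | E'. feasible gap_inst E'} \<subseteq> solution_cost gap_inst ` Pow gap_edges"
      by (auto simp: feasible_iff)
    then have "finite {solution_cost gap_inst E' | E'. feasible gap_inst E'}"
      by (rule finite_subset) (simp add: finite_gap_arcs)
    then show ?thesis unfolding optimal_cost_def using feas by (intro Min_le) auto
  qed
  ultimately show ?thesis by (rule order_trans[rotated])
qed

text \<open>If no bought literal hits clause \<open>c\<close>, each of its \<open>N\<close> copies
  is reached from the root and from every other clause copy only through the relay.\<close>

lemma cost_unhit:
  assumes feas: "feasible gap_inst E'" and c: "c < M"
    and unhit: "\<And>v b. v < m \<Longrightarrow> hit c v b \<Longrightarrow> (0, if b then 2 + 2 * v else 3 + 2 * v) \<notin> E'"
  shows "ereal (real (N * N * M)) \<le> solution_cost gap_inst E'"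
proof -
  have sub: "E' \<subseteq> gap_edges" using feas by (simp add: feasible_iff)
  define U where "U = insert 0 {2 + 2 * m..<gap_order}"
  define C where "C = {2 + 2 * m + c * N..<2 + 2 * m + c * N + N}"
  let ?\<mu> = "wf_digraph.\<mu> (with_proj \<lparr>pverts = {..<gap_order}, parcs = E'\<rparr>) (\<lambda>e. real (inst_dist gap_inst e))"
  have "c * N + N \<le> M * N" using c by (metis Suc_leI add.commute mult_Suc mult_le_mono1)
  then have CU: "C \<subseteq> U" "U \<subseteq> {..<gap_order}" by (auto simp: C_def U_def)
  have "ereal (of_bool ((u, v) \<in> U \<times> C - Id)) \<le> ?\<mu> u v" if uv: "u < gap_order" "v < gap_order" for u v
  proof (subst mu_eq)
    show "E' \<subseteq> {..<gap_order} \<times> {..<gap_order}" using sub gap_arcs_subset by blast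
    show "ereal (of_bool ((u, v) \<in> U \<times> C - Id)) \<le>
      (INF p \<in> {p. u \<in> {..<gap_order} \<and> set p \<subseteq> E' \<and> pcas u p v}. ereal (sum_list (map (\<lambda>e. real (inst_dist gap_inst e)) p)))"
    proof (rule INF_greatest)
      fix p assume "p \<in> {p. u \<in> {..<gap_order} \<and> set p \<subseteq> E' \<and> pcas u p v}"
      then have p: "set p \<subseteq> E'" "pcas u p v" by auto
      have "of_bool ((u, v) \<in> U \<times> C - Id) \<le> sum_list (map (inst_dist gap_inst) p)"
      proof (cases "(u, v) \<in> U \<times> C - Id")
        case True
        \<comment> \<open>\<open>X\<close> encloses all that \<open>U\<close> reaches at length 0
          short of \<open>v\<close>: root, clause copies and bought literals, but not the relay.
          Arcs into \<open>v\<close> start at literals hitting \<open>c\<close>, none of which is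
          bought, so only \<open>(0, 1)\<close> leaves \<open>X\<close>.\<close>
        define X where "X = U \<union> {j. (0, j) \<in> E' \<and> 2 \<le> j \<and> j < 2 + 2 * m} - {v}"
        have "b \<in> X \<or> (a, b) = (0, 1)" if ab: "(a, b) \<in> E'" "a \<in> X" for a b
        proof -
          have v: "2 + 2 * m \<le> v" using True by (auto simp: C_def)
          have "(a, b) \<in> gap_edges" using ab sub by auto
          then consider "b = 0" | "(a, b) = (0, 1)" | "a = 0" "2 \<le> b" "b < 2 + 2 * m" | "a = 1"
            | k l where "a = 2 + k" "b = 2 + 2 * m + l" "k < 2 * m" "l < M * N" "hit (l div N) (k div 2) (even k)"
            by (auto simp: gap_arcs_def)
          then show ?thesis
          proof cases
            case 1
            then show ?thesis using v by (auto simp: X_def U_def)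
          next
            case 3
            then show ?thesis using v ab by (auto simp: X_def)
          next
            case 4
            then show ?thesis using ab by (auto simp: X_def U_def)
          next
            case (5 k l)
            have "b \<noteq> v"
            proof
              assume "b = v"
              then have "l div N = c" using 5 True by (auto simp: C_def mult.commute intro!: div_nat_eqI)
              then have "(0, if even k then 2 + 2 * (k div 2) else 3 + 2 * (k div 2)) \<notin> E'"
                using unhit[of "k div 2" "even k"] 5 by auto
              moreover have "(if even k then 2 + 2 * (k div 2) else 3 + 2 * (k div 2)) = 2 + k"
                by (auto elim!: oddE evenE)
              ultimately have "(0, a) \<notin> E'" using 5 by simp
              then show False using ab 5 by (auto simp: X_def U_def)
            qed
            then show ?thesis using 5 by (auto simp: X_def U_def)
          qed auto
        qed
        then have "(0, 1) \<in> set p"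
          using walk_leaves[of E' X "(0, 1)" p u v] p True by (auto simp: X_def)
        then have "inst_dist gap_inst (0, 1) \<le> sum_list (map (inst_dist gap_inst) p)"
          by (intro member_le_sum_list) auto
        then show ?thesis by (simp add: gap_instance_def)
      qed auto
      then have "real (of_bool ((u, v) \<in> U \<times> C - Id)) \<le> real (sum_list (map (inst_dist gap_inst) p))"
        by (simp only: of_nat_le_iff)
      also have "real (sum_list (map (inst_dist gap_inst) p)) = sum_list (map (\<lambda>e. real (inst_dist gap_inst e)) p)"
        by (induction p) auto
      finally show "ereal (of_bool ((u, v) \<in> U \<times> C - Id)) \<le> ereal (sum_list (map (\<lambda>e. real (inst_dist gap_inst e)) p))"
        by simp
    qed
  qed
  then have "(\<Sum>u<gap_order. \<Sum>v<gap_order. ereal (of_bool ((u, v) \<in> U \<times> C - Id))) \<le> solution_cost gap_inst E'"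
    unfolding solution_cost_eq by (intro sum_mono) auto
  also have "(\<Sum>u<gap_order. \<Sum>v<gap_order. ereal (of_bool ((u, v) \<in> U \<times> C - Id))) =
      ereal (\<Sum>e\<in>{..<gap_order} \<times> {..<gap_order}. of_bool (e \<in> U \<times> C - Id))"
    unfolding sum_ereal sum.cartesian_product by (intro arg_cong[where f = ereal] sum.cong) auto
  also have "(\<Sum>e\<in>{..<gap_order} \<times> {..<gap_order}. of_bool (e \<in> U \<times> C - Id) :: real) = real (card (U \<times> C - Id))"
  proof -
    have "{..<gap_order} \<times> {..<gap_order} \<inter> {e. e \<in> U \<times> C - Id} = U \<times> C - Id" using CU by auto
    then show ?thesis by (simp only: sum_of_bool_eq finite_cartesian_product finite_lessThan)
  qed
  \<comment> \<open>The root as an additional source makes up exactly for the excluded diagonal: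
    \<open>(1 + M * N) * N - N\<close>.\<close>
  also have "card (U \<times> C - Id) = N * N * M"
  proof -
    have fin: "finite (U \<times> C)" by (auto simp: U_def C_def)
    have "U \<times> C - Id = U \<times> C - (\<lambda>v. (v, v)) ` C" by auto
    moreover have "card (U \<times> C - (\<lambda>v. (v, v)) ` C) = card (U \<times> C) - card ((\<lambda>v. (v, v)) ` C)"
      using CU fin by (intro card_Diff_subset) (auto simp: C_def)
    moreover have "card ((\<lambda>v. (v, v)) ` C) = N" by (subst card_image) (auto simp: inj_on_def C_def)
    moreover have "card (U \<times> C) = (1 + M * N) * N" by (simp add: card_cartesian_product U_def C_def)
    ultimately show ?thesis by (simp add: algebra_simps)
  qed
  finally show ?thesis .
qed

text \<open>A single clause without a bought literal would already exceed the guaranteed cost.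
  Applied to the clauses in \<open>pairs\<close>, this yields at least one literal of every
  variable; by \<open>exactly_one\<close> the arcs to the positive literals then define a consistent
  assignment.\<close>

lemma gap:
  assumes pairs: "\<And>v. v < m \<Longrightarrow> \<exists>c<M. \<forall>v' b. v' < m \<longrightarrow> hit c v' b \<longrightarrow> v' = v"
    and sat: "\<And>c. c < M \<Longrightarrow> \<exists>v<m. hit c v (\<alpha> v)"
    and feas: "feasible gap_inst E'" and cost: "solution_cost gap_inst E' \<le> ereal r * optimal_cost gap_inst"
    and r: "0 \<le> r" "r * real (gap_order * (m + 1)) < real (N * N * M)"
    and c: "c < M"
  shows "\<exists>v<m. hit c v ((0, 2 + 2 * v) \<in> E')"
proof -
  have hits: "\<exists>v b. v < m \<and> hit c v b \<and> (0, if b then 2 + 2 * v else 3 + 2 * v) \<in> E'" if c: "c < M" for c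
  proof (rule ccontr)
    assume "\<not> ?thesis"
    then have "ereal (real (N * N * M)) \<le> solution_cost gap_inst E'"
      by (intro cost_unhit[OF feas c]) auto
    also have "\<dots> \<le> ereal r * ereal (real (gap_order * (m + 1)))"
      using cost cost_satisfiable[of \<alpha>] sat r(1) by (meson ereal_mult_left_mono order_trans ereal_less_eq(5))
    finally show False using r(2) by simp
  qed
  have some: "(0, 2 + 2 * v) \<in> E' \<or> (0, 3 + 2 * v) \<in> E'" if v: "v < m" for v
  proof -
    obtain c' where "c' < M" "\<forall>v' b. v' < m \<longrightarrow> hit c' v' b \<longrightarrow> v' = v" using pairs[OF v] by blast
    then show ?thesis using hits[of c'] by (auto split: if_splits)
  qed
  obtain v b where vb: "v < m" "hit c v b" "(0, if b then 2 + 2 * v else 3 + 2 * v) \<in> E'"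
    using hits[OF c] by blast
  have "b = ((0, 2 + 2 * v) \<in> E')"
    using exactly_one[OF feas some vb(1)] vb(3) by (auto split: if_splits)
  then show ?thesis using vb by blast
qed

end

section \<open>Encoding the instance\<close>

lemma concat_map_mult:
  "concat (map f [0..<a * b]) = concat (map (\<lambda>i. concat (map (\<lambda>j. f (i * b + j)) [0..<b])) [0..<a])"
proof (induction a)
  case (Suc a)
  have "[0..<Suc a * b] = [0..<a * b] @ map (\<lambda>j. a * b + j) [0..<b]"
    by (rule nth_equalityI) (auto simp: nth_append)
  then show ?case using Suc by (simp add: o_def)
qed auto

lemma concat_map_double:
  "concat (map f [0..<2 * a]) = concat (map (\<lambda>i. f (2 * i) @ f (2 * i + 1)) [0..<a])"
  by (induction a) auto

lemma concat_map_split: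
  "concat (map f [0..<2 + a + b]) =
     f 0 @ f 1 @ concat (map (\<lambda>i. f (2 + i)) [0..<a]) @ concat (map (\<lambda>i. f (2 + a + i)) [0..<b])"
proof -
  have "[0..<2 + a + b] = [0, 1] @ map (\<lambda>i. 2 + i) [0..<a] @ map (\<lambda>i. 2 + a + i) [0..<b]"
    by (rule nth_equalityI) (auto simp: nth_append nth_Cons')
  then show ?thesis by (simp add: o_def)
qed

lemma concat_map_const: "concat (map (\<lambda>i. w) [0..<a]) = concat (replicate a w)"
  by (simp add: map_replicate_const)

lemma concat_map_product: "concat (map f (List.product xs ys)) = concat (map (\<lambda>x. concat (map (\<lambda>y. f (x, y)) ys)) xs)"
  by (induction xs) (auto simp: o_def)

lemma binary_power: "binary (2 ^ v) = replicate v False @ [True]"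
proof (induction v)
  case 0
  show ?case by (simp add: binary.simps)
next
  case (Suc v)
  then show ?case by (subst binary.simps) simp
qed

lemma binary_mersenne: "binary (2 ^ m - 1) = replicate m True"
proof (induction m)
  case 0
  show ?case by (simp add: binary.simps)
next
  case (Suc m)
  obtain a :: nat where a: "2 ^ m = Suc a" using not0_implies_Suc[of "2 ^ m"] by auto
  show ?case using Suc by (subst binary.simps) (simp add: a)
qed

text \<open>Up to a constant suffix, each power and the budget is a fixed word repeated as often as
  the exponent says, which is what a loop can write.\<close>

lemma encode_nat_simps:
  "encode_nat 0 = [False]" "encode_nat 1 = [True, True, False]"
  "encode_nat (2 ^ v) = concat (replicate v [True, False]) @ [True, True, False]"
  "encode_nat (2 ^ m - 1) = concat (replicate m [True, True]) @ [False]"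
  using binary_power[of 0] binary_mersenne[of 0]
  by (simp_all add: encode_nat_def delimited_def binary_power binary_mersenne del: One_nat_def)

locale reduction = tableau +
  fixes N :: nat
  assumes N: "0 < N"
begin

definition "nvk = length (var_list M)"
definition "nck = length (clause_list M)"
definition "nv = (T + 1) * width * nvk"
definition "nc = (T + 1) * width * nck"

text \<open>Variables and clauses are numbered by the same scheme of time, column and kind. Words
  written in this order match the nested loops of the emitting program.\<close>

definition over :: "nat \<Rightarrow> (nat \<Rightarrow> nat \<Rightarrow> nat \<Rightarrow> 'b list) \<Rightarrow> 'b list" where
  "over c h = concat (map (\<lambda>t. concat (map (\<lambda>i. concat (map (h t i) [0..<c])) [0..<width])) [0..<T + 1])"

lemma concat_map_over: "concat (map f [0..<(T + 1) * width * c]) = over c (\<lambda>t i l. f ((t * width + i) * c + l))"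
  unfolding over_def concat_map_mult[of f "(T + 1) * width"] concat_map_mult[of _ "T + 1"] ..

lemma over_cong [cong]:
  "c = c' \<Longrightarrow> (\<And>t i l. t \<le> T \<Longrightarrow> i < width \<Longrightarrow> l < c' \<Longrightarrow> h t i l = h' t i l) \<Longrightarrow> over c h = over c' h'"
  unfolding over_def by (intro arg_cong[where f = concat] map_cong refl) auto

lemma map_over: "map f (over c h) = over c (\<lambda>t i l. map f (h t i l))"
  unfolding over_def map_concat by (simp add: o_def map_concat)

definition tmatch :: "time_spec \<Rightarrow> nat \<Rightarrow> nat \<Rightarrow> bool" where
  "tmatch ts t t' \<longleftrightarrow> t' = tval ts t"

definition imatch :: "col_spec \<Rightarrow> nat \<Rightarrow> nat \<Rightarrow> bool" where
  "imatch is i i' \<longleftrightarrow> (case is of Ctr \<Rightarrow> i' = ctr | Rel m \<Rightarrow> int i' = int i + offset m)"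

text \<open>Expressed by comparing \<open>t\<close> with \<open>t'\<close> and \<open>i\<close> with
  \<open>i'\<close> rather than by computing indices, since comparisons are what scanned symbols can
  decide.\<close>

definition contains :: "nat \<Rightarrow> nat \<Rightarrow> nat \<Rightarrow> nat \<Rightarrow> bool \<Rightarrow> nat \<Rightarrow> nat \<Rightarrow> bool" where
  "contains t i k l b t' i' \<longleftrightarrow> (\<exists>(b', v, ts, is) \<in> set (pats (clause_list M ! k) t i).
     b' = b \<and> v = var_list M ! l \<and> tmatch ts t t' \<and> imatch is i i')"

definition hit :: "nat \<Rightarrow> nat \<Rightarrow> bool \<Rightarrow> bool" where
  "hit c v b = contains (c div nck div width) (c div nck mod width) (c mod nck)
     (v mod nvk) b (v div nvk div width) (v div nvk mod width)"

abbreviation "inst \<equiv> gap_instance nv nc N hit"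

lemma index_div_mod:
  fixes i l c t :: nat
  assumes "i < width" "l < c"
  shows "((t * width + i) * c + l) mod c = l" "((t * width + i) * c + l) div c div width = t"
    "((t * width + i) * c + l) div c mod width = i"
  using assms by auto

lemma hit_index:
  assumes "i < width" "k < nck" "i' < width" "l < nvk"
  shows "hit ((t * width + i) * nck + k) ((t' * width + i') * nvk + l) b = contains t i k l b t' i'"
  unfolding hit_def using assms by (simp add: index_div_mod)

lemma index_less:
  fixes t i l c :: nat
  assumes "t \<le> T" "i < width" "l < c"
  shows "(t * width + i) * c + l < (T + 1) * width * c"
proof -
  have "t * width + i < (T + 1) * width" using assms
    by (metis Suc_eq_plus1 add.commute add_less_le_mono le_imp_less_Suc mult_Suc mult_le_mono1 Suc_leI le_refl)
  then have "(t * width + i + 1) * c \<le> (T + 1) * width * c" by (intro mult_le_mono1) simp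
  then show ?thesis using assms by (simp add: algebra_simps)
qed

lemma index_cases:
  fixes c :: nat
  assumes "v < (T + 1) * width * c"
  obtains t i l where "t \<le> T" "i < width" "l < c" "v = (t * width + i) * c + l"
proof
  have pos: "0 < c" "0 < width" using assms by (auto intro: gr0I)
  show "v mod c < c" "v div c mod width < width" using pos by auto
  have "v div c < (T + 1) * width" using assms by (simp add: less_mult_imp_div_less)
  from less_mult_imp_div_less[OF this] show "v div c div width \<le> T" by simp
qed simp

section \<open>Satisfying assignments and hit clauses\<close>

lemma satisfies_hit:
  assumes sat: "satisfies \<alpha>" and c: "c < nc"
  shows "\<exists>v<nv. hit c v (\<alpha> (var_list M ! (v mod nvk)) (v div nvk div width) (v div nvk mod width))"
proof -
  obtain t i k where c: "t \<le> T" "i < width" "k < nck" "c = (t * width + i) * nck + k"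
    using c unfolding nc_def by (rule index_cases)
  have k: "clause_list M ! k \<in> clause_kinds M"
    using c(3) clause_list[of M] nth_mem[of k "clause_list M"] by (simp add: nck_def)
  then obtain p0 where p0: "p0 \<in> set (pats (clause_list M ! k) t i)" "holds ctr \<alpha> t i p0"
    using sat c(1,2) unfolding satisfies_def by blast
  obtain b v ts "is" where "p0 = (b, v, ts, is)" by (cases p0)
  with p0 have p: "(b, v, ts, is) \<in> set (pats (clause_list M ! k) t i)"
    "holds ctr \<alpha> t i (b, v, ts, is)" by simp_all
  note r = patterns_range[OF k c(1,2) p(1)]
  obtain l where l: "l < nvk" "var_list M ! l = v" using r(1) by (auto simp: in_set_conv_nth nvk_def)
  have m: "imatch is i (ival ctr is i)" using r(4) by (cases "is") (auto simp: imatch_def)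
  let ?v = "(tval ts t * width + ival ctr is i) * nvk + l"
  have "hit c ?v b" unfolding c(4) hit_index[OF c(2,3) r(3) l(1)] contains_def
    using p(1) l m by (auto simp: tmatch_def)
  moreover have "?v < nv" unfolding nv_def using r(2,3) l(1) by (rule index_less)
  ultimately show ?thesis using p(2) l r(3) by (intro exI[of _ ?v]) (auto simp: index_div_mod)
qed

definition chosen :: "(nat \<times> nat) set \<Rightarrow> var_kind \<Rightarrow> nat \<Rightarrow> nat \<Rightarrow> bool" where
  "chosen E' v t i \<longleftrightarrow> (\<exists>l<nvk. var_list M ! l = v \<and> (0, 2 + 2 * ((t * width + i) * nvk + l)) \<in> E')"

lemma nvk_ge: "2 \<le> nvk" by (simp add: nvk_def var_list_def)

lemma chosen_VE: "chosen E' VE t i \<longleftrightarrow> (0, 2 + 2 * ((t * width + i) * nvk)) \<in> E'"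
  and chosen_VB: "chosen E' VB t i \<longleftrightarrow> (0, 2 + 2 * ((t * width + i) * nvk + 1)) \<in> E'"
proof -
  have "var_list M ! 0 = VE" "var_list M ! 1 = VB" by (auto simp: var_list_def)
  moreover have "l = l'" if "l < nvk" "l' < nvk" "var_list M ! l = var_list M ! l'" for l l'
    using var_list(2) that nth_eq_iff_index_eq unfolding nvk_def by blast
  ultimately show "chosen E' VE t i \<longleftrightarrow> (0, 2 + 2 * ((t * width + i) * nvk)) \<in> E'"
    "chosen E' VB t i \<longleftrightarrow> (0, 2 + 2 * ((t * width + i) * nvk + 1)) \<in> E'"
    unfolding chosen_def using nvk_ge
    by (metis add.right_neutral less_le_trans zero_less_numeral, metis less_le_trans one_less_numeral_iff semiring_norm(76))
qed

lemma hit_satisfies: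
  assumes "\<And>c. c < nc \<Longrightarrow> \<exists>v<nv. hit c v ((0, 2 + 2 * v) \<in> E')"
  shows "satisfies (chosen E')"
  unfolding satisfies_def
proof (intro ballI allI impI)
  fix \<kappa> t i assume \<kappa>: "\<kappa> \<in> clause_kinds M" and t: "t \<le> T" and i: "i < width"
  obtain k where k: "k < nck" "clause_list M ! k = \<kappa>"
    using \<kappa> by (auto simp: clause_list[symmetric] in_set_conv_nth nck_def)
  have "(t * width + i) * nck + k < nc" unfolding nc_def using t i k(1) by (rule index_less)
  then obtain v where v: "v < nv" "hit ((t * width + i) * nck + k) v ((0, 2 + 2 * v) \<in> E')"
    using assms by blast
  obtain t' i' l where v': "t' \<le> T" "i' < width" "l < nvk" "v = (t' * width + i') * nvk + l"
    using v(1) unfolding nv_def by (rule index_cases)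
  then have "contains t i k l ((0, 2 + 2 * v) \<in> E') t' i'"
    using v(2) hit_index[OF i k(1)] by simp
  then obtain ts "is" where p: "((0, 2 + 2 * v) \<in> E', var_list M ! l, ts, is) \<in> set (pats \<kappa> t i)"
    and m: "tmatch ts t t'" "imatch is i i'"
    unfolding contains_def k(2) by auto
  have "tval ts t = t'" "ival ctr is i = i'" using m by (auto simp: tmatch_def imatch_def split: col_spec.splits)
  moreover have "chosen E' (var_list M ! l) t' i' = ((0, 2 + 2 * v) \<in> E')"
  proof -
    have "l' = l" if "l' < nvk" "var_list M ! l' = var_list M ! l" for l'
      using var_list(2) that v'(3) nth_eq_iff_index_eq unfolding nvk_def by blast
    then show ?thesis unfolding chosen_def v'(4) using v'(3) by blast
  qed
  ultimately have "holds ctr (chosen E') t i ((0, 2 + 2 * v) \<in> E', var_list M ! l, ts, is)" by simp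
  then show "\<exists>p \<in> set (pats \<kappa> t i). holds ctr (chosen E') t i p" using p by blast
qed

text \<open>The \<open>KPair\<close> clause at the time and column of \<open>v\<close> mentions no
  other variable. This supplies the premise \<open>pairs\<close> of \<open>gap\<close>.\<close>

lemma hit_pair:
  assumes "v < nv"
  shows "\<exists>c<nc. \<forall>v' b. v' < nv \<longrightarrow> hit c v' b \<longrightarrow> v' = v"
proof -
  obtain t i l where v: "t \<le> T" "i < width" "l < nvk" "v = (t * width + i) * nvk + l"
    using assms unfolding nv_def by (rule index_cases)
  have "var_list M ! l \<in> set (var_list M)" using v(3) by (simp add: nvk_def)
  then have "KPair (var_list M ! l) \<in> set (clause_list M)" by (auto simp: clause_list clause_kinds_def)
  then obtain k where k: "k < nck" "clause_list M ! k = KPair (var_list M ! l)"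
    by (auto simp: in_set_conv_nth nck_def)
  let ?c = "(t * width + i) * nck + k"
  have "v' = v" if v': "v' < nv" "hit ?c v' b" for v' b
  proof -
    obtain t' i' l' where w: "t' \<le> T" "i' < width" "l' < nvk" "v' = (t' * width + i') * nvk + l'"
      using v'(1) unfolding nv_def by (rule index_cases)
    have "contains t i k l' b t' i'" using v'(2) hit_index[OF v(2) k(1) w(2,3)] w(4) by simp
    then have "var_list M ! l' = var_list M ! l" "t' = t" "i' = i"
      by (auto simp: contains_def clause_patterns_def k(2) tmatch_def imatch_def)
    then show ?thesis using var_list(2) v w nth_eq_iff_index_eq unfolding nvk_def by blast
  qed
  moreover have "?c < nc" unfolding nc_def using v(1,2) k(1) by (rule index_less)
  ultimately show ?thesis by blast
qed

lemma reduction_gap: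
  assumes y: "length y \<le> g"
    and acc: "halts_with_output M ((tm_step M ^^ t0) (initial_config M (encode_pair x y))) [True]"
    and E': "feasible inst E'" "solution_cost inst E' \<le> ereal r * optimal_cost inst"
    and r: "0 \<le> r" "r * real ((2 + 2 * nv + nc * N) * (nv + 1)) < real (N * N * nc)"
  shows "satisfies (chosen E')"
proof (rule hit_satisfies)
  fix c assume "c < nc"
  with hit_pair satisfies_hit[OF tableau_complete[OF y acc]] E' r
  show "\<exists>v<nv. hit c v ((0, 2 + 2 * v) \<in> E')" by (rule gap)
qed

section \<open>The encoded instance as nested loops\<close>

abbreviation (input) "free_arc \<equiv> [True, False, False]"

definition copies :: "'b list \<Rightarrow> 'b list" where
  "copies w = concat (replicate N w)"

definition no_arcs :: "bool list" where
  "no_arcs = over nvk (\<lambda>t i l. [False, False]) @ over nck (\<lambda>t i k. copies [False])"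

text \<open>The order in unary, the matrix rows of the root, the relay, the two literals of each
  variable and the clause copies, and the budget. \<open>free_arc\<close> is an arc of weight and
  length 0; the word \<open>[False, True, False, True, True, False]\<close> is the absent loop at
  the root followed by the arc to the relay, of weight 0 and length 1.\<close>

definition instance_bits :: "bool list" where
  "instance_bits =
     [True, True] @ over nvk (\<lambda>t i l. [True, True]) @ over nck (\<lambda>t i k. copies [True]) @ [False] @
     [False, True, False, True, True, False] @
     over nvk (\<lambda>t i l. concat (replicate 2
       (True # concat (replicate ((t * width + i) * nvk + l) [True, False]) @ [True, True, False, False]))) @
     over nck (\<lambda>t i k. copies [False]) @
     free_arc @ [False] @ over nvk (\<lambda>t i l. free_arc @ free_arc) @ over nck (\<lambda>t i k. copies [False]) @
     over nvk (\<lambda>t' i' l. concat (map (\<lambda>b. free_arc @ [False] @ over nvk (\<lambda>t i l. [False, False]) @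
       over nck (\<lambda>t i k. copies (if contains t i k l b t' i' then free_arc else [False]))) [True, False])) @
     over nck (\<lambda>t i k. copies (free_arc @ [False] @ no_arcs)) @
     over nvk (\<lambda>t i l. [True, True]) @ [False]"

lemma encode_inst: "encode_instance inst = instance_bits"
proof -
  define sz where "sz = 2 + 2 * nv + nc * N"
  define A where "A = gap_arcs nv nc N hit"
  define entry where "entry = (\<lambda>e. if e \<in> A
     then True # encode_nat (inst_weight inst e) @ encode_nat (inst_dist inst e) else [False])"
  \<comment> \<open>\<open>V\<close> numbers the variables and \<open>D\<close> the clause copies;
    \<open>P\<close>, \<open>Q\<close> and \<open>R\<close> turn such numbers into the vertices of
    positive literals, negative literals and clause copies.\<close>
  define V where "V t i l = (t * width + i) * nvk + l" for t i l
  define D where "D t i k j = ((t * width + i) * nck + k) * N + j" for t i k j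
  define P where "P v = 2 + 2 * v" for v :: nat
  define Q where "Q v = 3 + 2 * v" for v :: nat
  define R where "R l = 2 + 2 * nv + l" for l
  have V: "V t i l < nv" if "t \<le> T" "i < width" "l < nvk" for t i l
    unfolding V_def nv_def using that by (rule index_less)
  have D: "D t i k j < nc * N" "D t i k j div N = (t * width + i) * nck + k"
    if "t \<le> T" "i < width" "k < nck" "j < N" for t i k j
  proof -
    have "(t * width + i) * nck + k + 1 \<le> nc" unfolding nc_def using index_less[OF that(1-3)] by simp
    then have "((t * width + i) * nck + k + 1) * N \<le> nc * N" by (rule mult_le_mono1)
    then show "D t i k j < nc * N" unfolding D_def using that(4) by (simp add: algebra_simps)
    show "D t i k j div N = (t * width + i) * nck + k" unfolding D_def using that(4) by simp
  qed
  have all: "concat (map f [0..<sz]) = f 0 @ f (Suc 0) @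
      over nvk (\<lambda>t i l. f (P (V t i l)) @ f (Q (V t i l))) @
      over nck (\<lambda>t i k. concat (map (\<lambda>j. f (R (D t i k j))) [0..<N]))"
    for f :: "nat \<Rightarrow> bool list"
  proof -
    have "concat (map (\<lambda>k. f (2 + k)) [0..<2 * nv]) = over nvk (\<lambda>t i l. f (P (V t i l)) @ f (Q (V t i l)))"
      unfolding concat_map_double nv_def concat_map_over V_def P_def Q_def by (simp add: numeral_3_eq_3)
    moreover have "concat (map (\<lambda>k. f (2 + 2 * nv + k)) [0..<nc * N]) =
      over nck (\<lambda>t i k. concat (map (\<lambda>j. f (R (D t i k j))) [0..<N]))"
      unfolding concat_map_mult[of _ nc N] unfolding nc_def concat_map_over R_def D_def ..
    ultimately show ?thesis unfolding sz_def concat_map_split by simp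
  qed
  have e0: "entry (0, 0) = [False]" "entry (0, Suc 0) = [True, False, True, True, False]"
    "entry (Suc 0, 0) = free_arc" "entry (Suc 0, Suc 0) = [False]"
    using encode_nat_simps(2) by (auto simp: entry_def A_def gap_arcs_def gap_instance_def encode_nat_simps)
  have eL: "entry (0, P v) = True # concat (replicate v [True, False]) @ [True, True, False, False]"
     "entry (0, Q v) = True # concat (replicate v [True, False]) @ [True, True, False, False]"
     "entry (Suc 0, P v) = free_arc" "entry (Suc 0, Q v) = free_arc"
     "entry (P v, 0) = free_arc" "entry (Q v, 0) = free_arc"
     "entry (P v, Suc 0) = [False]" "entry (Q v, Suc 0) = [False]" if "v < nv" for v
    using that by (auto simp: entry_def A_def gap_arcs_def gap_instance_def encode_nat_simps image_iff Bex_def P_def Q_def)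
  have eLL: "entry (P u, P v) = [False]" "entry (P u, Q v) = [False]" "entry (Q u, P v) = [False]"
     "entry (Q u, Q v) = [False]" "entry (R w, P v) = [False]" "entry (R w, Q v) = [False]"
     if "v < nv" for u v w
    using that by (auto simp: entry_def A_def gap_arcs_def P_def Q_def R_def)
  have eR: "entry (0, R l) = [False]" "entry (Suc 0, R l) = [False]"
     "entry (R l, 0) = free_arc" "entry (R l, Suc 0) = [False]" "entry (R l', R l) = [False]" if "l < nc * N" for l l'
    using that by (auto simp: entry_def A_def gap_arcs_def gap_instance_def encode_nat_simps image_iff Bex_def R_def)
  have eLR: "entry (P v, R l) = (if hit (l div N) v True then free_arc else [False])"
     "entry (Q v, R l) = (if hit (l div N) v False then free_arc else [False])" if "v < nv" "l < nc * N" for v l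
  proof -
    have "(P v, R l) \<in> A \<longleftrightarrow> hit (l div N) v True"
      using that by (auto simp: A_def gap_arcs_def P_def R_def)
    moreover have "(Q v, R l) \<in> A \<longleftrightarrow> hit (l div N) v False"
    proof
      assume "hit (l div N) v False"
      then have "(2 + (2 * v + 1), 2 + 2 * nv + l) \<in> A"
        using that unfolding A_def gap_arcs_def by (intro UnI2 CollectI exI conjI) auto
      then show "(Q v, R l) \<in> A" by (simp add: Q_def R_def numeral_3_eq_3)
    qed (use that in \<open>auto simp: A_def gap_arcs_def Q_def R_def\<close>)
    ultimately show "entry (P v, R l) = (if hit (l div N) v True then free_arc else [False])"
     "entry (Q v, R l) = (if hit (l div N) v False then free_arc else [False])"
      by (auto simp: entry_def gap_instance_def encode_nat_simps P_def Q_def)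
  qed
  define row where "row i = concat (map (\<lambda>j. entry (i, j)) [0..<sz])" for i
  have copies: "concat (map (\<lambda>j. w) [0..<N]) = copies w" for w :: "bool list"
    by (simp add: copies_def concat_map_const)
  have cols: "over nck (\<lambda>t i k. concat (map (\<lambda>j. f (R (D t i k j))) [0..<N])) = over nck (\<lambda>t i k. copies (h t i k))"
    if "\<And>t i k j. t \<le> T \<Longrightarrow> i < width \<Longrightarrow> k < nck \<Longrightarrow> j < N \<Longrightarrow> f (R (D t i k j)) = h t i k"
    for f :: "nat \<Rightarrow> bool list" and h
    unfolding copies[symmetric]
    by (intro over_cong refl arg_cong[where f = concat] map_cong) (auto simp: that)
  have row0: "row 0 = [False, True, False, True, True, False] @
     over nvk (\<lambda>t i l. concat (replicate 2
       (True # concat (replicate (V t i l) [True, False]) @ [True, True, False, False]))) @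
     over nck (\<lambda>t i k. copies [False])"
    unfolding row_def all by (subst cols[of _ "\<lambda>_ _ _. [False]"]) (auto simp: e0 eL eR V D numeral_2_eq_2)
  have row1: "row (Suc 0) = free_arc @ [False] @ over nvk (\<lambda>t i l. free_arc @ free_arc) @ over nck (\<lambda>t i k. copies [False])"
    unfolding row_def all by (subst cols[of _ "\<lambda>_ _ _. [False]"]) (auto simp: e0 eL eR V D)
  have rowL: "row (if b then P (V t' i' l) else Q (V t' i' l)) =
      free_arc @ [False] @ over nvk (\<lambda>t i l. [False, False]) @
       over nck (\<lambda>t i k. copies (if contains t i k l b t' i' then free_arc else [False]))"
    if "t' \<le> T" "i' < width" "l < nvk" for t' i' l b
    unfolding row_def all
  proof (subst cols[of _ "\<lambda>t i k. if contains t i k l b t' i' then free_arc else [False]"], goal_cases)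
    case (1 t i k j)
    then have "hit (D t i k j div N) (V t' i' l) b = contains t i k l b t' i'"
      using hit_index[OF _ _ that(2,3)] D(2) by (simp add: V_def)
    then show ?case using 1 that by (cases b) (auto simp: eLR V D)
  next
    case 2
    show ?case using that by (auto simp: eL eLL V)
  qed
  have rowR: "row (R l) = free_arc @ [False] @ no_arcs" if "l < nc * N" for l
    unfolding row_def all no_arcs_def
    by (subst cols[of _ "\<lambda>_ _ _. [False]"]) (use that in \<open>auto simp: eR eLL V D\<close>)
  have rows: "concat (map row [0..<sz]) = row 0 @ row (Suc 0) @
     over nvk (\<lambda>t' i' l. concat (map (\<lambda>b. free_arc @ [False] @ over nvk (\<lambda>t i l. [False, False]) @
       over nck (\<lambda>t i k. copies (if contains t i k l b t' i' then free_arc else [False]))) [True, False])) @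
     over nck (\<lambda>t i k. copies (free_arc @ [False] @ no_arcs))"
    unfolding all
  proof (subst cols[of _ "\<lambda>_ _ _. free_arc @ [False] @ no_arcs"], goal_cases)
    case 1
    then show ?case by (intro rowR D)
  next
    case 2
    show ?case using rowL[of _ _ _ True] rowL[of _ _ _ False] by (intro arg_cong2[where f = append] over_cong refl) auto
  qed
  have unary: "replicate sz True = [True, True] @ over nvk (\<lambda>t i l. [True, True]) @ over nck (\<lambda>t i k. copies [True])"
    using all[of "\<lambda>_. [True]"] unfolding copies by (simp add: map_replicate_const)
  have budget: "encode_nat (2 ^ nv - 1) = over nvk (\<lambda>t i l. [True, True]) @ [False]"
    using concat_map_over[of "\<lambda>_. [True, True]" nvk]
    unfolding encode_nat_simps concat_map_const nv_def by simp
  have "encode_instance inst = replicate sz True @ [False] @ concat (map row [0..<sz]) @ encode_nat (2 ^ nv - 1)"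
  proof -
    have "card (pverts (inst_graph inst)) = sz" "parcs (inst_graph inst) = A" "inst_budget inst = 2 ^ nv - 1"
      by (auto simp: gap_instance_def sz_def A_def)
    then show ?thesis
      unfolding encode_instance_def Let_def concat_map_product row_def[abs_def] entry_def by simp
  qed
  then show ?thesis unfolding rows row0 row1 V_def unary budget instance_bits_def by simp
qed

end

section \<open>Emitting the instance\<close>

lemma shift_stay [simp]: "D j = Stay \<Longrightarrow> shift D z s j = s j"
  by (simp add: shift_def)

lemma emits_seqs_list:
  assumes "1 \<le> B" "list_all2 (\<lambda>c w. emits K B out c s w) cs ws"
  shows "emits K B out (seqs cs) s (concat ws)"
  using assms(2) unfolding seqs_def
  by (induction rule: list_all2_induct) (use assms(1) in \<open>auto simp: emits_noop intro!: emits_Seq\<close>)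

text \<open>
  Tapes: 0 carries the input, 1 and 3 control the outer loops over times and columns, and 2 and 4
  the inner loops. The single non-blank or distinguished cells of 5, 6, and 9 mark the column
  \<open>ctr\<close> (for the outer and inner loop) and the time 0 (for the outer loop). The heads of 7 and 8
  follow the inner loops forwards and the outer loops backwards, so that the scanned symbol
  compares the two times or columns. 10 and 11 hold \<open>N\<close> in unary.
\<close>

definition outer_time :: "nat \<Rightarrow> head_move" where
  "outer_time j = (if j = 1 \<or> j = 9 then Move_Right else if j = 7 then Move_Left else Stay)"

definition outer_col :: "nat \<Rightarrow> head_move" where
  "outer_col j = (if j = 3 \<or> j = 5 then Move_Right else if j = 8 then Move_Left else Stay)"

definition inner_time :: "nat \<Rightarrow> head_move" where
  "inner_time j = (if j = 2 \<or> j = 7 then Move_Right else Stay)"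

definition inner_col :: "nat \<Rightarrow> head_move" where
  "inner_col j = (if j = 4 \<or> j = 6 \<or> j = 8 then Move_Right else Stay)"

definition outer :: "nat \<Rightarrow> (nat \<Rightarrow> com) \<Rightarrow> com" where
  "outer n c = For 1 outer_time (For 3 outer_col (seqs (map c [0..<n])))"

definition inner :: "nat \<Rightarrow> (nat \<Rightarrow> com) \<Rightarrow> com" where
  "inner n c = For 2 inner_time (For 4 inner_col (seqs (map c [0..<n])))"

lemma nst_inner [simp]: "0 < nst (inner n c)" "0 < nst (outer n c)"
  by (simp_all add: inner_def outer_def)

lemma wf_inner [simp]: "wf_com K S (inner n c) \<longleftrightarrow> (\<forall>l<n. wf_com K S (c l))"
  "wf_com K S (outer n c) \<longleftrightarrow> (\<forall>l<n. wf_com K S (c l))"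
  by (auto simp: inner_def outer_def)

text \<open>The symbols come from words \<open>3, 2, 4, 5, ...\<close> whose head is on the 2 when
  the two times, or columns, agree. To the left lie 3 (smaller by one) and then blanks, so 0 or 3
  means that the inner value is smaller.\<close>

definition compare_less :: "nat \<Rightarrow> nat \<Rightarrow> nat list \<Rightarrow> bool" where
  "compare_less l l' ss \<longleftrightarrow> ss ! 0 \<in> {0, 3} \<or>
     ss ! 0 = 2 \<and> (ss ! 1 \<in> {0, 3} \<or> ss ! 1 = 2 \<and> l' < l)"

text \<open>In order, the symbols reveal whether the clause is at time \<open>T\<close>, its column
  code, whether its column and then that of the variable is \<open>ctr\<close>, how the times and
  the columns compare, and whether the variable is at time 0. A 3 says that the variable is one
  ahead of the clause, a 4 that it is one behind.\<close>

definition test_contains :: "turing_machine \<Rightarrow> nat \<Rightarrow> nat \<Rightarrow> bool \<Rightarrow> nat list \<Rightarrow> bool" where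
  "test_contains M k l b ss \<longleftrightarrow>
     (\<exists>(b', v, ts, is) \<in> set (clause_patterns M (clause_list M ! k) (ss ! 1) (ss ! 2 = 2) (ss ! 0 = 2)).
        b' = b \<and> v = var_list M ! l \<and>
        (case ts of T0 \<Rightarrow> ss ! 6 = 2 | Tcur \<Rightarrow> ss ! 4 = 2 | Tnext \<Rightarrow> ss ! 4 = 3) \<and>
        (case is of Ctr \<Rightarrow> ss ! 3 = 2 | Rel Stay \<Rightarrow> ss ! 5 = 2 | Rel Move_Right \<Rightarrow> ss ! 5 = 3
          | Rel Move_Left \<Rightarrow> ss ! 5 = 4))"

definition emit_bits :: "nat \<Rightarrow> bool list \<Rightarrow> com" where
  "emit_bits out bs = emit out (map bit_symbol bs)"

lemma nst_emit_bits [simp]: "0 < nst (emit_bits out w)"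
  by (simp add: emit_bits_def)

lemma wf_emit_bits [simp]: "3 \<le> S \<Longrightarrow> wf_com K S (emit_bits out w)"
  unfolding emit_bits_def by (rule wf_emit) (auto simp: bit_symbol_def)

definition emit_copies :: "nat \<Rightarrow> bool list \<Rightarrow> com" where
  "emit_copies out bs = For 10 (only 10) (emit_bits out bs)"

lemma emit_copies [simp]: "0 < nst (emit_copies out bs)" "3 \<le> S \<Longrightarrow> wf_com K S (emit_copies out bs)"
  by (simp_all add: emit_copies_def)

text \<open>The row of a clause copy has entries for all clause copies, so two loops over
  \<open>N\<close> are nested; hence two unary tapes, 10 and 11. In the rows of literals the outer
  loops fix the variable and the inner loops run over the entries.\<close>

definition emit_instance :: "turing_machine \<Rightarrow> nat \<Rightarrow> com" where
  "emit_instance M out =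
     (let nvk = length (var_list M); nck = length (clause_list M) in
      seqs [emit_bits out [True, True],
        inner nvk (\<lambda>_. emit_bits out [True, True]), inner nck (\<lambda>_. emit_copies out [True]),
        emit_bits out [False],
        emit_bits out [False, True, False, True, True, False],
        outer nvk (\<lambda>l. seqs (map (\<lambda>_. seqs [emit_bits out [True],
            inner nvk (\<lambda>l'. If [7, 8] (compare_less l l') (emit_bits out [True, False]) noop),
            emit_bits out [True, True, False, False]]) [0..<2])),
        inner nck (\<lambda>_. emit_copies out [False]),
        emit_bits out [True, False, False, False],
        inner nvk (\<lambda>_. emit_bits out [True, False, False, True, False, False]),
        inner nck (\<lambda>_. emit_copies out [False]),
        outer nvk (\<lambda>l. seqs (map (\<lambda>b. seqs [emit_bits out [True, False, False, False],
            inner nvk (\<lambda>_. emit_bits out [False, False]),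
            inner nck (\<lambda>k. If [2, 4, 6, 5, 7, 8, 9] (test_contains M k l b)
              (emit_copies out [True, False, False]) (emit_copies out [False]))]) [True, False])),
        outer nck (\<lambda>_. For 11 (only 11) (seqs [emit_bits out [True, False, False, False],
            inner nvk (\<lambda>_. emit_bits out [False, False]), inner nck (\<lambda>_. emit_copies out [False])])),
        inner nvk (\<lambda>_. emit_bits out [True, True]), emit_bits out [False]])"

lemma wf_emit_instance: "3 \<le> S \<Longrightarrow> wf_com K S (emit_instance M out)"
  by (simp add: emit_instance_def Let_def)

lemma cells_compare:
  "cells ([3, 2, 4] @ replicate n 5) z =
     (if z = 0 then 3 else if z = 1 then 2 else if z = 2 then 4 else if 2 < z \<and> z < int n + 3 then 5 else 0)"
proof -
  consider "z < 0" | "z = 0" | "z = 1" | "z = 2" | "2 < z" by linarith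
  then show ?thesis by cases (auto simp: cells_def nth_append nth_Cons' nat_eq_iff numeral_2_eq_2 numeral_3_eq_3)
qed

lemma concat_map_less:
  assumes "v \<le> n"
  shows "concat (map (\<lambda>u. if u < v then w else []) [0..<n]) = concat (replicate v w)"
proof -
  have "[0..<n] = [0..<v] @ [v..<n]" using assms by (metis le_add_diff_inverse upt_add_eq_append zero_le)
  moreover have "map (\<lambda>u. if u < v then w else []) [0..<v] = map (\<lambda>u. w) [0..<v]" by simp
  moreover have "concat (map (\<lambda>u. if u < v then w else []) [v..<n]) = []" by simp
  ultimately show ?thesis by (simp add: map_replicate_const)
qed

context reduction
begin

definition "center_word = replicate ctr 1 @ [2 :: nat]"
definition "time_word = replicate T 1 @ [2 :: nat]"

text \<open>The outer loops stand at time \<open>t'\<close> and column \<open>i'\<close>, the inner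
  ones at their start. Heads 7 and 8 begin on the symbol 2 in cell 1 and move back with the outer
  loops, so an inner loop at time \<open>t\<close> scans cell \<open>1 + t - t'\<close> of tape 7,
  and likewise for columns on tape 8.\<close>

definition ready :: "(nat \<Rightarrow> tape) \<Rightarrow> nat \<Rightarrow> nat \<Rightarrow> bool" where
  "ready s t' i' \<longleftrightarrow> s 2 = rt time_word \<and> s 4 = rt (columns T g x) \<and> s 5 = (cells center_word, int i') \<and>
     s 6 = rt center_word \<and> s 7 = (cells ([3, 2, 4] @ replicate (T + 1) 5), 1 - int t') \<and>
     s 8 = (cells ([3, 2, 4] @ replicate width 5), 1 - int i') \<and> s 9 = (cells [2], int t') \<and>
     s 10 = rt (replicate N 1)"

lemma word_lengths:
  "is_word (T + 1) (rt time_word)" "is_word width (rt (columns T g x))"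
  "is_word N (rt (replicate N 1))" "is_word (T + 1) (rt (replicate (T + 1) 1))"
  by (auto simp: time_word_def columns_def width_def length_delimited intro!: is_word_rt)

context
  fixes K B out :: nat
  assumes out: "11 < out" "out < K" and B: "T + 1 \<le> B" "width \<le> B" "N \<le> B"
begin

lemma B1: "1 \<le> B" using B by simp

lemma emits_inner:
  assumes s: "ready s t' i'"
    and c: "\<And>t i l. t \<le> T \<Longrightarrow> i < width \<Longrightarrow> l < n \<Longrightarrow>
      emits K B out (c l) (shift inner_col (int i) (shift inner_time (int t) s)) (h t i l)"
  shows "emits K B out (inner n c) s (over n h)"
  unfolding inner_def over_def
proof (intro emits_For emits_seqs)
  show "is_word (T + 1) (s 2)" using s word_lengths by (simp add: ready_def)
  show "is_word width (shift inner_time (int t) s 4)" for t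
    using s word_lengths by (simp add: ready_def inner_time_def)
  show "emits K B out (c l) (shift inner_col (int i) (shift inner_time (int t) s)) (h t i l)"
    if "t < T + 1" "i < width" "l \<in> set [0..<n]" for t i l
    using that by (intro c) auto
qed (use out B in \<open>auto simp: inner_time_def inner_col_def\<close>)

lemma emits_outer:
  assumes s: "ready s 0 0" "s 1 = rt (replicate (T + 1) 1)" "s 3 = rt (columns T g x)"
    and c: "\<And>t i l s'. t \<le> T \<Longrightarrow> i < width \<Longrightarrow> l < n \<Longrightarrow> ready s' t i \<Longrightarrow> s' 11 = s 11 \<Longrightarrow>
      emits K B out (c l) s' (h t i l)"
  shows "emits K B out (outer n c) s (over n h)"
  unfolding outer_def over_def
proof (intro emits_For emits_seqs)
  show "is_word (T + 1) (s 1)" using s word_lengths by simp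
  show "is_word width (shift outer_time (int t) s 3)" for t
    using s word_lengths by (simp add: outer_time_def)
  show "emits K B out (c l) (shift outer_col (int i) (shift outer_time (int t) s)) (h t i l)"
    if "t < T + 1" "i < width" "l \<in> set [0..<n]" for t i l
  proof (rule c)
    show "ready (shift outer_col (int i) (shift outer_time (int t) s)) t i"
      using s(1) by (simp add: ready_def shift_def outer_time_def outer_col_def rt_def)
    show "shift outer_col (int i) (shift outer_time (int t) s) 11 = s 11"
      by (simp add: outer_time_def outer_col_def)
  qed (use that in auto)
qed (use out B in \<open>auto simp: outer_time_def outer_col_def\<close>)

lemma emits_bits: "emits K B out (emit_bits out bs) s (map bit_symbol bs)"
  unfolding emit_bits_def using B1 by (rule emits_emit)

lemma emits_repeat:
  assumes "s k = rt (replicate N 1)" "k < out" "\<And>j. emits K B out c (shift (only k) (int j) s) w"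
  shows "emits K B out (For k (only k) c) s (copies w)"
  unfolding copies_def concat_map_const[symmetric]
  by (rule emits_For) (use assms out B word_lengths(3) B1 in \<open>auto simp: only_def\<close>)

lemma emits_copies:
  assumes "s 10 = rt (replicate N 1)"
  shows "emits K B out (emit_copies out bs) s (copies (map bit_symbol bs))"
  unfolding emit_copies_def by (rule emits_repeat) (use assms out emits_bits in auto)

lemma ready_inner:
  assumes "ready s t' i'" "t \<le> T" "i < width"
  defines "s' \<equiv> shift inner_col (int i) (shift inner_time (int t) s)"
  shows "s' 10 = rt (replicate N 1)"
    and "scanned (s' 2) = (if t = T then 2 else 1)" and "scanned (s' 4) = columns T g x ! i"
    and "scanned (s' 5) = 2 \<longleftrightarrow> i' = ctr" and "scanned (s' 6) = 2 \<longleftrightarrow> i = ctr"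
    and "scanned (s' 7) = cells ([3, 2, 4] @ replicate (T + 1) 5) (1 + int t - int t')"
    and "scanned (s' 8) = cells ([3, 2, 4] @ replicate width 5) (1 + int i - int i')"
    and "scanned (s' 9) = 2 \<longleftrightarrow> t' = 0"
  using assms(1-3) length_columns unfolding s'_def
  by (auto simp: ready_def scanned_def shift_def inner_col_def inner_time_def rt_def
      cells_def time_word_def center_word_def nth_append nth_Cons' algebra_simps)

text \<open>The exponent of a weight is the number of its variable, but it is never computed: a loop
  over all variables writes one zero bit, preceded by its delimiter bit, for each lexicographically
  smaller triple of time, column and kind.\<close>

lemma emits_power:
  assumes s: "ready s t' i'" and i': "t' \<le> T" "i' < width" "l < nvk"
  shows "emits K B out (inner nvk (\<lambda>l'. If [7, 8] (compare_less l l') (emit_bits out [True, False]) noop)) s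
    (concat (replicate ((t' * width + i') * nvk + l) (map bit_symbol [True, False])))"
proof -
  let ?v = "(t' * width + i') * nvk + l"
  let ?w = "map bit_symbol [True, False]"
  have less: "t < t' \<or> t = t' \<and> (i < i' \<or> i = i' \<and> l' < l) \<longleftrightarrow> (t * width + i) * nvk + l' < ?v"
    if "i < width" "l' < nvk" for t i l'
  proof -
    have lex: "a * c + p < b * c + q \<longleftrightarrow> a < b \<or> a = b \<and> p < q" if "p < c" "q < c" for a b c p q :: nat
    proof (cases a b rule: linorder_cases)
      case less
      then have "Suc a * c \<le> b * c" by (intro mult_le_mono1) simp
      then show ?thesis using that less by simp
    next
      case greater
      then have "Suc b * c \<le> a * c" by (intro mult_le_mono1) simp
      then show ?thesis using that greater by simp
    qed simp
    have eq: "a * c + p = b * c + q \<longleftrightarrow> a = b \<and> p = q" if "p < c" "q < c" for a b c p q :: nat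
      using lex[OF that, of a b] lex[OF that(2,1), of b a] by (metis linorder_neq_iff)
    show ?thesis using that i' by (auto simp: lex eq)
  qed
  have "emits K B out (inner nvk (\<lambda>l'. If [7, 8] (compare_less l l') (emit_bits out [True, False]) noop)) s
    (over nvk (\<lambda>t i l'. if (t * width + i) * nvk + l' < ?v then ?w else []))"
  proof (rule emits_inner[OF s])
    fix t i l' assume t: "t \<le> T" "i < width" "l' < nvk"
    let ?s = "shift inner_col (int i) (shift inner_time (int t) s)"
    have "compare_less l l' (map (\<lambda>j. scanned (?s j)) [7, 8]) \<longleftrightarrow> (t * width + i) * nvk + l' < ?v"
      unfolding less[OF t(2,3), symmetric] using t i' ready_inner(6,7)[OF s t(1,2), unfolded cells_compare]
      by (auto simp: compare_less_def)
    then show "emits K B out (If [7, 8] (compare_less l l') (emit_bits out [True, False]) noop) ?s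
       (if (t * width + i) * nvk + l' < ?v then ?w else [])"
      using out emits_bits[of "[True, False]" ?s] emits_noop[OF B1] by (intro emits_If) auto
  qed
  also have "over nvk (\<lambda>t i l'. if (t * width + i) * nvk + l' < ?v then ?w else []) = concat (replicate ?v ?w)"
    unfolding concat_map_over[of "\<lambda>u. if u < ?v then ?w else []" nvk, symmetric] using index_less[OF i'] by (intro concat_map_less) simp
  finally show ?thesis .
qed

lemma emits_contains:
  assumes s: "ready s t' i'" and i: "t \<le> T" "i < width" "k < nck" "t' \<le> T" "i' < width"
  defines "s' \<equiv> shift inner_col (int i) (shift inner_time (int t) s)"
  shows "emits K B out (If [2, 4, 6, 5, 7, 8, 9] (test_contains M k l b)
        (emit_copies out [True, False, False]) (emit_copies out [False])) s'
     (copies (map bit_symbol (if contains t i k l b t' i' then [True, False, False] else [False])))"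
proof -
  note r = ready_inner[OF s i(1,2), folded s'_def, unfolded cells_compare]
  define ss where "ss = map (\<lambda>j. scanned (s' j)) [2, 4, 6, 5, 7, 8, 9]"
  then have ss: "ss ! 0 = scanned (s' 2)" "ss ! 1 = scanned (s' 4)" "ss ! 2 = scanned (s' 6)"
    "ss ! 3 = scanned (s' 5)" "ss ! 4 = scanned (s' 7)" "ss ! 5 = scanned (s' 8)" "ss ! 6 = scanned (s' 9)"
    by simp_all
  have times: "(case ts of T0 \<Rightarrow> ss ! 6 = 2 | Tcur \<Rightarrow> ss ! 4 = 2 | Tnext \<Rightarrow> ss ! 4 = 3) \<longleftrightarrow> tmatch ts t t'" for ts
    using i r(6,8) ss by (cases ts) (auto simp: tmatch_def)
  have cols: "(case is of Ctr \<Rightarrow> ss ! 3 = 2 | Rel Stay \<Rightarrow> ss ! 5 = 2 | Rel Move_Right \<Rightarrow> ss ! 5 = 3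
      | Rel Move_Left \<Rightarrow> ss ! 5 = 4) \<longleftrightarrow> imatch is i i'" for "is"
    using i r(4,7) ss by (auto simp: imatch_def split: col_spec.splits head_move.splits)
  have "ss ! 0 = 2 \<longleftrightarrow> t = T" "ss ! 1 = columns T g x ! i" "ss ! 2 = 2 \<longleftrightarrow> i = ctr"
    using r(2,3,5) ss by simp_all
  then have "test_contains M k l b ss \<longleftrightarrow> contains t i k l b t' i'"
    unfolding test_contains_def contains_def times cols by simp
  then have "test_contains M k l b (map (\<lambda>j. scanned (s' j)) [2, 4, 6, 5, 7, 8, 9]) \<longleftrightarrow>
      contains t i k l b t' i'" unfolding ss_def .
  then show ?thesis using out emits_copies[of s' "[True, False, False]"] emits_copies[of s' "[False]"] r(1)
    by (intro emits_If) auto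
qed

lemma emits_instance:
  assumes s: "ready s 0 0" "s 1 = rt (replicate (T + 1) 1)" "s 3 = rt (columns T g x)"
    "s 11 = rt (replicate N 1)"
  shows "emits K B out (emit_instance M out) s (map bit_symbol instance_bits)"
proof -
  let ?b = "map bit_symbol"
  have const: "emits K B out (inner n (\<lambda>_. emit_bits out bs)) s' (over n (\<lambda>t i l. ?b bs))"
    "emits K B out (inner n (\<lambda>_. emit_copies out bs)) s' (over n (\<lambda>t i l. copies (?b bs)))"
    if "ready s' t' i'" for s' t' i' n bs
    using ready_inner(1)[OF that]
    by (auto intro!: emits_inner[OF that] emits_bits emits_copies)
  let ?w = "[?b [True, True], over nvk (\<lambda>t i l. ?b [True, True]), over nck (\<lambda>t i k. copies (?b [True])), ?b [False],
     ?b [False, True, False, True, True, False],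
     over nvk (\<lambda>t i l. concat (map (\<lambda>_. concat [?b [True], concat (replicate ((t * width + i) * nvk + l) (?b [True, False])),
       ?b [True, True, False, False]]) [0..<2])),
     over nck (\<lambda>t i k. copies (?b [False])), ?b [True, False, False, False],
     over nvk (\<lambda>t i l. ?b [True, False, False, True, False, False]), over nck (\<lambda>t i k. copies (?b [False])),
     over nvk (\<lambda>t' i' l. concat (map (\<lambda>b. concat [?b [True, False, False, False], over nvk (\<lambda>t i l. ?b [False, False]),
       over nck (\<lambda>t i k. copies (?b (if contains t i k l b t' i' then [True, False, False] else [False])))]) [True, False])),
     over nck (\<lambda>t i k. copies (concat [?b [True, False, False, False], over nvk (\<lambda>t i l. ?b [False, False]),
       over nck (\<lambda>t i k. copies (?b [False]))])),
     over nvk (\<lambda>t i l. ?b [True, True]), ?b [False]]"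
  have "emits K B out (emit_instance M out) s (concat ?w)"
    unfolding emit_instance_def Let_def nvk_def[symmetric] nck_def[symmetric]
  proof (rule emits_seqs_list[OF B1], simp only: list_all2_Cons list_all2_Nil simp_thms,
      intro conjI emits_bits const[OF s(1)] emits_outer[OF s(1-3)], goal_cases)
    case (1 t i l s')
    show ?case
      by (intro emits_seqs[OF B1] emits_seqs_list[OF B1], simp only: list_all2_Cons list_all2_Nil simp_thms,
        intro conjI emits_bits emits_power 1)
  next
    case (2 t' i' l s')
    show ?case
    proof (intro emits_seqs[OF B1] emits_seqs_list[OF B1], simp only: list_all2_Cons list_all2_Nil simp_thms,
        intro conjI emits_bits const[OF 2(4)] emits_inner[OF 2(4)])
    qed (rule emits_contains[OF 2(4)], use 2 in auto)
  next
    case (3 t i k s')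
    show ?case
    proof (rule emits_repeat)
      fix j
      have "ready (shift (only 11) (int j) s') t i"
        using 3(4) by (simp add: ready_def only_def)
      then show "emits K B out (seqs [emit_bits out [True, False, False, False],
            inner nvk (\<lambda>_. emit_bits out [False, False]), inner nck (\<lambda>_. emit_copies out [False])])
          (shift (only 11) (int j) s')
          (concat [?b [True, False, False, False], over nvk (\<lambda>t i l. ?b [False, False]),
            over nck (\<lambda>t i k. copies (?b [False]))])"
        by (intro emits_seqs_list[OF B1]) (auto intro!: emits_bits const simp del: list.map)
    qed (use 3 s(4) out in auto)
  qed
  also have "concat ?w = map bit_symbol instance_bits"
    by (simp add: instance_bits_def no_arcs_def map_over map_concat copies_def numeral_2_eq_2 if_distrib cong: if_cong)
  finally show ?thesis .
qed

end

end

section \<open>Preparation and decoding\<close>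

definition emit_delimited :: "nat \<Rightarrow> nat \<Rightarrow> nat \<Rightarrow> com" where
  "emit_delimited out t f =
     Seq (For 0 (only 0) (Seq (emit out [t]) (If [0] (\<lambda>ss. hd ss = 2) (emit out [t]) (emit out [f]))))
       (emit out [f])"

lemma wf_emit_delimited [simp]: "t < S \<Longrightarrow> f < S \<Longrightarrow> wf_com K S (emit_delimited out t f)"
  by (simp add: emit_delimited_def)

lemma emits_delimited:
  assumes "s 0 = input_tape x" "0 < out" "out < K" "length x \<le> B" "1 \<le> B"
  shows "emits K B out (emit_delimited out t f) s (map (\<lambda>b. if b then t else f) (delimited x))"
proof -
  let ?c = "\<lambda>b. if b then t else f"
  have "emits K B out (For 0 (only 0) (Seq (emit out [t]) (If [0] (\<lambda>ss. hd ss = 2) (emit out [t]) (emit out [f])))) s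
     (concat (map (\<lambda>i. [t] @ [?c (x ! i)]) [0..<length x]))"
  proof (rule emits_For)
    show "is_word (length x) (s 0)"
      using assms(1) by (auto simp: bit_symbol_def simp flip: rt_input intro!: is_word_rt)
    fix i assume i: "i < length x"
    let ?s = "shift (only 0) (int i) s"
    have sc: "scanned (?s 0) = bit_symbol (x ! i)"
      using i assms(1) by (simp add: scanned_shift only_def input_tape_def)
    have "emits K B out (If [0] (\<lambda>ss. hd ss = 2) (emit out [t]) (emit out [f])) ?s [?c (x ! i)]"
    proof (rule emits_If)
      show "emits K B out (emit out [t]) ?s [?c (x ! i)]"
        if "hd (map (\<lambda>j. scanned (?s j)) [0]) = 2"
        using that sc emits_emit[OF assms(5), of K out "[t]"] by (simp add: bit_symbol_def split: if_splits)
      show "emits K B out (emit out [f]) ?s [?c (x ! i)]"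
        if "\<not> hd (map (\<lambda>j. scanned (?s j)) [0]) = 2"
        using that sc emits_emit[OF assms(5), of K out "[f]"] by (simp add: bit_symbol_def split: if_splits)
    qed (use assms in auto)
    then show "emits K B out (Seq (emit out [t]) (If [0] (\<lambda>ss. hd ss = 2) (emit out [t]) (emit out [f]))) ?s
      ([t] @ [?c (x ! i)])"
      using emits_emit[OF assms(5)] by (intro emits_Seq)
  qed (use assms in \<open>auto simp: only_def\<close>)
  moreover have "concat (map (\<lambda>i. [t] @ [?c (x ! i)]) [0..<length x]) = map ?c (concat (map (\<lambda>b. [True, b]) x))"
  proof -
    have "map (\<lambda>i. [t] @ [?c (x ! i)]) [0..<length x] = map (\<lambda>b. [t, ?c b]) x"
      by (rule nth_equalityI) auto
    then show ?thesis by (simp add: map_concat o_def)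
  qed
  ultimately have "emits K B out (emit_delimited out t f) s (map ?c (concat (map (\<lambda>b. [True, b]) x)) @ [f])"
    unfolding emit_delimited_def using emits_emit[OF assms(5)] by (intro emits_Seq) auto
  then show ?thesis by (simp add: delimited_def)
qed

definition fills :: "(nat \<times> com) list \<Rightarrow> com" where
  "fills cs = seqs (map (\<lambda>(k, c). fill k c) cs)"

text \<open>\<open>R\<close> contains the tapes that the emitting programs rely on. No filled tape
  belongs to \<open>R\<close>, so earlier fills cannot disturb later ones.\<close>

lemma exec_fills:
  assumes "1 \<le> B" "distinct (map fst cs)" "\<And>j. j \<in> R \<Longrightarrow> s' j = s j"
    and "\<And>k c s'. (k, c) \<in> set cs \<Longrightarrow> (\<And>j. j \<in> R \<Longrightarrow> s' j = s j) \<Longrightarrow> emits K B k c s' (w k)"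
    and "\<And>k c. (k, c) \<in> set cs \<Longrightarrow> s' k = blank_tape \<and> 0 \<notin> set (w k) \<and> length (w k) \<le> B \<and> k < K \<and> k \<notin> R"
  shows "exec K B (fills cs) s' (\<lambda>j. if j \<in> fst ` set cs then rt (w j) else s' j)"
  using assms(2-)
proof (induction cs arbitrary: s')
  case Nil
  then show ?case using exec_noop[OF assms(1)] by (simp add: fills_def seqs_def)
next
  case (Cons kc cs)
  obtain k c where kc: "kc = (k, c)" by (cases kc)
  let ?s = "s'(k := rt (w k))"
  have k: "(k, c) \<in> set (kc # cs)" using kc by simp
  have 1: "exec K B (fill k c) s' ?s"
    using Cons.prems(3)[OF k Cons.prems(2)] Cons.prems(4)[OF k] assms(1) by (intro exec_fill) auto
  have "exec K B (fills cs) ?s (\<lambda>j. if j \<in> fst ` set cs then rt (w j) else ?s j)"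
  proof (rule Cons.IH)
    show "?s j = s j" if "j \<in> R" for j using that Cons.prems(2)[OF that] Cons.prems(4)[of k c] kc by auto
    show "?s k' = blank_tape \<and> 0 \<notin> set (w k') \<and> length (w k') \<le> B \<and> k' < K \<and> k' \<notin> R"
      if "(k', c') \<in> set cs" for k' c'
      using that Cons.prems(1) Cons.prems(4)[of k' c'] kc by (auto simp: image_iff)
  qed (use Cons.prems in auto)
  moreover have "(\<lambda>j. if j \<in> fst ` set cs then rt (w j) else ?s j) =
      (\<lambda>j. if j \<in> fst ` set (kc # cs) then rt (w j) else s' j)"
    using kc by auto
  ultimately show ?case using 1 kc by (auto simp: fills_def seqs_def)
qed

definition emit_columns :: "nat poly \<Rightarrow> nat poly \<Rightarrow> nat \<Rightarrow> nat \<Rightarrow> com" where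
  "emit_columns pT pg b out = seqs [emit out [5], emit_poly pT b out 1, emit_poly pT b out 1,
     emit_delimited out 3 2, emit_poly pg b out 4, emit_poly pT b out 1, emit_poly pT b out 1, emit out [5]]"

definition emit_center :: "nat poly \<Rightarrow> nat \<Rightarrow> nat \<Rightarrow> com" where
  "emit_center pT b out = seqs [emit_poly pT b out 1, emit_poly pT b out 1, emit out [1], emit out [2]]"

definition control_fills :: "nat poly \<Rightarrow> nat poly \<Rightarrow> nat poly \<Rightarrow> nat poly \<Rightarrow> nat \<Rightarrow> (nat \<times> com) list" where
  "control_fills pT pg pW pN b =
     [(1, seqs [emit_poly pT b 1 1, emit 1 [1]]), (2, seqs [emit_poly pT b 2 1, emit 2 [2]]),
      (3, emit_columns pT pg b 3), (4, emit_columns pT pg b 4), (5, emit_center pT b 5), (6, emit_center pT b 6),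
      (7, seqs [emit 7 [3, 2, 4], emit_poly pT b 7 5, emit 7 [5]]),
      (8, seqs [emit 8 [3, 2, 4], emit_poly pW b 8 5]),
      (9, emit 9 [2]), (10, emit_poly pN b 10 1), (11, emit_poly pN b 11 1)]"

text \<open>The final move places the heads of tapes 7 and 8 on the symbol 2 in cell 1, as
  \<open>ready\<close> demands at time and column 0.\<close>

definition prepare :: "nat poly \<Rightarrow> nat poly \<Rightarrow> nat poly \<Rightarrow> nat poly \<Rightarrow> nat \<Rightarrow> nat \<Rightarrow> com" where
  "prepare pT pg pW pN b d = Seq (pow_tapes 0 b d) (Seq (fills (control_fills pT pg pW pN b))
     (move (\<lambda>j. if j = 7 \<or> j = 8 then Move_Right else Stay)))"

lemma wf_prepare: "6 \<le> S \<Longrightarrow> wf_com K S (prepare pT pg pW pN b d)"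
  by (simp add: prepare_def control_fills_def emit_columns_def emit_center_def fills_def)

definition start :: "bool list \<Rightarrow> nat \<Rightarrow> tape" where
  "start x = (\<lambda>i. if i = 0 then input_tape x else blank_tape)"

context reduction
begin

definition control_word :: "nat \<Rightarrow> nat list" where
  "control_word j = (if j = 1 then replicate (T + 1) 1 else if j = 2 then time_word
     else if j = 3 \<or> j = 4 then columns T g x else if j = 5 \<or> j = 6 then center_word
     else if j = 7 then [3, 2, 4] @ replicate (T + 1) 5 else if j = 8 then [3, 2, 4] @ replicate width 5
     else if j = 9 then [2] else replicate N 1)"

lemma exec_prepare:
  assumes p: "T = poly pT (length x)" "g = poly pg (length x)" "width = poly pW (length x)" "N = poly pN (length x)"
    and d: "degree pT \<le> d" "degree pg \<le> d" "degree pW \<le> d" "degree pN \<le> d"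
    and b: "11 < b" "b + d < K"
    and B: "length x ^ d \<le> B" "length x \<le> B" "2 * T + 4 \<le> B" "width + 3 \<le> B" "N \<le> B"
  obtains s where "exec K B (prepare pT pg pW pN b d) (start x) s" "ready s 0 0"
    "s 1 = rt (replicate (T + 1) 1)" "s 3 = rt (columns T g x)" "s 11 = rt (replicate N 1)"
    "s 0 = input_tape x" "\<And>j. 11 < j \<Longrightarrow> j < b \<or> b + d < j \<Longrightarrow> s j = blank_tape"
proof -
  let ?n = "length x"
  define s1 where "s1 = with_pows b d ?n (start x)"
  have B1: "1 \<le> B" using B by simp
  have 1: "exec K B (pow_tapes 0 b d) (start x) s1" unfolding s1_def
  proof (rule exec_pow_tapes)
    show "is_word ?n (start x 0)"
      by (auto simp: start_def bit_symbol_def simp flip: rt_input intro!: is_word_rt)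
  qed (use b B B1 in \<open>auto simp: start_def\<close>)
  define R where "R = insert 0 {b..b + d}"
  define cs where "cs = control_fills pT pg pW pN b"
  have fst_cs: "fst ` set cs = {1..11}" by (auto simp: cs_def control_fills_def) presburger
  have poly: "emits K B k (emit_poly p b k a) s (replicate (poly p ?n) a)"
    if "\<And>j. j \<in> R \<Longrightarrow> s j = s1 j" "degree p \<le> d" "k < b" for k p a s
  proof (rule emits_emit_poly)
    show "s (b + i) = rt (replicate (?n ^ i) 1)" if "i \<le> d" for i
      using that \<open>\<And>j. j \<in> R \<Longrightarrow> s j = s1 j\<close>[of "b + i"] by (simp add: R_def s1_def with_pows_def)
  qed (use that b B B1 in auto)
  have delim: "emits K B k (emit_delimited k t f) s (map (\<lambda>b. if b then t else f) (delimited x))"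
    if "\<And>j. j \<in> R \<Longrightarrow> s j = s1 j" "0 < k" "k < b" for k t f s
    using that b B B1 by (intro emits_delimited) (auto simp: R_def s1_def with_pows_def start_def)
  have 2: "exec K B (fills cs) s1 (\<lambda>j. if j \<in> fst ` set cs then rt (control_word j) else s1 j)"
  proof (rule exec_fills[where R = R and s = s1])
    show "distinct (map fst cs)" by (simp add: cs_def control_fills_def)
    show "s1 k = blank_tape \<and> 0 \<notin> set (control_word k) \<and> length (control_word k) \<le> B \<and> k < K \<and> k \<notin> R"
      if "(k, c) \<in> set cs" for k c
    proof -
      have k: "1 \<le> k" "k \<le> 11" using that fst_cs by (metis atLeastAtMost_iff fst_conv image_eqI)+
      have "0 \<notin> set (columns T g x)" by (auto simp: columns_def)
      then show ?thesis using k b B length_columns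
        by (auto simp: s1_def with_pows_def start_def R_def control_word_def time_word_def center_word_def ctr_def)
    qed
    fix k c s assume kc: "(k, c) \<in> set cs" and R: "\<And>j. j \<in> R \<Longrightarrow> s j = s1 j"
    note [intro] = poly[OF R] delim[OF R] emits_emit[OF B1] emits_seqs_list[OF B1]
    have cols: "emits K B k (emit_columns pT pg b k) s (columns T g x)" if "0 < k" "k < b"
    proof -
      have "emits K B k (emit_columns pT pg b k) s (concat [[5], replicate T 1, replicate T 1,
        map (\<lambda>b. if b then 3 else 2) (delimited x), replicate g 4, replicate T 1, replicate T 1, [5]])"
        unfolding emit_columns_def p(1,2) using that d
        by (intro emits_seqs_list[OF B1]) (auto simp del: replicate.simps emit.simps)
      then show ?thesis by (simp add: columns_def mult_2 replicate_add)
    qed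
    have center: "emits K B k (emit_center pT b k) s center_word" if "k < b"
    proof -
      have "emits K B k (emit_center pT b k) s (concat [replicate T 1, replicate T 1, [1], [2]])"
        unfolding emit_center_def p(1) using that d
        by (intro emits_seqs_list[OF B1]) (auto simp del: replicate.simps emit.simps)
      moreover have "concat [replicate T 1, replicate T 1, [1], [2]] = center_word"
      proof -
        have "ctr = T + (T + 1)" by (simp add: ctr_def)
        then show ?thesis unfolding center_word_def by (simp only: replicate_add) simp
      qed
      ultimately show ?thesis by simp
    qed
    have time: "emits K B k (seqs [emit_poly pT b k 1, emit k [a]]) s (concat [replicate T 1, [a]])" if "k < b" for a
      unfolding p(1) using that d by (intro emits_seqs_list[OF B1]) (auto simp del: replicate.simps emit.simps)
    have "emits K B k (seqs [emit_poly pT b k 1, emit k [1]]) s (replicate (T + 1) 1)" if "k < b"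
      using time[OF that, of 1] by (simp add: replicate_append_same)
    moreover have "emits K B k (seqs [emit_poly pT b k 1, emit k [2]]) s time_word" if "k < b"
      using time[OF that, of 2] by (simp add: time_word_def)
    moreover have "emits K B k (seqs [emit k [3, 2, 4], emit_poly pT b k 5, emit k [5]]) s
        (concat [[3, 2, 4], replicate T 5, [5]])" if "k < b"
      unfolding p(1) using that d by (intro emits_seqs_list[OF B1]) (auto simp del: replicate.simps emit.simps)
    moreover have "emits K B k (seqs [emit k [3, 2, 4], emit_poly pW b k 5]) s
        (concat [[3, 2, 4], replicate width 5])" if "k < b"
      unfolding p(3) using that d by (intro emits_seqs_list[OF B1]) (auto simp del: replicate.simps emit.simps)
    moreover have "emits K B k (emit_poly pN b k 1) s (replicate N 1)" if "k < b"
      unfolding p(4) using that d by auto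
    moreover note cols center emits_emit[OF B1, of K k "[2]" s]
    ultimately show "emits K B k c s (control_word k)"
      using kc b unfolding cs_def control_fills_def list.set insert_iff prod.inject empty_iff
      by (elim disjE conjE; simp add: control_word_def replicate_append_same)
  qed (use B1 in auto)
  define s2 where "s2 = (\<lambda>j. if j \<in> {1..11} then rt (control_word j) else s1 j)"
  let ?D = "\<lambda>j. if j = 7 \<or> j = 8 then Move_Right else Stay :: head_move"
  have 3: "exec K B (move ?D) s2 (shift ?D 1 s2)" using exec_move[OF B1] .
  have "ready (shift ?D 1 s2) 0 0"
    by (simp add: ready_def s2_def shift_def control_word_def rt_def)
  moreover have "shift ?D 1 s2 j = s2 j" if "j \<noteq> 7" "j \<noteq> 8" for j using that by simp
  ultimately show ?thesis
    using exec_Seq[OF 1 exec_Seq[OF 2[unfolded fst_cs, folded s2_def] 3]] b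
    by (intro that[of "shift ?D 1 s2"])
      (auto simp: prepare_def cs_def s2_def control_word_def s1_def with_pows_def start_def)
qed

end

section \<open>Reading off the guessed string and answering\<close>

definition steps :: "nat \<Rightarrow> (nat \<Rightarrow> head_move) \<Rightarrow> com" where
  "steps n D = seqs (replicate n (move D))"

lemma exec_steps: "1 \<le> B \<Longrightarrow> exec K B (steps n D) s (shift D (int n) s)"
proof -
  assume "1 \<le> B"
  then have "exec K B (seqs (replicate n (move D))) (shift D (int 0) s) (shift D (int (length (replicate n (move D)))) s)"
    by (intro exec_seqs[where st = "\<lambda>i. shift D (int i) s"]) (auto intro!: exec_move_shift)
  then show ?thesis by (simp add: steps_def)
qed

lemma nst_steps [simp]: "0 < nst (steps n D)" and wf_steps [simp]: "wf_com K S (steps n D)"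
  by (simp_all add: steps_def)

lemma shift_only: "shift (only k) z s = s(k := (fst (s k), snd (s k) + z))"
  and shift_only_opp: "shift (opp \<circ> only k) z s = s(k := (fst (s k), snd (s k) - z))"
  by (auto simp: shift_def only_def fun_eq_iff)

text \<open>The bit of \<open>VB\<close> is two cells to the right of that of \<open>VE\<close>,
  because the cell between them belongs to the negative literal of \<open>VE\<close>.\<close>

definition copy_bit :: "nat \<Rightarrow> nat \<Rightarrow> com" where
  "copy_bit F V = Seq (steps 2 (only F)) (Seq (If [F] (\<lambda>ss. hd ss = 2) (emit V [2]) (emit V [1]))
     (steps 2 (opp \<circ> only F)))"

text \<open>
  On tape \<open>F\<close> the root row of the adjacency matrix is read, in which every column of the tableau
  takes \<open>2 * n\<close> cells, starting with those of \<open>VE\<close> and \<open>VB\<close>.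
\<close>

definition read_guess :: "nat \<Rightarrow> nat \<Rightarrow> nat \<Rightarrow> com" where
  "read_guess n F V = Seq (emit_delimited V 2 1) (Seq (steps 2 (only F)) (For 4 (only 4)
     (Seq (If [4, F] (\<lambda>ss. ss ! 0 = 4 \<and> ss ! 1 = 2)
         (copy_bit F V) noop)
       (steps (2 * n) (only F)))))"

lemma wf_read_guess: "3 \<le> S \<Longrightarrow> wf_com K S (read_guess n F V)"
  by (simp add: read_guess_def copy_bit_def steps_def)

lemma exec_read_guess:
  assumes F: "s F = (c, 0)" and V: "s V = blank_tape" and x: "s 0 = input_tape x" and w: "s 4 = rt cs"
    and K: "4 < F" "F < K" "4 < V" "V < K" "F \<noteq> V" and B: "length cs \<le> B" "length x \<le> B" "1 \<le> B"
    and cs: "0 \<notin> set cs"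
  obtains s' where "exec K B (read_guess n F V) s s'" "\<And>j. j \<noteq> F \<Longrightarrow> j \<noteq> V \<Longrightarrow> s' j = s j"
    "s' V = wt (map bit_symbol (delimited x @ concat (map (\<lambda>i.
       if cs ! i = 4 \<and> c (2 + int (2 * n * i)) = 2 then [c (4 + int (2 * n * i)) = 2] else []) [0..<length cs])))"
proof -
  define bits where "bits i = (if cs ! i = 4 \<and> c (2 + int (2 * n * i)) = 2 then [c (4 + int (2 * n * i)) = 2] else [])" for i
  define st where "st i = s(F := (c, 2 + int (2 * n * i)),
      V := wt (map bit_symbol (delimited x @ concat (map bits [0..<i]))))" for i
  have bits: "map (\<lambda>b. if b then 2 else 1) (delimited x) = map bit_symbol (delimited x)"
    by (simp add: bit_symbol_def)
  have "emits K B V (emit_delimited V 2 1) s (map bit_symbol (delimited x))"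
    using emits_delimited[of s x V K B 2 1, OF x] K B unfolding bits by simp
  then have "exec K B (emit_delimited V 2 1) (s(V := wt [])) (s(V := wt (map bit_symbol (delimited x))))"
    unfolding emits_def by (metis append_Nil)
  moreover have "s(V := wt []) = s" using V by (auto simp: wt_Nil)
  ultimately have 1: "exec K B (emit_delimited V 2 1) s (s(V := wt (map bit_symbol (delimited x))))" by simp
  have 2: "exec K B (steps 2 (only F)) (s(V := wt (map bit_symbol (delimited x)))) (st 0)"
    using exec_steps[OF B(3), of K 2 "only F" "s(V := wt (map bit_symbol (delimited x)))"] K F
    by (simp add: shift_only st_def fun_upd_twist)
  let ?copy = "If [4, F] (\<lambda>ss. ss ! 0 = 4 \<and> ss ! 1 = 2) (copy_bit F V) noop"
  let ?body = "Seq ?copy (steps (2 * n) (only F))"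
  have 3: "exec K B (For 4 (only 4) ?body) (st 0) (st (length cs))"
  proof (rule exec_For)
    show "is_word (length cs) (st i 4)" for i
      using w K cs by (simp add: st_def is_word_rt)
    fix i assume i: "i < length cs"
    let ?s = "shift (only 4) (int i) (st i)"
    let ?v = "map bit_symbol (delimited x @ concat (map bits [0..<i]))"
    let ?p = "2 + int (2 * n * i)"
    have sF: "?s F = (c, ?p)" and sV: "?s V = wt ?v"
      using K by (auto simp: only_def st_def)
    have s4: "scanned (?s 4) = cs ! i" using w K i
      by (simp add: scanned_shift only_def st_def rt_def cells_def)
    let ?s1 = "?s(V := wt (?v @ map bit_symbol (bits i)))"
    have s1F: "?s1 F = (c, ?p)" using sF K by simp
    have "exec K B ?copy ?s ?s1"
    proof (rule exec_If)
      assume "map (\<lambda>j. scanned (?s j)) [4, F] ! 0 = 4 \<and> map (\<lambda>j. scanned (?s j)) [4, F] ! 1 = 2"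
      then have "cs ! i = 4 \<and> c ?p = 2" using s4 sF by (simp add: scanned_def)
      then have bits: "bits i = [c (2 + ?p) = 2]" by (simp add: bits_def)
      let ?t = "?s(F := (c, ?p + 2))"
      have "exec K B (steps 2 (only F)) ?s ?t"
        using exec_steps[OF B(3), of K 2 "only F" ?s] sF by (simp add: shift_only)
      moreover have "exec K B (If [F] (\<lambda>ss. hd ss = 2) (emit V [2]) (emit V [1])) ?t (?t(V := wt (?v @ map bit_symbol (bits i))))"
      proof (rule exec_If)
        have tV: "?t = ?t(V := wt ?v)" using sV K by (auto simp: fun_eq_iff)
        have em: "exec K B (emit V [a]) ?t (?t(V := wt (?v @ [a])))" for a
          using emits_emit[OF B(3), of K V "[a]" ?t, unfolded emits_def, rule_format, of ?v] tV by metis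
        show "exec K B (emit V [2]) ?t (?t(V := wt (?v @ map bit_symbol (bits i))))"
          if "hd (map (\<lambda>j. scanned (?t j)) [F]) = 2"
          using that em[of 2] by (simp add: scanned_def bits bit_symbol_def add.commute)
        show "exec K B (emit V [1]) ?t (?t(V := wt (?v @ map bit_symbol (bits i))))"
          if "\<not> hd (map (\<lambda>j. scanned (?t j)) [F]) = 2"
          using that em[of 1] by (simp add: scanned_def bits bit_symbol_def add.commute)
      qed (use K in auto)
      moreover have "exec K B (steps 2 (opp \<circ> only F)) (?t(V := wt (?v @ map bit_symbol (bits i)))) ?s1"
      proof -
        have "shift (opp \<circ> only F) 2 (?t(V := wt (?v @ map bit_symbol (bits i)))) = ?s1"
          using K sF unfolding shift_only_opp by (auto simp: fun_eq_iff)
        then show ?thesis using exec_steps[OF B(3), of K 2 "opp \<circ> only F" "?t(V := wt (?v @ map bit_symbol (bits i)))"]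
          by simp
      qed
      ultimately show "exec K B (copy_bit F V) ?s ?s1" unfolding copy_bit_def by blast
    next
      assume "\<not> (map (\<lambda>j. scanned (?s j)) [4, F] ! 0 = 4 \<and> map (\<lambda>j. scanned (?s j)) [4, F] ! 1 = 2)"
      then have "bits i = []" using s4 sF by (auto simp: scanned_def bits_def)
      then have "?s1 = ?s" using sV by (auto simp: fun_eq_iff)
      then show "exec K B noop ?s ?s1" using exec_noop[OF B(3)] by simp
    qed (use K in \<open>auto simp: copy_bit_def steps_def\<close>)
    moreover have "exec K B (steps (2 * n) (only F)) ?s1 (shift (only 4) (int i) (st (Suc i)))"
    proof -
      have "shift (only F) (int (2 * n)) ?s1 = shift (only 4) (int i) (st (Suc i))"
        using K sF unfolding shift_only by (auto simp: fun_eq_iff st_def algebra_simps)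
      then show ?thesis using exec_steps[OF B(3), of K "2 * n" "only F" ?s1] by simp
    qed
    ultimately show "exec K B ?body ?s (shift (only 4) (int i) (st (Suc i)))" by blast
  qed (use K B in \<open>auto simp: only_def\<close>)
  have "exec K B (read_guess n F V) s (st (length cs))"
    unfolding read_guess_def using 1 2 3 by blast
  then show ?thesis by (rule that) (auto simp: st_def bits_def[abs_def])
qed

text \<open>The answer overwrites the input on the first tape; the blank behind it cuts off the rest
  of the input.\<close>

definition answer :: "nat \<Rightarrow> com" where
  "answer V = If [V] (\<lambda>ss. hd ss = 2)
     (Seq (put 0 2 Move_Right) (put 0 0 Stay)) (Seq (put 0 1 Move_Right) (put 0 0 Stay))"

lemma wf_answer: "3 \<le> S \<Longrightarrow> wf_com K S (answer V)"
  by (simp add: answer_def)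

lemma exec_answer:
  assumes "snd (s V) = 0" "tape_holds (s V) [b]" "snd (s 0) = 0" "V < K" "1 \<le> B"
  obtains s' where "exec K B (answer V) s s'" "tape_holds (s' 0) [b]"
proof -
  define T where "T = act (0, Stay) (act (bit_symbol b, Move_Right) (s 0))"
  have put: "exec K B (Seq (put 0 a Move_Right) (put 0 0 Stay)) s (s(0 := T))" if "a = bit_symbol b" for a
  proof -
    have "exec K B (put 0 0 Stay) (s(0 := act (a, Move_Right) (s 0))) (s(0 := T))"
      using exec_put[OF assms(5), of K 0 0 Stay "s(0 := act (a, Move_Right) (s 0))"] that
      by (simp add: T_def)
    then show ?thesis using exec_put[OF assms(5), of K 0 a Move_Right s] by blast
  qed
  have sc: "scanned (s V) = bit_symbol b" using assms(1,2) by (simp add: scanned_def tape_holds_def)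
  have "exec K B (answer V) s (s(0 := T))" unfolding answer_def
    by (rule exec_If) (use assms sc put in \<open>auto simp: bit_symbol_def split: if_splits\<close>)
  moreover have "tape_holds T [b]" using assms(3) by (simp add: T_def act_eq tape_holds_def)
  ultimately show ?thesis by (intro that[of "s(0 := T)"]) auto
qed

text \<open>A total left inverse of \<open>encode_pair\<close> in its first argument, computed by a finite automaton.\<close>

fun parse_step :: "nat \<times> bool list \<Rightarrow> bool \<Rightarrow> nat \<times> bool list" where
  "parse_step (f, w) b = (if f = 0 then (if b then 1 else 2, w) else if f = 1 then (0, w @ [b]) else (f, w))"

definition parse :: "bool list \<Rightarrow> bool list" where
  "parse z = snd (foldl parse_step (0, []) z)"

lemma parse_pair: "parse (encode_pair x y) = x"
proof -
  have "foldl parse_step (0, w) (concat (map (\<lambda>b. [True, b]) x)) = (0, w @ x)" for w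
    by (induction x arbitrary: w) auto
  moreover have "snd (foldl parse_step (2, w) y) = w" for w by (induction y) auto
  ultimately show ?thesis by (simp add: parse_def encode_pair_def delimited_def)
qed

text \<open>Cell 0 of tape 1 stores the state of the automaton: 0 before a flag, 1 before a data
  bit, 2 behind the delimited part. The initial state coincides with the blank, so the tape is ready
  from the start.\<close>

definition parse_bit :: "nat \<Rightarrow> com" where
  "parse_bit V = If [1] (\<lambda>ss. hd ss = 0) (If [0] (\<lambda>ss. hd ss = 2) (put 1 1 Stay) (put 1 2 Stay))
     (If [1] (\<lambda>ss. hd ss = 1)
       (Seq (put 1 0 Stay) (If [0] (\<lambda>ss. hd ss = 2) (emit V [2]) (emit V [1]))) noop)"

definition parse_prog :: "nat \<Rightarrow> com" where
  "parse_prog V = For 0 (only 0) (parse_bit V)"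

lemma wf_parse_prog: "3 \<le> S \<Longrightarrow> wf_com K S (parse_prog V)"
  by (simp add: parse_prog_def parse_bit_def)

lemma exec_parse:
  assumes V: "1 < V" "V < K" and B: "length z \<le> B" "1 \<le> B"
    and s: "s 0 = input_tape z" "s 1 = blank_tape" "s V = blank_tape"
  obtains s' where "exec K B (parse_prog V) s s'" "\<And>j. j \<noteq> 1 \<Longrightarrow> j \<noteq> V \<Longrightarrow> s' j = s j"
    "s' V = wt (map bit_symbol (parse z))" "length (parse z) \<le> length z"
proof -
  define P where "P i = foldl parse_step (0, []) (take i z)" for i
  define st where "st i = s(1 := ((\<lambda>_. 0)(0 := fst (P i)), 0), V := wt (map bit_symbol (snd (P i))))" for i
  have "exec K B (parse_prog V) (st 0) (st (length z))" unfolding parse_prog_def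
  proof (rule exec_For)
    show "is_word (length z) (st i 0)" for i
      using s V by (auto simp: st_def bit_symbol_def simp flip: rt_input intro!: is_word_rt)
    fix i assume i: "i < length z"
    obtain f w where fw: "P i = (f, w)" by (cases "P i")
    have P: "P (Suc i) = parse_step (f, w) (z ! i)"
      unfolding P_def take_Suc_conv_app_nth[OF i] foldl_append using fw by (simp add: P_def)
    let ?s = "shift (only 0) (int i) (st i)"
    let ?e = "shift (only 0) (int i) (st (Suc i))"
    have s0: "scanned (?s 0) = bit_symbol (z ! i)"
      using i s V by (simp add: scanned_shift only_def st_def input_tape_def)
    have s1: "?s 1 = ((\<lambda>_. 0)(0 := f), 0)" and sV: "?s V = wt (map bit_symbol w)"
      using V by (auto simp: st_def only_def fw)
    then have sc1: "scanned (?s 1) = f" by (simp add: scanned_def)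
    have e: "?e = ?s(1 := ((\<lambda>_. 0)(0 := fst (P (Suc i))), 0), V := wt (map bit_symbol (snd (P (Suc i)))))"
      using V by (auto simp: fun_eq_iff st_def shift_def only_def)
    have put: "exec K B (put 1 a Stay) ?s (?s(1 := ((\<lambda>_. 0)(0 := a), 0)))" for a
      using exec_put[OF B(2), of K 1 a Stay ?s] unfolding s1 by (simp add: act_eq)
    show "exec K B (parse_bit V) ?s ?e" unfolding parse_bit_def
    proof (rule exec_If)
      assume "hd (map (\<lambda>j. scanned (?s j)) [1]) = 0"
      then have f: "f = 0" using sc1 by simp
      have eq: "?e = ?s(1 := ((\<lambda>_. 0)(0 := if z ! i then 1 else 2), 0))"
        unfolding e P f using sV V by (auto simp: fun_eq_iff)
      show "exec K B (If [0] (\<lambda>ss. hd ss = 2) (put 1 1 Stay) (put 1 2 Stay)) ?s ?e"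
        unfolding eq by (rule exec_If) (use V s0 put in \<open>auto simp: bit_symbol_def split: if_splits\<close>)
    next
      assume "\<not> hd (map (\<lambda>j. scanned (?s j)) [1]) = 0"
      then have f: "f \<noteq> 0" using sc1 by simp
      show "exec K B (If [1] (\<lambda>ss. hd ss = 1)
         (Seq (put 1 0 Stay) (If [0] (\<lambda>ss. hd ss = 2) (emit V [2]) (emit V [1]))) noop) ?s ?e"
      proof (rule exec_If)
        assume "hd (map (\<lambda>j. scanned (?s j)) [1]) = 1"
        then have f: "f = 1" using sc1 by simp
        let ?t = "?s(1 := ((\<lambda>_. 0)(0 := 0), 0))"
        have eq: "?e = ?t(V := wt (map bit_symbol w @ [bit_symbol (z ! i)]))"
          unfolding e P f by simp
        have tV: "?t = ?t(V := wt (map bit_symbol w))" using sV V by (auto simp: fun_eq_iff)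
        have em: "exec K B (emit V [a]) ?t (?t(V := wt (map bit_symbol w @ [a])))" for a
          using emits_emit[OF B(2), of K V "[a]" ?t, unfolded emits_def, rule_format, of "map bit_symbol w"] tV by metis
        have "exec K B (If [0] (\<lambda>ss. hd ss = 2) (emit V [2]) (emit V [1])) ?t ?e"
          unfolding eq by (rule exec_If) (use V s0 em in \<open>auto simp: bit_symbol_def split: if_splits\<close>)
        then show "exec K B (Seq (put 1 0 Stay) (If [0] (\<lambda>ss. hd ss = 2) (emit V [2]) (emit V [1]))) ?s ?e"
          using put[of 0] by blast
      next
        assume "\<not> hd (map (\<lambda>j. scanned (?s j)) [1]) = 1"
        then have "f \<noteq> 1" using sc1 by simp
        then have "?e = ?s" unfolding e P using f s1 sV by (auto simp: fun_eq_iff)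
        then show "exec K B noop ?s ?e" using exec_noop[OF B(2)] by simp
      qed (use V in auto)
    qed (use V in auto)
  qed (use V B in \<open>auto simp: only_def\<close>)
  moreover have "st 0 = s" using s by (auto simp: st_def P_def wt_Nil blank_tape_def fun_eq_iff)
  moreover have len: "length (snd (foldl parse_step (f, w) z)) \<le> length w + length z" for f w
  proof (induction z arbitrary: f w)
    case (Cons b z)
    obtain f' w' where "parse_step (f, w) b = (f', w')" by (cases "parse_step (f, w) b")
    moreover have "length w' \<le> length w + 1" using calculation by (auto split: if_splits)
    ultimately show ?case using Cons[of f' w'] by simp
  qed auto
  ultimately show ?thesis
    using len[of 0 "[]"] by (intro that[of "st (length z)"]) (auto simp: st_def P_def parse_def)
qed

section \<open>The decision procedure\<close>

lemma poly_mono_nat: "a \<le> b \<Longrightarrow> poly p a \<le> poly p b" for p :: "nat poly"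
  by (induction p) (auto intro!: add_mono mult_mono)

lemma emits_mono: "emits K A out c s w \<Longrightarrow> A \<le> B \<Longrightarrow> emits K B out c s w"
  unfolding emits_def using exec_mono by blast

text \<open>The certificate is empty, and the verifier parses the pair and decides its first
  component. The approximation yields only the inclusion of NP in P, whereas the theorem assumes an
  inequality; this is the other inclusion.\<close>

lemma class_P_subset_NP: "class_P \<subseteq> class_NP"
proof
  fix L assume "L \<in> class_P"
  then obtain M p where M: "wf_tm M" and run: "\<And>x. \<exists>t \<le> poly p (length x).
      halts_with_output M ((tm_step M ^^ t) (initial_config M x)) [x \<in> L]"
    unfolding class_P_def poly_time_computable_def by blast
  let ?k = "num_tapes M"
  let ?K = "3 + ?k" and ?S = "3 + num_symbols M"
  let ?c = "Seq (parse_prog 3) (Seq (rewind 3) (Seq (call M 3 2) (answer 3)))"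
  let ?p = "[:2, 1:] + 2 * p"
  have k: "0 < ?k" using M by (simp add: wf_tm_def)
  have "poly_time_computable (\<lambda>z. [parse z \<in> L])"
  proof (rule exec_poly_time)
    show "wf_com ?K ?S ?c"
      using M by (simp add: wf_parse_prog wf_answer wf_call)
    fix z :: "bool list"
    let ?B = "poly ?p (length z)"
    have B: "length z + 2 + 2 * poly p (length z) = ?B" by simp
    obtain s1 where s1: "exec ?K ?B (parse_prog 3) (start z) s1" "\<And>j. j \<noteq> 1 \<Longrightarrow> j \<noteq> 3 \<Longrightarrow> s1 j = start z j"
      "s1 3 = wt (map bit_symbol (parse z))" "length (parse z) \<le> length z"
    proof (rule exec_parse[where V = 3 and K = ?K and z = z and B = ?B and s = "start z"])
      show "length z \<le> ?B" "1 \<le> ?B" using B by linarith+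
    qed (use k in \<open>auto simp: start_def\<close>)
    have 2: "exec ?K ?B (rewind 3) s1 (s1(3 := input_tape (parse z)))"
      unfolding rt_input[symmetric]
      by (rule exec_rewind[where p = "length (parse z)"])
        (use s1 k B in \<open>auto simp: wt_def bit_symbol_def\<close>)
    obtain t where t: "t \<le> poly p (length (parse z))"
      "halts_with_output M ((tm_step M ^^ t) (initial_config M (parse z))) [parse z \<in> L]" using run by blast
    have "poly p (length (parse z)) \<le> poly p (length z)" using s1(4) by (rule poly_mono_nat)
    then have "2 * t + 1 \<le> ?B" using t(1) B by linarith
    note t2 = this
    obtain s3 where s3: "exec ?K ?B (call M 3 2) (s1(3 := input_tape (parse z))) s3" "snd (s3 3) = 0"
      "tape_holds (s3 3) [parse z \<in> L]"
      "\<And>i. i < 3 \<or> 3 + ?k \<le> i \<Longrightarrow> i \<noteq> 2 \<Longrightarrow> s3 i = (s1(3 := input_tape (parse z))) i"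
      by (rule exec_call[OF M _ _ _ _ _ _ t(2), of 3 ?K 2 "s1(3 := input_tape (parse z))" ?B])
        (use s1(2) t2 in \<open>auto simp: start_def\<close>)
    have "snd (s3 0) = 0" using s3(4)[of 0] s1(2)[of 0] by (simp add: start_def input_tape_def)
    then obtain s4 where s4: "exec ?K ?B (answer 3) s3 s4" "tape_holds (s4 0) [parse z \<in> L]"
      using exec_answer[of s3 3 "parse z \<in> L" ?K ?B] s3 k B by auto
    show "\<exists>s'. exec ?K ?B ?c (\<lambda>i. if i = 0 then input_tape z else blank_tape) s' \<and>
        tape_holds (s' 0) [parse z \<in> L]"
      using s1(1) 2 s3(1) s4 unfolding start_def by blast
  qed auto
  then have "{z. parse z \<in> L} \<in> class_P" by (simp add: class_P_def)
  moreover have "x \<in> L \<longleftrightarrow> (\<exists>y. length y \<le> poly 0 (length x) \<and> encode_pair x y \<in> {z. parse z \<in> L})" for x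
    by (auto simp: parse_pair)
  ultimately show "L \<in> class_NP" unfolding class_NP_def by blast
qed

text \<open>Apart from the factor \<open>nv + 1\<close> the left side is
  \<open>s powr (2 - \<epsilon>)\<close>, where \<open>s \<le> 2 * nc * N\<close>; this is at most
  \<open>4 * nc ^ 2 * N ^ 2 / N powr \<epsilon>\<close>, and
  \<open>N powr \<epsilon> \<ge> Z\<close>. The part \<open>4 * (nv + 1) * nc\<close> of
  \<open>Z\<close> beats what remains, and \<open>2 * nv + 3\<close> makes root, relay and literals
  fewer than the clause copies.\<close>

lemma gap_ratio:
  fixes nv nc N Z k :: nat and \<epsilon> :: real
  assumes \<epsilon>: "0 < \<epsilon>" "\<epsilon> < 1" "1 \<le> real k * \<epsilon>" and N: "N = Z ^ k"
    and Z: "4 * (nv + 1) * nc + 2 * nv + 3 \<le> Z" and nc: "1 \<le> nc"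
  defines "s \<equiv> 2 + 2 * nv + nc * N"
  shows "real s powr (1 - \<epsilon>) * real (s * (nv + 1)) < real (N * N * nc)"
proof -
  have k: "1 \<le> k" using \<epsilon> by (cases k) auto
  have Z1: "1 \<le> Z" using Z by simp
  then have NZ: "Z \<le> N" unfolding N using k by (metis power_increasing power_one_right)
  have N0: "0 < real N" using NZ Z1 by simp
  have "N \<le> nc * N" using nc by simp
  then have "2 + 2 * nv \<le> nc * N" using NZ Z by linarith
  then have "s \<le> 2 * nc * N" unfolding s_def by linarith
  then have "real s \<le> real (2 * nc * N)" by (simp only: of_nat_le_iff)
  then have s: "real s \<le> (2 * real nc) * real N" by simp
  have "0 < s" by (simp add: s_def)
  then have s0: "0 < real s" by simp
  have Neps: "real Z \<le> real N powr \<epsilon>"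
  proof -
    have "real Z powr 1 \<le> real Z powr (real k * \<epsilon>)" using \<epsilon> Z1 by (intro powr_mono) auto
    also have "\<dots> = real N powr \<epsilon>" unfolding N using Z1 by (simp add: powr_powr flip: powr_realpow)
    finally show ?thesis using Z1 by simp
  qed
  have "real s powr (1 - \<epsilon>) * real s = real s powr (2 - \<epsilon>)"
    using s0 by (simp add: powr_mult_base mult.commute)
  also have "\<dots> \<le> ((2 * real nc) * real N) powr (2 - \<epsilon>)" using s s0 \<epsilon> by (intro powr_mono2) auto
  also have "\<dots> = (2 * real nc) powr (2 - \<epsilon>) * real N powr (2 - \<epsilon>)" using N0 nc by (subst powr_mult) auto
  also have "\<dots> \<le> (2 * real nc) powr 2 * real N powr (2 - \<epsilon>)"
    using nc \<epsilon> by (intro mult_right_mono powr_mono) auto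
  also have "\<dots> = 4 * real nc ^ 2 * real N ^ 2 / real N powr \<epsilon>"
    using nc N0 by (simp add: powr_diff power_mult_distrib)
  also have "\<dots> \<le> 4 * real nc ^ 2 * real N ^ 2 / real Z"
    using Neps Z1 N0 by (intro divide_left_mono mult_pos_pos) auto
  finally have "real s powr (1 - \<epsilon>) * real s * real (nv + 1) \<le> 4 * real nc ^ 2 * real N ^ 2 / real Z * real (nv + 1)"
    by (intro mult_right_mono) auto
  also have "\<dots> = (real N ^ 2 * real nc) * (real (4 * (nv + 1) * nc) / real Z)"
    by (simp add: power2_eq_square algebra_simps)
  also have "\<dots> < (real N ^ 2 * real nc) * 1"
  proof (rule mult_strict_left_mono)
    have "4 * (nv + 1) * nc < Z" using Z by linarith
    then show "real (4 * (nv + 1) * nc) / real Z < 1" using Z1 by (subst divide_less_eq_1_pos) (auto simp del: of_nat_mult of_nat_add)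
  qed (use nc N0 in auto)
  finally show ?thesis by (simp add: power2_eq_square algebra_simps)
qed

context tableau
begin

lemma guess_columns:
  "concat (map (\<lambda>i. if columns T g x ! i = 4 \<and> P i then [Q i] else []) [0..<width]) =
     map (\<lambda>e. Q (guess_start + e)) (filter (\<lambda>e. P (guess_start + e)) [0..<g])"
proof -
  let ?h = "\<lambda>i. if columns T g x ! i = 4 \<and> P i then [Q i] else []"
  have le: "guess_start + g \<le> width" by (simp add: guess_start_def width_def ctr_def)
  then have split: "[0..<width] = [0..<guess_start] @ map (\<lambda>e. guess_start + e) [0..<g] @ [guess_start + g..<width]"
    by (intro nth_equalityI) (auto simp: nth_append)
  have "?h i = []" if "i < guess_start \<or> guess_start + g \<le> i" "i < width" for i
  proof -
    have "columns T g x ! i \<noteq> 4"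
    proof (cases "1 \<le> i \<and> i < width - 1")
      case True
      then have "1 \<le> i" "i < width - 1" by auto
      then show ?thesis using that by (cases rule: column_cases) auto
    next
      case False
      then have "i = 0 \<or> i = width - 1" using that by linarith
      then show ?thesis using columns_nth(1,2) by auto
    qed
    then show ?thesis by simp
  qed
  then have "concat (map ?h [0..<guess_start]) = []" "concat (map ?h [guess_start + g..<width]) = []"
    using le by auto
  moreover have "concat (map ?h (map (\<lambda>e. guess_start + e) [0..<g])) =
      map (\<lambda>e. Q (guess_start + e)) (filter (\<lambda>e. P (guess_start + e)) [0..<g])"
  proof -
    have "concat (map ?h (map (\<lambda>e. guess_start + e) es)) =
      map (\<lambda>e. Q (guess_start + e)) (filter (\<lambda>e. P (guess_start + e)) es)" if "set es \<subseteq> {..<g}" for es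
    using that columns_nth(5) by (induction es) auto
    from this[of "[0..<g]"] show ?thesis by (simp add: lessThan_atLeast0)
  qed
  ultimately show ?thesis unfolding split map_append concat_append by (simp only: append_Nil append_Nil2)
qed

lemma length_guessed: "length (guessed \<alpha>) \<le> g"
  unfolding guessed_def by (metis diff_zero length_filter_le length_map length_upt)

end

text \<open>In row-major order the first \<open>n\<close> bits describe the arcs that leave the
  root, which are all that is read from the output.\<close>

lemma encode_arcs_nth:
  assumes "j < n"
  shows "encode_arcs n E' ! j \<longleftrightarrow> (0, j) \<in> E'" "j < length (encode_arcs n E')"
proof -
  have "1 \<le> n" using assms by simp
  then have "n * 1 \<le> n * n" by (rule mult_le_mono2)
  then have "j < n * n" using assms by linarith
  then show "j < length (encode_arcs n E')" by (simp add: encode_arcs_def)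
  then show "encode_arcs n E' ! j \<longleftrightarrow> (0, j) \<in> E'"
    using assms by (simp add: encode_arcs_def product_nth)
qed

text \<open>Tapes 0 to 11 serve the emission, 12 and 13 are the shadow tapes of the two calls, 14 to
  \<open>14 + d\<close> hold the powers of the input length, and then come the tapes of
  \<open>A\<close> and of \<open>M\<close>. The instance and the verified pair are written directly
  onto the input tapes of these machines.\<close>

definition solve :: "turing_machine \<Rightarrow> turing_machine \<Rightarrow> nat poly \<Rightarrow> nat poly \<Rightarrow> nat poly \<Rightarrow> nat poly \<Rightarrow> nat \<Rightarrow> com" where
  "solve A M pT pg pW pN d =
     (let F = 15 + d; V = F + num_tapes A in
      Seq (prepare pT pg pW pN 14 d) (Seq (fill F (emit_instance M F)) (Seq (call A F 12)
        (Seq (read_guess (length (var_list M)) F V) (Seq (rewind V) (Seq (call M V 13) (answer V)))))))"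

lemma wf_solve:
  assumes "wf_tm A" "wf_tm M" "K = 15 + d + num_tapes A + num_tapes M" "6 + num_symbols A + num_symbols M \<le> S"
  shows "wf_com K S (solve A M pT pg pW pN d)"
  using assms by (simp add: solve_def Let_def wf_prepare wf_emit_instance wf_call wf_read_guess wf_answer)

text \<open>Two bounds avoid a circularity: the length of the instance is itself estimated by the
  time for writing it. That happens under \<open>B0\<close>, which covers only the words controlling
  the loops; \<open>B\<close> is then chosen for \<open>A\<close> on an input of length up to
  \<open>cost B0 (emit_instance M (15 + d))\<close>.\<close>

lemma exec_solve:
  assumes A: "wf_tm A" and runA: "\<And>z. \<exists>t \<le> poly pA (length z).
      halts_with_output A ((tm_step A ^^ t) (initial_config A z)) (f z)"
    and M: "wf_tm M" and runM: "\<And>z. \<exists>t \<le> poly pM (length z).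
      halts_with_output M ((tm_step M ^^ t) (initial_config M z)) [z \<in> V]"
    and red: "reduction M N"
    and p: "T = poly pT (length x)" "g = poly pg (length x)" "tableau.width T g x = poly pW (length x)" "N = poly pN (length x)"
    and d: "degree pT \<le> d" "degree pg \<le> d" "degree pW \<le> d" "degree pN \<le> d"
    and K: "K = 15 + d + num_tapes A + num_tapes M"
    and E': "f (encode_instance (reduction.inst M T g x N)) = encode_arcs (card (pverts (inst_graph (reduction.inst M T g x N)))) E'"
    and B: "length x ^ d \<le> B0" "length x \<le> B0" "2 * T + 4 \<le> B0" "tableau.width T g x + 3 \<le> B0" "N \<le> B0"
      "B0 \<le> B" "cost B0 (emit_instance M (15 + d)) \<le> B" "2 * poly pA (cost B0 (emit_instance M (15 + d))) + 1 \<le> B"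
      "2 * length x + 1 + g \<le> B" "2 * poly pM (2 * length x + 1 + g) + 1 \<le> B"
  obtains s' where "exec K B (solve A M pT pg pW pN d) (start x) s'"
    "tape_holds (s' 0) [encode_pair x (tableau.guessed T g x (reduction.chosen M T g x E')) \<in> V]"
proof -
  interpret reduction M T g x N by (rule red)
  let ?F = "15 + d" and ?V = "15 + d + num_tapes A"
  have k: "0 < num_tapes A" "0 < num_tapes M" using A M by (auto simp: wf_tm_def)
  have B1: "1 \<le> B0" "1 \<le> B" using B by simp_all
  obtain s1 where s1: "exec K B0 (prepare pT pg pW pN 14 d) (start x) s1" "ready s1 0 0"
    "s1 1 = rt (replicate (T + 1) 1)" "s1 3 = rt (columns T g x)" "s1 11 = rt (replicate N 1)"
    "s1 0 = input_tape x" "\<And>j. 11 < j \<Longrightarrow> j < 14 \<or> 14 + d < j \<Longrightarrow> s1 j = blank_tape"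
    using exec_prepare[OF p d, of 14 K B0] B(1-5) K by auto
  have em: "emits K B0 ?F (emit_instance M ?F) s1 (map bit_symbol instance_bits)"
    by (rule emits_instance) (use s1 K k B in auto)
  have len: "length instance_bits \<le> cost B0 (emit_instance M ?F)"
    using emits_length[OF em] K k by simp
  let ?s2 = "s1(?F := input_tape instance_bits)"
  have 2: "exec K B (fill ?F (emit_instance M ?F)) s1 ?s2"
    unfolding rt_input[symmetric]
    by (rule exec_fill[OF emits_mono[OF em B(6)]])
      (use s1(7) K k B B1 len in \<open>auto simp: bit_symbol_def\<close>)
  let ?sz = "2 + 2 * nv + nc * N"
  let ?y = "encode_arcs ?sz E'"
  have fy: "f instance_bits = ?y" using E' unfolding encode_inst by (simp add: gap_instance_def)
  obtain t where t: "t \<le> poly pA (length instance_bits)"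
    "halts_with_output A ((tm_step A ^^ t) (initial_config A instance_bits)) ?y"
    using runA[of instance_bits] fy by auto
  have "2 * t + 1 \<le> B" using t(1) poly_mono_nat[OF len, of pA] B(8) by linarith
  then obtain s3 where s3: "exec K B (call A ?F 12) ?s2 s3" "snd (s3 ?F) = 0" "tape_holds (s3 ?F) ?y"
      "\<And>i. i < ?F \<or> ?V \<le> i \<Longrightarrow> i \<noteq> 12 \<Longrightarrow> s3 i = ?s2 i"
    using exec_call[OF A _ _ _ _ _ _ t(2), of ?F K 12 ?s2 B] s1(7) K by auto
  define c where "c = fst (s3 ?F)"
  have c: "c (int j) = 2 \<longleftrightarrow> (0, j) \<in> E'" if "j < ?sz" for j
    using s3(3) encode_arcs_nth[OF that, of E'] by (simp add: c_def tape_holds_def bit_symbol_def)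
  have cols: "s3 4 = rt (columns T g x)" "s3 0 = input_tape x"
    using s3(4)[of 4] s3(4)[of 0] s1(2,6) by (simp_all add: ready_def)
  define y where "y = guessed (chosen E')"
  obtain s4 where s4: "exec K B (read_guess nvk ?F ?V) s3 s4" "\<And>j. j \<noteq> ?F \<Longrightarrow> j \<noteq> ?V \<Longrightarrow> s4 j = s3 j"
    "s4 ?V = wt (map bit_symbol (encode_pair x y))"
  proof -
    obtain s4 where s4: "exec K B (read_guess nvk ?F ?V) s3 s4" "\<And>j. j \<noteq> ?F \<Longrightarrow> j \<noteq> ?V \<Longrightarrow> s4 j = s3 j"
      "s4 ?V = wt (map bit_symbol (delimited x @ concat (map (\<lambda>i.
       if columns T g x ! i = 4 \<and> c (2 + int (2 * nvk * i)) = 2 then [c (4 + int (2 * nvk * i)) = 2] else [])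
        [0..<length (columns T g x)])))"
    proof (rule exec_read_guess[of s3 ?F c ?V x "columns T g x" K B nvk])
      show "s3 ?F = (c, 0)" using s3(2) by (simp add: c_def prod_eq_iff)
      show "s3 ?V = blank_tape" using s3(4)[of ?V] s1(7)[of ?V] k by simp
      show "0 \<notin> set (columns T g x)" by (auto simp: columns_def)
    qed (use cols K k B B1 length_columns in auto)
    moreover have "concat (map (\<lambda>i.
       if columns T g x ! i = 4 \<and> c (2 + int (2 * nvk * i)) = 2 then [c (4 + int (2 * nvk * i)) = 2] else [])
        [0..<length (columns T g x)]) = concat (map (\<lambda>i.
       if columns T g x ! i = 4 \<and> chosen E' VE 0 i then [chosen E' VB 0 i] else []) [0..<width])"
      unfolding length_columns
    proof (intro arg_cong[where f = concat] map_cong refl)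
      fix i assume "i \<in> set [0..<width]"
      then have i: "(0 * width + i) * nvk + 1 < nv" unfolding nv_def using nvk_ge by (intro index_less) auto
      have "c (2 + int (2 * nvk * i)) = 2 \<longleftrightarrow> chosen E' VE 0 i"
        using c[of "2 + 2 * nvk * i"] i by (simp add: chosen_VE algebra_simps)
      moreover have "c (4 + int (2 * nvk * i)) = 2 \<longleftrightarrow> chosen E' VB 0 i"
      proof -
        have "2 + 2 * ((0 * width + i) * nvk + 1) = 4 + 2 * nvk * i" by simp
        note idx = this
        have "2 + 2 * nv \<le> ?sz" by (rule le_add1)
        moreover have "2 + 2 * ((0 * width + i) * nvk + 1) < 2 + 2 * nv"
          using i by (intro add_strict_left_mono mult_strict_left_mono) simp_all
        ultimately have "4 + 2 * nvk * i < ?sz" unfolding idx by (rule less_le_trans[rotated])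
        from c[OF this] show ?thesis unfolding chosen_VB idx by simp
      qed
      ultimately show "(if columns T g x ! i = 4 \<and> c (2 + int (2 * nvk * i)) = 2 then [c (4 + int (2 * nvk * i)) = 2] else []) =
         (if columns T g x ! i = 4 \<and> chosen E' VE 0 i then [chosen E' VB 0 i] else [])" by simp
    qed
    ultimately show ?thesis using that[OF s4(1,2)]
      by (simp add: guess_columns y_def guessed_def encode_pair_def)
  qed
  let ?z = "encode_pair x y"
  have lenz: "length ?z \<le> 2 * length x + 1 + g"
    using length_guessed[of "chosen E'"] by (simp add: encode_pair_def length_delimited y_def)
  let ?s5 = "s4(?V := input_tape ?z)"
  have 5: "exec K B (rewind ?V) s4 ?s5"
    unfolding rt_input[symmetric]
    by (rule exec_rewind[where p = "length ?z"])
      (use s4(3) K k B B1 lenz in \<open>auto simp: wt_def bit_symbol_def\<close>)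
  obtain u where u: "u \<le> poly pM (length ?z)"
    "halts_with_output M ((tm_step M ^^ u) (initial_config M ?z)) [?z \<in> V]" using runM by blast
  have "2 * u + 1 \<le> B" using u(1) poly_mono_nat[OF lenz, of pM] B(10) by linarith
  note u2 = this
  have "s4 i = blank_tape" if "i = 13 \<or> ?V < i" for i
    using that s4(2)[of i] s3(4)[of i] s1(7)[of i] by auto
  note facts = this
  obtain s6 where s6: "exec K B (call M ?V 13) ?s5 s6" "snd (s6 ?V) = 0" "tape_holds (s6 ?V) [?z \<in> V]"
      "\<And>i. i < ?V \<or> ?V + num_tapes M \<le> i \<Longrightarrow> i \<noteq> 13 \<Longrightarrow> s6 i = ?s5 i"
    by (rule exec_call[OF M _ _ _ _ _ _ u(2), of ?V K 13 ?s5 B]) (use K facts u2 in auto)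
  have "snd (s6 0) = 0" using s6(4)[of 0] s4(2)[of 0] cols(2) by (simp add: input_tape_def)
  then obtain s7 where s7: "exec K B (answer ?V) s6 s7" "tape_holds (s7 0) [?z \<in> V]"
    using exec_answer[of s6 ?V "?z \<in> V" K B] s6(2,3) K k B1 by auto
  have "exec K B (solve A M pT pg pW pN d) (start x) s7"
    unfolding solve_def Let_def nvk_def[symmetric]
    using exec_mono[OF s1(1) B(6)] 2 s3(1) s4(1) 5 s6(1) s7(1) by blast
  then show ?thesis using s7(2) unfolding y_def by (rule that)
qed

lemma approximation_decides_NP:
  fixes \<epsilon> :: real
  assumes \<epsilon>: "0 < \<epsilon>" "\<epsilon> < 1" and f: "poly_time_computable f"
    and alg: "dindp_approx_algorithm (\<lambda>n. real n powr (1 - \<epsilon>)) f" and L: "L \<in> class_NP"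
  shows "L \<in> class_P"
proof -
  obtain A pA where A: "wf_tm A" and runA: "\<And>z. \<exists>t \<le> poly pA (length z).
      halts_with_output A ((tm_step A ^^ t) (initial_config A z)) (f z)"
    using f unfolding poly_time_computable_def by blast
  obtain V pg where V: "V \<in> class_P" and L: "\<And>x. x \<in> L \<longleftrightarrow>
      (\<exists>y. length y \<le> poly pg (length x) \<and> encode_pair x y \<in> V)"
    using L unfolding class_NP_def by blast
  obtain M pM where M: "wf_tm M" and runM: "\<And>z. \<exists>t \<le> poly pM (length z).
      halts_with_output M ((tm_step M ^^ t) (initial_config M z)) [z \<in> V]"
    using V unfolding class_P_def poly_time_computable_def by blast
  \<comment> \<open>\<open>pl\<close> bounds the length of an encoded pair, and \<open>pT\<close>
    exceeds the time bound of the verifier on such pairs, so that halting happens strictly before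
    time \<open>T\<close>.\<close>
  define pl where "pl = [:1, 2:] + pg"
  define pT where "pT = pcompose pM pl + 1"
  define pW where "pW = 4 * pT + 2 + pl"
  define pv where "pv = (pT + 1) * pW * [:length (var_list M):]"
  define pc where "pc = (pT + 1) * pW * [:length (clause_list M):]"
  \<comment> \<open>The lower bound on \<open>Z\<close> in \<open>gap_ratio\<close>, as a polynomial
    in the input length. Since \<open>k\<close> depends on \<epsilon> only, \<open>pZ ^ k\<close> is
    a polynomial as well.\<close>
  define pZ where "pZ = 4 * (pv + 1) * pc + 2 * pv + 3"
  obtain k where "1 / \<epsilon> \<le> real k" using real_arch_simple by blast
  then have k: "1 \<le> real k * \<epsilon>" using \<epsilon> by (simp add: field_simps)
  define pN where "pN = pZ ^ k"
  \<comment> \<open>A common bound on the degrees; it fixes the number of tapes for powers.\<close>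
  define d where "d = degree pT + degree pg + degree pW + degree pN"
  define pB0 where "pB0 = monom 1 d + [:0, 1:] + 2 * pT + 4 + pW + 3 + pN"
  obtain q where q: "\<And>B. cost B (emit_instance M (15 + d)) = poly q B" using cost_poly by metis
  define pC where "pC = pcompose q pB0"
  define pB where "pB = pB0 + pC + 2 * pcompose pA pC + 1 + pl + 2 * pcompose pM pl + 1"
  define K where "K = 15 + d + num_tapes A + num_tapes M"
  define S where "S = 6 + num_symbols A + num_symbols M"
  have "poly_time_computable (\<lambda>x. [x \<in> L])"
  proof (rule exec_poly_time)
    show "wf_com K S (solve A M pT pg pW pN d)"
      by (rule wf_solve[OF A M]) (auto simp: K_def S_def)
    show "1 \<le> K" "3 \<le> S" by (auto simp: K_def S_def)
    fix x :: "bool list"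
    let ?n = "length x"
    define T g N where "T = poly pT ?n" and "g = poly pg ?n" and "N = poly pN ?n"
    have pl: "poly pl ?n = 2 * ?n + 1 + g" by (simp add: pl_def g_def)
    interpret tableau M T g x by unfold_locales (rule M)
    have width: "width = poly pW ?n" unfolding width_def pW_def by (simp add: pl flip: T_def)
    have Z: "N = poly pZ ?n ^ k" "3 \<le> poly pZ ?n" by (simp_all add: N_def pN_def poly_power pZ_def)
    have red: "reduction M N" using M Z by unfold_locales auto
    interpret reduction M T g x N by (rule red)
    have nv: "nv = poly pv ?n" and nc: "nc = poly pc ?n"
      by (simp_all add: nv_def nc_def nvk_def nck_def pv_def pc_def width flip: T_def)
    have nc1: "1 \<le> nc"
    proof -
      have "KState0 \<in> set (clause_list M)" by (auto simp: clause_list clause_kinds_def)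
      then have "0 < nck" by (auto simp: nck_def)
      then show ?thesis by (simp add: nc_def width_def Suc_le_eq)
    qed
    let ?sz = "2 + 2 * nv + nc * N"
    have card: "card (pverts (inst_graph inst)) = ?sz" by (simp add: gap_instance_def)
    obtain E' where E': "f (encode_instance inst) = encode_arcs (card (pverts (inst_graph inst))) E'"
      "feasible inst E'"
      "solution_cost inst E' \<le> ereal (real (card (pverts (inst_graph inst))) powr (1 - \<epsilon>)) * optimal_cost inst"
      using alg gap_instance_input[of nv nc N hit] unfolding dindp_approx_algorithm_def by blast
    define y where "y = guessed (chosen E')"
    have T: "t < T" if "t \<le> poly pM (length (encode_pair x y'))" "length y' \<le> g" for t y'
    proof -
      have "length (encode_pair x y') \<le> poly pl ?n"
        using that(2) by (simp add: encode_pair_def length_delimited pl)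
      then have "t \<le> poly pM (poly pl ?n)" using that(1) poly_mono_nat le_trans by blast
      then show ?thesis by (simp add: T_def pT_def poly_pcompose)
    qed
    \<comment> \<open>From left to right the string read off is itself a certificate, whatever arcs
      were computed; the approximation ratio enters in the converse.\<close>
    have correct: "encode_pair x y \<in> V \<longleftrightarrow> x \<in> L"
    proof
      assume "encode_pair x y \<in> V"
      then show "x \<in> L" unfolding L using length_guessed[of "chosen E'"] by (auto simp: y_def g_def)
    next
      assume "x \<in> L"
      then obtain y0 where y0: "length y0 \<le> g" "encode_pair x y0 \<in> V" unfolding L g_def by blast
      obtain t0 where t0: "halts_with_output M ((tm_step M ^^ t0) (initial_config M (encode_pair x y0))) [True]"
        using runM[of "encode_pair x y0"] y0(2) by auto
      have "satisfies (chosen E')"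
      proof (rule reduction_gap[OF y0(1) t0 E'(2) E'(3)[unfolded card]])
        show "real ?sz powr (1 - \<epsilon>) * real (?sz * (nv + 1)) < real (N * N * nc)"
          by (rule gap_ratio[OF \<epsilon> k Z(1) _ nc1]) (simp add: nv nc pZ_def)
      qed simp
      moreover obtain t where "t \<le> poly pM (length (encode_pair x y))"
        "halts_with_output M ((tm_step M ^^ t) (initial_config M (encode_pair x y))) [encode_pair x y \<in> V]"
        using runM by blast
      ultimately show "encode_pair x y \<in> V"
        using tableau_sound[of "chosen E'" t] T[of t y] length_guessed[of "chosen E'"] unfolding y_def by blast
    qed
    have B0: "poly pB0 ?n = ?n ^ d + ?n + 2 * T + 4 + width + 3 + N"
      by (simp add: pB0_def poly_monom width flip: T_def N_def)
    have B: "poly pB ?n = poly pB0 ?n + cost (poly pB0 ?n) (emit_instance M (15 + d)) +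
        2 * poly pA (cost (poly pB0 ?n) (emit_instance M (15 + d))) + 1 + (2 * ?n + 1 + g) +
        2 * poly pM (2 * ?n + 1 + g) + 1"
      by (simp add: pB_def pC_def poly_pcompose q pl)
    obtain s' where "exec K (poly pB ?n) (solve A M pT pg pW pN d) (start x) s'"
      "tape_holds (s' 0) [encode_pair x y \<in> V]"
      unfolding y_def
    proof (rule exec_solve[where ?B0.0 = "poly pB0 ?n" and B = "poly pB ?n", OF A runA M runM red T_def g_def width N_def _ _ _ _ K_def E'(1)])
      show "degree pT \<le> d" "degree pg \<le> d" "degree pW \<le> d" "degree pN \<le> d" by (auto simp: d_def)
    qed (use B0 B in linarith)+
    then show "\<exists>s'. exec K (poly pB ?n) (solve A M pT pg pW pN d)
        (\<lambda>i. if i = 0 then input_tape x else blank_tape) s' \<and> tape_holds (s' 0) [x \<in> L]"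
      unfolding correct start_def by blast
  qed
  then show ?thesis by (simp add: class_P_def)
qed

theorem lemmaA2:
  fixes \<epsilon> :: real
  assumes "class_P \<noteq> class_NP"
    and "0 < \<epsilon>" and "\<epsilon> < 1"
  shows "\<not> (\<exists>f. poly_time_computable f \<and>
               dindp_approx_algorithm (\<lambda>n. real n powr (1 - \<epsilon>)) f)"
  using assms approximation_decides_NP class_P_subset_NP by blast

end
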